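(* Let $X$ be a closed Riemann surface of genus at least two with its conformal hyperbolic metric, $n\ge2$, and let $q\in H^0(X,K^k)$, $2\le k\le n$. Let $\gamma$ be a simple closed geodesic of hyperbolic length $\ell_\gamma$. Then at the Fuchsian point $\delta$ of $\mathcal H(\Sigma,n)$ determined by $X$, the first variation of the largest eigenvalue $\lambda_\gamma$ of the holonomy along $\gamma$ in the direction of the standard Hitchin deformation $\psi^0(q)$ is $$d\log\lambda_\gamma\bigl(\psi^0(q)\bigr)=\frac{(-1)^k(n-1)!}{2^{k-2}(n-k)!}\int_0^{\ell_\gamma}\Re\bigl(q(\dot\gamma,\dots,\dot\gamma)\bigr)\,dt ,$$ where $\gamma$ is parametrized by arc length and $q$ is evaluated on $k$ copies of the unit tangent vector $\dot\gamma$.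
   Context: Setting. $X$ is a closed Riemann surface of genus $\ge2$ with its conformal hyperbolic metric of curvature $-1$ and area form $d\sigma$; $\Sigma$ is the underlying oriented surface, $K$ the canonical bundle. Locally $d\sigma=i\,h\,dz\wedge d\bar z$, and the hermitian metric on $K^k$ is $\langle dz^k,dz^k\rangle=h^{-k}$. $\mathcal H(\Sigma,n)$ (the Hitchin component) is the set of conjugacy classes of representations $\pi_1(\Sigma)\to\mathsf{PSL}(n,\mathbb R)$ (lifted to $\mathsf{SL}(n,\mathbb R)$) that can be continuously deformed to a Fuchsian one; the Fuchsian representation attached to $X$ is $\delta=\iota_n\circ\delta_X$, with $\delta_X$ the monodromy of the hyperbolic metric and $\iota_n$ the irreducible representation of $\mathsf{PSL}(2,\mathbb R)$ in $\mathsf{PSL}(n,\mathbb R)$. For a Hitchin representation $\delta$, $\delta(\gamma)$ has $n$ distinct positive eigenvalues; $\lambda_\gamma(\delta)$ is the largest. Standard deformation. Let $a,x,y$ be generators of $\mathfrak{sl}(2)$ with $[a,x]=x$, $[a,y]=-y$, $[x,y]=-a$, and $\kappa_n:\mathfrak{sl}(2)\to\mathfrak{sl}(n,\mathbb C)$ the irreducible embedding given in a unitary basis $\hat w_1,\dots,\hat w_n$ by $X_n=\kappa_n(x)$, $Y_n=\kappa_n(y)$, $-X_n\hat w_p=c_p\hat w_{p+1}$, $Y_n\hat w_p=c_{p-1}\hat w_{p-1}$, $c_p=(p(n-p)/2)^{1/2}$; so $Y_n=\rho(X_n)$ for the Cartan involution $\rho(M)=-M^*$. Put $E^0_k=(-\sqrt2X_n)^k$.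 With $\mathfrak g_m$ the $m$-eigenspace of $\mathrm{ad}\,\kappa_n(a)$ on $\mathfrak{sl}(n,\mathbb C)$, let $\mathcal G=\bigoplus_m\mathfrak g_m\otimes K^m$, with the family of Cartan involutions (also denoted $\rho$) induced by the hermitian metric on $K$, the Chern connection $\nabla$, and Higgs field $\Phi_0=Y_n\otimes1\in\mathfrak g_{-1}\otimes K^{-1}\otimes K$. Then $D=\nabla+\Phi_0-\rho(\Phi_0)$ is flat with monodromy $\delta$. For $q\in H^0(X,K^k)$ set $\phi^0(q)=q\otimes E^0_{k-1}\in\Omega^{1,0}(X,\mathcal G)$ and $\psi^0(q)=\phi^0(q)-\rho(\phi^0(q))$; this is a $D$-closed real $1$-form whose class is a tangent vector in $\mathsf T_\delta\mathcal H(\Sigma,n)$, the standard Hitchin deformation.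
   Formalization: Arc length, the unit vector and ℓ_γ are taken in the hermitian norm |v|²=h|dz(v)|², so ℓ_γ is the hyperbolic length divided by √2; with curvature −1 arc length for the area form i h dz∧dz̄ the printed constant is off by the factor 2^{(k−1)/2}. *)

theory Defs
  imports
    "HOL-Analysis.Analysis"
    "HOL-Homology.Homology"
    "HOL-Algebra.Free_Abelian_Groups"
    "Jordan_Normal_Form.Char_Poly"
begin

section \<open>Smooth functions and Wirtinger derivatives\<close>

text \<open>For open sets in finite-dimensional spaces this is the usual notion of a \<open>C\<^sup>m\<close> function.\<close>

fun Ck_on :: "nat \<Rightarrow> ('b::real_normed_vector \<Rightarrow> 'c::real_normed_vector) \<Rightarrow> 'b set \<Rightarrow> bool" where
  "Ck_on 0 f S = continuous_on S f"
| "Ck_on (Suc m) f S =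
     ((\<forall>x\<in>S. f differentiable (at x)) \<and> (\<forall>v. Ck_on m (\<lambda>x. frechet_derivative f (at x) v) S))"

definition smooth_on :: "('b::real_normed_vector \<Rightarrow> 'c::real_normed_vector) \<Rightarrow> 'b set \<Rightarrow> bool" where
  "smooth_on f S \<longleftrightarrow> (\<forall>m. Ck_on m f S)"

definition d_z :: "(complex \<Rightarrow> complex) \<Rightarrow> complex \<Rightarrow> complex" where
  "d_z f x = (frechet_derivative f (at x) 1 - \<i> * frechet_derivative f (at x) \<i>) / 2"

definition d_zbar :: "(complex \<Rightarrow> complex) \<Rightarrow> complex \<Rightarrow> complex" where
  "d_zbar f x = (frechet_derivative f (at x) 1 + \<i> * frechet_derivative f (at x) \<i>) / 2"


section \<open>Closed Riemann surfaces\<close>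

text \<open>The points of the surface are the elements of a Hausdorff type; a chart is a domain together
  with a local coordinate. Second countability follows from compactness. All tensors below are
  families of local coefficients indexed by the charts of the atlas.\<close>

type_synonym 'a chart = "'a set \<times> ('a \<Rightarrow> complex)"

definition chart_inv :: "'a chart \<Rightarrow> complex \<Rightarrow> 'a" where
  "chart_inv ch = inv_into (fst ch) (snd ch)"

definition riemann_atlas :: "('a::t2_space) chart set \<Rightarrow> bool" where
  "riemann_atlas A \<longleftrightarrow>
     (\<Union>ch\<in>A. fst ch) = UNIV \<and>
     (\<forall>ch\<in>A. open (fst ch) \<and> open (snd ch ` fst ch) \<and>
        homeomorphism (fst ch) (snd ch ` fst ch) (snd ch) (chart_inv ch)) \<and>
     (\<forall>ch\<in>A. \<forall>ch'\<in>A. (snd ch' \<circ> chart_inv ch) holomorphic_on (snd ch ` (fst ch \<inter> fst ch')))"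

definition closed_riemann_surface :: "('a::t2_space) chart set \<Rightarrow> bool" where
  "closed_riemann_surface A \<longleftrightarrow>
     riemann_atlas A \<and> compact (UNIV :: 'a set) \<and> connected (UNIV :: 'a set)"

definition surface_genus :: "('a::t2_space) itself \<Rightarrow> nat \<Rightarrow> bool" where
  "surface_genus _ g \<longleftrightarrow>
     homology_group 1 (euclidean :: 'a topology) \<cong> free_Abelian_group {..<2 * g}"

text \<open>The derivative \<open>dz'/dz\<close> of the coordinate of \<open>ch'\<close> with respect to that of \<open>ch\<close>.\<close>

definition transition_deriv :: "'a chart \<Rightarrow> 'a chart \<Rightarrow> 'a \<Rightarrow> complex" where
  "transition_deriv ch ch' p = deriv (snd ch' \<circ> chart_inv ch) (snd ch p)"


section \<open>Conformal hyperbolic metric, geodesics, holomorphic differentials\<close>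

text \<open>A conformal metric is given by the densities \<open>h\<close> with area form
  \<open>d\<sigma> = i h dz \<and> dz\<bar> = 2 h dx \<and> dy\<close> and hermitian metric \<open>\<langle>dz,dz\<rangle> = 1/h\<close> on the canonical bundle.\<close>

definition conformal_metric :: "('a::t2_space) chart set \<Rightarrow> ('a chart \<Rightarrow> 'a \<Rightarrow> real) \<Rightarrow> bool" where
  "conformal_metric A h \<longleftrightarrow>
     (\<forall>ch\<in>A. (\<forall>p\<in>fst ch. h ch p > 0) \<and> smooth_on (\<lambda>x. h ch (chart_inv ch x)) (snd ch ` fst ch)) \<and>
     (\<forall>ch\<in>A. \<forall>ch'\<in>A. \<forall>p\<in>fst ch \<inter> fst ch'. h ch p = h ch' p * (cmod (transition_deriv ch ch' p))\<^sup>2)"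

definition log_density :: "('a chart \<Rightarrow> 'a \<Rightarrow> real) \<Rightarrow> 'a chart \<Rightarrow> complex \<Rightarrow> complex" where
  "log_density h ch x = complex_of_real (ln (h ch (chart_inv ch x)))"

text \<open>Coefficient of the Chern connection of the tangent bundle: \<open>\<partial> log h = chern_coeff dz\<close>.\<close>

definition chern_coeff :: "('a chart \<Rightarrow> 'a \<Rightarrow> real) \<Rightarrow> 'a chart \<Rightarrow> 'a \<Rightarrow> complex" where
  "chern_coeff h ch p = d_z (log_density h ch) (snd ch p)"

text \<open>The Gauss curvature \<open>\<kappa>\<close> in the form \<open>i \<Theta> = \<kappa> d\<sigma>\<close>, where
  \<open>\<Theta> = - \<partial>\<partial>\<bar> log h\<close> is the Chern curvature of the tangent bundle \<open>K\<^sup>-\<^sup>1\<close> and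
  \<open>d\<sigma> = i h dz \<and> dz\<bar>\<close>; equivalently \<open>\<kappa> = - \<Delta> log(2h) / (2 (2h))\<close>.\<close>

definition gauss_curvature :: "('a chart \<Rightarrow> 'a \<Rightarrow> real) \<Rightarrow> 'a chart \<Rightarrow> 'a \<Rightarrow> complex" where
  "gauss_curvature h ch p =
     - d_z (d_zbar (log_density h ch)) (snd ch p) / complex_of_real (h ch p)"

definition hyperbolic_metric :: "('a::t2_space) chart set \<Rightarrow> ('a chart \<Rightarrow> 'a \<Rightarrow> real) \<Rightarrow> bool" where
  "hyperbolic_metric A h \<longleftrightarrow>
     conformal_metric A h \<and> (\<forall>ch\<in>A. \<forall>p\<in>fst ch. gauss_curvature h ch p = -1)"

definition coord_velocity :: "'a chart \<Rightarrow> (real \<Rightarrow> 'a) \<Rightarrow> real \<Rightarrow> complex" where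
  "coord_velocity ch c t = vector_derivative (\<lambda>s. snd ch (c s)) (at t)"

text \<open>Tangent vectors are measured in the hermitian norm of \<open>K\<^sup>-\<^sup>1\<close> dual to \<open>\<langle>dz,dz\<rangle> = 1/h\<close>, that is
  \<open>\<bar>v\<bar> = sqrt h \<cdot> \<bar>dz(v)\<bar>\<close>. Pitfall: the norm of the Riemannian metric with area form \<open>i h dz \<and> dz\<bar>\<close>
  is \<open>sqrt 2\<close> times this one; the geodesics are the same, but lengths, unit vectors and the
  constants of variation formulas change, and arc length refers to the hermitian norm throughout.\<close>

definition tangent_norm :: "('a chart \<Rightarrow> 'a \<Rightarrow> real) \<Rightarrow> 'a chart \<Rightarrow> 'a \<Rightarrow> complex \<Rightarrow> real" where
  "tangent_norm h ch p v = sqrt (h ch p) * cmod v"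

text \<open>The geodesic equation of a conformal metric reads \<open>z'' + (\<partial>\<^sub>z log h) (z')\<^sup>2 = 0\<close>.\<close>

definition unit_speed_geodesic ::
  "('a::t2_space) chart set \<Rightarrow> ('a chart \<Rightarrow> 'a \<Rightarrow> real) \<Rightarrow> (real \<Rightarrow> 'a) \<Rightarrow> bool" where
  "unit_speed_geodesic A h c \<longleftrightarrow>
     continuous_on UNIV c \<and>
     (\<forall>ch\<in>A. \<forall>t. c t \<in> fst ch \<longrightarrow>
        (\<lambda>s. snd ch (c s)) differentiable (at t) \<and>
        (coord_velocity ch c has_vector_derivative
           - chern_coeff h ch (c t) * (coord_velocity ch c t)\<^sup>2) (at t) \<and>
        tangent_norm h ch (c t) (coord_velocity ch c t) = 1)"

definition simple_closed_geodesic ::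
  "('a::t2_space) chart set \<Rightarrow> ('a chart \<Rightarrow> 'a \<Rightarrow> real) \<Rightarrow> (real \<Rightarrow> 'a) \<Rightarrow> real \<Rightarrow> bool" where
  "simple_closed_geodesic A h c l \<longleftrightarrow>
     unit_speed_geodesic A h c \<and> l > 0 \<and> (\<forall>t. c (t + l) = c t) \<and> inj_on c {0..<l}"

definition holomorphic_differential ::
  "('a::t2_space) chart set \<Rightarrow> nat \<Rightarrow> ('a chart \<Rightarrow> 'a \<Rightarrow> complex) \<Rightarrow> bool" where
  "holomorphic_differential A k q \<longleftrightarrow>
     (\<forall>ch\<in>A. (\<lambda>x. q ch (chart_inv ch x)) holomorphic_on (snd ch ` fst ch)) \<and>
     (\<forall>ch\<in>A. \<forall>ch'\<in>A. \<forall>p\<in>fst ch \<inter> fst ch'. q ch p = q ch' p * transition_deriv ch ch' p ^ k)"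

text \<open>\<open>q(c',\<dots>,c')\<close> at time \<open>t\<close>; the value does not depend on the chart that is chosen.\<close>

definition differential_along ::
  "'a chart set \<Rightarrow> nat \<Rightarrow> ('a chart \<Rightarrow> 'a \<Rightarrow> complex) \<Rightarrow> (real \<Rightarrow> 'a) \<Rightarrow> real \<Rightarrow> complex" where
  "differential_along A k q c t =
     (let ch = (SOME ch. ch \<in> A \<and> c t \<in> fst ch) in q ch (c t) * coord_velocity ch c t ^ k)"


section \<open>The irreducible embedding of \<open>sl(2)\<close>\<close>

text \<open>Row and column indices start at 0: the basis vector \<open>w\<^sub>p\<close> has index \<open>p - 1\<close>.\<close>

definition c_coeff :: "nat \<Rightarrow> nat \<Rightarrow> complex" where
  "c_coeff n p = complex_of_real (sqrt (real p * (real n - real p) / 2))"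

definition X_mat :: "nat \<Rightarrow> complex mat" where
  "X_mat n = mat n n (\<lambda>(i, j). if i = Suc j then - c_coeff n (Suc j) else 0)"

definition Y_mat :: "nat \<Rightarrow> complex mat" where
  "Y_mat n = mat n n (\<lambda>(i, j). if j = Suc i then c_coeff n (Suc i) else 0)"

text \<open>The image of \<open>a = [y,x]\<close>.\<close>

definition a_mat :: "nat \<Rightarrow> complex mat" where
  "a_mat n = Y_mat n * X_mat n - X_mat n * Y_mat n"

definition E0_mat :: "nat \<Rightarrow> nat \<Rightarrow> complex mat" where
  "E0_mat n k = (- complex_of_real (sqrt 2) \<cdot>\<^sub>m X_mat n) ^\<^sub>m k"

lemma c_coeff_sq: "p \<le> n \<Longrightarrow> c_coeff n p * c_coeff n p = of_nat p * (of_nat n - of_nat p) / 2"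
proof -
  assume "p \<le> n"
  then have "real p * (real n - real p) / 2 \<ge> 0" by simp
  then have "sqrt (real p * (real n - real p) / 2) * sqrt (real p * (real n - real p) / 2)
      = real p * (real n - real p) / 2" by simp
  then have "c_coeff n p * c_coeff n p = complex_of_real (real p * (real n - real p) / 2)"
    unfolding c_coeff_def of_real_mult[symmetric] by simp
  then show ?thesis by simp
qed

lemma a_mat_eq:
  "a_mat n = mat n n (\<lambda>(i, j). if i = j then of_nat (Suc i) - (of_nat n + 1) / 2 else 0)"
proof (rule eq_matI)
  fix i j assume "i < dim_row (mat n n (\<lambda>(i, j). if i = j then of_nat (Suc i) - (of_nat n + 1) / 2 else 0 :: complex))"
    "j < dim_col (mat n n (\<lambda>(i, j). if i = j then of_nat (Suc i) - (of_nat n + 1) / 2 else 0 :: complex))"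
  then have ij: "i < n" "j < n" by auto
  have YX: "(Y_mat n * X_mat n) $$ (i, j) =
      (\<Sum>k<n. (if k = Suc i then c_coeff n (Suc i) else 0) * (if k = Suc j then - c_coeff n (Suc j) else 0))"
    using ij by (simp add: Y_mat_def X_mat_def scalar_prod_def atLeast0LessThan)
  also have "\<dots> = (\<Sum>k<n. if k = Suc i then (if i = j then - (c_coeff n (Suc i) * c_coeff n (Suc i)) else 0) else 0)"
    by (intro sum.cong) auto
  also have "\<dots> = (if i = j then - (c_coeff n (Suc i) * c_coeff n (Suc i)) else 0)"
  proof (cases "Suc i < n")
    case True then show ?thesis by simp
  next
    case False
    then have "Suc i = n" using ij by simp
    then show ?thesis by (auto simp: c_coeff_sq)
  qed
  finally have 1: "(Y_mat n * X_mat n) $$ (i, j) =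
      (if i = j then - (of_nat (Suc i) * (of_nat n - of_nat (Suc i)) / 2) else 0)"
    using ij by (simp add: c_coeff_sq)
  have "(X_mat n * Y_mat n) $$ (i, j) =
      (\<Sum>k<n. (if i = Suc k then - c_coeff n (Suc k) else 0) * (if j = Suc k then c_coeff n (Suc k) else 0))"
    using ij by (simp add: Y_mat_def X_mat_def scalar_prod_def atLeast0LessThan)
  also have "\<dots> = (\<Sum>k<n. if i = Suc k then (if i = j then - (c_coeff n i * c_coeff n i) else 0) else 0)"
    by (intro sum.cong) auto
  also have "\<dots> = (if i = j then - (c_coeff n i * c_coeff n i) else 0)"
  proof (cases i)
    case 0 then show ?thesis by (auto simp: c_coeff_def)
  next
    case (Suc m)
    then show ?thesis using ij by auto
  qed
  finally have 2: "(X_mat n * Y_mat n) $$ (i, j) =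
      (if i = j then - (of_nat i * (of_nat n - of_nat i) / 2) else 0)"
    using ij by (simp add: c_coeff_sq)
  show "a_mat n $$ (i, j) =
     mat n n (\<lambda>(i, j). if i = j then of_nat (Suc i) - (of_nat n + 1) / 2 else 0) $$ (i, j)"
    using ij 1 2 by (simp add: a_mat_def X_mat_def Y_mat_def field_simps)
qed (auto simp: a_mat_def X_mat_def Y_mat_def)

text \<open>Hence the \<open>m\<close>-eigenspace \<open>\<g>\<^sub>m\<close> of \<open>ad a\<close> consists of the matrices supported on the
  entries \<open>(i,j)\<close> with \<open>i - j = m\<close>.\<close>

lemma ad_a_mat:
  assumes "M \<in> carrier_mat n n" "i < n" "j < n"
  shows "(a_mat n * M - M * a_mat n) $$ (i, j) = of_int (int i - int j) * M $$ (i, j)"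
proof -
  have 1: "(a_mat n * M) $$ (i, j) = (of_nat (Suc i) - (of_nat n + 1) / 2) * M $$ (i, j)"
  proof -
    have "(a_mat n * M) $$ (i, j) = (\<Sum>k<n. (if i = k then of_nat (Suc i) - (of_nat n + 1) / 2 else 0) * M $$ (k, j))"
      using assms by (simp add: a_mat_eq scalar_prod_def atLeast0LessThan)
    also have "\<dots> = (\<Sum>k<n. if k = i then (of_nat (Suc i) - (of_nat n + 1) / 2) * M $$ (i, j) else 0)"
      by (intro sum.cong) auto
    finally show ?thesis using assms by simp
  qed
  have 2: "(M * a_mat n) $$ (i, j) = M $$ (i, j) * (of_nat (Suc j) - (of_nat n + 1) / 2)"
  proof -
    have "(M * a_mat n) $$ (i, j) = (\<Sum>k<n. M $$ (i, k) * (if k = j then of_nat (Suc k) - (of_nat n + 1) / 2 else 0))"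
      using assms by (simp add: a_mat_eq scalar_prod_def atLeast0LessThan)
    also have "\<dots> = (\<Sum>k<n. if k = j then M $$ (i, j) * (of_nat (Suc j) - (of_nat n + 1) / 2) else 0)"
      by (intro sum.cong) auto
    finally show ?thesis using assms by simp
  qed
  have "a_mat n \<in> carrier_mat n n"
    by (simp add: a_mat_eq)
  then have "(a_mat n * M - M * a_mat n) $$ (i, j) = (a_mat n * M) $$ (i, j) - (M * a_mat n) $$ (i, j)"
    using assms by (intro index_minus_mat) auto
  moreover have "(of_nat (Suc i) - b) * m - m * (of_nat (Suc j) - b) = of_int (int i - int j) * m"
    for b m :: complex
    by (simp add: algebra_simps)
  ultimately show ?thesis
    unfolding 1 2 by metis
qed


section \<open>The bundle \<open>\<G> = \<Oplus>\<^sub>m \<g>\<^sub>m \<otimes> K\<^sup>m\<close>\<close>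

text \<open>In a chart with coordinate \<open>z\<close>, a section \<open>\<Sum>\<^sub>m M\<^sub>m \<otimes> dz\<^sup>m\<close> is written as the matrix
  \<open>M = \<Sum>\<^sub>m M\<^sub>m\<close>, so the entry \<open>(i,j)\<close> is a coefficient of \<open>dz\<^sup>i\<^sup>-\<^sup>j\<close>. A 1-form
  \<open>P dz + Q dz\<bar>\<close> with values in \<open>\<G>\<close> is written as the pair \<open>(P, Q)\<close>.\<close>

definition sl_mat :: "nat \<Rightarrow> complex mat set" where
  "sl_mat n = {M \<in> carrier_mat n n. (\<Sum>i<n. M $$ (i, i)) = 0}"

type_synonym 'a G_form = "'a chart \<Rightarrow> 'a \<Rightarrow> complex mat \<times> complex mat"

definition is_G_form :: "nat \<Rightarrow> ('a::t2_space) chart set \<Rightarrow> 'a G_form \<Rightarrow> bool" where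
  "is_G_form n A \<omega> \<longleftrightarrow>
     (\<forall>ch\<in>A. \<forall>p\<in>fst ch. fst (\<omega> ch p) \<in> sl_mat n \<and> snd (\<omega> ch p) \<in> sl_mat n) \<and>
     (\<forall>ch\<in>A. \<forall>ch'\<in>A. \<forall>p\<in>fst ch \<inter> fst ch'. \<forall>i<n. \<forall>j<n.
        (let \<tau> = transition_deriv ch ch' p in
           fst (\<omega> ch p) $$ (i, j) = fst (\<omega> ch' p) $$ (i, j) * \<tau> powi (int i - int j) * \<tau> \<and>
           snd (\<omega> ch p) $$ (i, j) = snd (\<omega> ch' p) $$ (i, j) * \<tau> powi (int i - int j) * cnj \<tau>))"

definition form_add :: "'a G_form \<Rightarrow> 'a G_form \<Rightarrow> 'a G_form" where
  "form_add \<omega> \<eta> = (\<lambda>ch p. (fst (\<omega> ch p) + fst (\<eta> ch p), snd (\<omega> ch p) + snd (\<eta> ch p)))"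

definition form_diff :: "'a G_form \<Rightarrow> 'a G_form \<Rightarrow> 'a G_form" where
  "form_diff \<omega> \<eta> = (\<lambda>ch p. (fst (\<omega> ch p) - fst (\<eta> ch p), snd (\<omega> ch p) - snd (\<eta> ch p)))"

text \<open>The Cartan involution of the fibre: \<open>\<rho>(M \<otimes> dz\<^sup>m) = - M\<^sup>* \<otimes> h\<^sup>-\<^sup>m dz\<^sup>-\<^sup>m\<close> for \<open>M\<close> in \<open>\<g>\<^sub>m\<close>,
  where \<open>h\<^sup>-\<^sup>m dz\<^sup>-\<^sup>m\<close> is the metric dual of \<open>dz\<^sup>m\<close>. It is conjugate linear, so it exchanges the
  \<open>dz\<close> and \<open>dz\<bar>\<close> parts of a form.\<close>

definition cartan_fibre :: "nat \<Rightarrow> real \<Rightarrow> complex mat \<Rightarrow> complex mat" where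
  "cartan_fibre n r M =
     mat n n (\<lambda>(i, j). - cnj (M $$ (j, i)) * complex_of_real (r powi (int i - int j)))"

definition cartan_form :: "nat \<Rightarrow> ('a chart \<Rightarrow> 'a \<Rightarrow> real) \<Rightarrow> 'a G_form \<Rightarrow> 'a G_form" where
  "cartan_form n h \<omega> =
     (\<lambda>ch p. (cartan_fibre n (h ch p) (snd (\<omega> ch p)), cartan_fibre n (h ch p) (fst (\<omega> ch p))))"

text \<open>Connections are written in charts as \<open>d + [\<omega>, \<cdot>]\<close>. The Chern connection of \<open>K\<^sup>m\<close> is
  \<open>d - m \<partial> log h\<close>, and \<open>ad a\<close> is multiplication by \<open>m\<close> on \<open>\<g>\<^sub>m\<close>.\<close>

definition chern_form :: "nat \<Rightarrow> ('a chart \<Rightarrow> 'a \<Rightarrow> real) \<Rightarrow> 'a G_form" where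
  "chern_form n h = (\<lambda>ch p. (- chern_coeff h ch p \<cdot>\<^sub>m a_mat n, 0\<^sub>m n n))"

definition higgs_form :: "nat \<Rightarrow> 'a G_form" where
  "higgs_form n = (\<lambda>ch p. (Y_mat n, 0\<^sub>m n n))"

definition D_form :: "nat \<Rightarrow> ('a chart \<Rightarrow> 'a \<Rightarrow> real) \<Rightarrow> 'a G_form" where
  "D_form n h =
     form_diff (form_add (chern_form n h) (higgs_form n)) (cartan_form n h (higgs_form n))"

definition phi0 :: "nat \<Rightarrow> nat \<Rightarrow> ('a chart \<Rightarrow> 'a \<Rightarrow> complex) \<Rightarrow> 'a G_form" where
  "phi0 n k q = (\<lambda>ch p. (q ch p \<cdot>\<^sub>m E0_mat n (k - 1), 0\<^sub>m n n))"

definition psi0 ::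
  "nat \<Rightarrow> nat \<Rightarrow> ('a chart \<Rightarrow> 'a \<Rightarrow> real) \<Rightarrow> ('a chart \<Rightarrow> 'a \<Rightarrow> complex) \<Rightarrow> 'a G_form" where
  "psi0 n k h q = form_diff (phi0 n k q) (cartan_form n h (phi0 n k q))"

definition flat_connection :: "nat \<Rightarrow> ('a::t2_space) chart set \<Rightarrow> 'a G_form \<Rightarrow> bool" where
  "flat_connection n A \<omega> \<longleftrightarrow>
     (\<forall>ch\<in>A. \<forall>p\<in>fst ch. \<forall>i<n. \<forall>j<n.
        d_z (\<lambda>x. snd (\<omega> ch (chart_inv ch x)) $$ (i, j)) (snd ch p)
        - d_zbar (\<lambda>x. fst (\<omega> ch (chart_inv ch x)) $$ (i, j)) (snd ch p)
        + (fst (\<omega> ch p) * snd (\<omega> ch p) - snd (\<omega> ch p) * fst (\<omega> ch p)) $$ (i, j) = 0)"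


section \<open>Parallel transport and monodromy\<close>

definition path_velocity :: "'a chart \<Rightarrow> (real \<Rightarrow> 'a) \<Rightarrow> real \<Rightarrow> complex" where
  "path_velocity ch c s = vector_derivative (\<lambda>r. snd ch (c r)) (at s within {0..1})"

definition C1_path :: "('a::t2_space) chart set \<Rightarrow> (real \<Rightarrow> 'a) \<Rightarrow> bool" where
  "C1_path A c \<longleftrightarrow>
     path c \<and>
     (\<forall>ch\<in>A. (\<forall>s\<in>{0..1}. c s \<in> fst ch \<longrightarrow> (\<lambda>r. snd ch (c r)) differentiable (at s within {0..1})) \<and>
        continuous_on {s \<in> {0..1}. c s \<in> fst ch} (path_velocity ch c))"

definition form_along :: "'a G_form \<Rightarrow> 'a chart \<Rightarrow> (real \<Rightarrow> 'a) \<Rightarrow> real \<Rightarrow> complex mat" where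
  "form_along \<omega> ch c s =
     path_velocity ch c s \<cdot>\<^sub>m fst (\<omega> ch (c s)) + cnj (path_velocity ch c s) \<cdot>\<^sub>m snd (\<omega> ch (c s))"

definition parallel_section ::
  "nat \<Rightarrow> ('a::t2_space) chart set \<Rightarrow> 'a G_form \<Rightarrow> (real \<Rightarrow> 'a) \<Rightarrow> ('a chart \<Rightarrow> real \<Rightarrow> complex mat) \<Rightarrow> bool"
  where
  "parallel_section n A \<omega> c M \<longleftrightarrow>
     (\<forall>ch\<in>A. \<forall>s\<in>{0..1}. c s \<in> fst ch \<longrightarrow> M ch s \<in> sl_mat n) \<and>
     (\<forall>ch\<in>A. \<forall>ch'\<in>A. \<forall>s\<in>{0..1}. c s \<in> fst ch \<inter> fst ch' \<longrightarrow> (\<forall>i<n. \<forall>j<n.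
        M ch s $$ (i, j) = M ch' s $$ (i, j) * transition_deriv ch ch' (c s) powi (int i - int j))) \<and>
     (\<forall>ch\<in>A. \<forall>s\<in>{0..1}. c s \<in> fst ch \<longrightarrow> (\<forall>i<n. \<forall>j<n.
        ((\<lambda>r. M ch r $$ (i, j)) has_vector_derivative
           - (form_along \<omega> ch c s * M ch s - M ch s * form_along \<omega> ch c s) $$ (i, j))
          (at s within {0..1})))"

definition based_loop :: "('a::t2_space) \<Rightarrow> (real \<Rightarrow> 'a) \<Rightarrow> bool" where
  "based_loop x0 c \<longleftrightarrow> path c \<and> pathstart c = x0 \<and> pathfinish c = x0"

text \<open>\<open>R\<close> (with values in \<open>PSL(n,\<real>)\<close>, see below) is the monodromy of the connection with form
  \<open>\<omega>\<close>: for some identification of the fibre of \<open>\<G>\<close> over \<open>x0\<close> with \<open>sl(n,\<complex>)\<close>, namely a chart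
  followed by conjugation by \<open>g\<close>, parallel transport along a loop \<open>c\<close> is \<open>Ad (R c)\<close>.\<close>

definition is_monodromy ::
  "nat \<Rightarrow> ('a::t2_space) chart set \<Rightarrow> 'a \<Rightarrow> 'a G_form \<Rightarrow> ((real \<Rightarrow> 'a) \<Rightarrow> real mat) \<Rightarrow> bool" where
  "is_monodromy n A x0 \<omega> R \<longleftrightarrow>
     (\<exists>ch\<in>A. x0 \<in> fst ch \<and>
       (\<exists>g\<in>carrier_mat n n. \<exists>g'\<in>carrier_mat n n. inverts_mat g g' \<and> inverts_mat g' g \<and>
         (\<forall>c. based_loop x0 c \<and> C1_path A c \<longrightarrow>
           (\<forall>M0\<in>sl_mat n. \<exists>M. parallel_section n A \<omega> c M \<and> M ch 0 = M0 \<and>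
              (g * M ch 1 * g') * map_mat complex_of_real (R c) =
              map_mat complex_of_real (R c) * (g * M0 * g')))))"


section \<open>The Hitchin component\<close>

text \<open>Elements of \<open>PSL(n,\<real>)\<close> are represented by lifts to \<open>SL(n,\<real>)\<close>, compared up to sign (for odd
  \<open>n\<close> the determinant condition fixes the sign). A representation of \<open>\<pi>\<^sub>1\<close> is a homotopy invariant
  function of loops. The product of \<open>\<pi>\<^sub>1\<close> is the one for which forward parallel transport is
  multiplicative: the loop \<open>c +++ d\<close>, first \<open>c\<close> and then \<open>d\<close>, represents \<open>[d][c]\<close>.\<close>

definition psl_eq :: "real mat \<Rightarrow> real mat \<Rightarrow> bool" where
  "psl_eq B C \<longleftrightarrow> B = C \<or> B = - C"

definition psl_rep :: "nat \<Rightarrow> ('a::t2_space) \<Rightarrow> ((real \<Rightarrow> 'a) \<Rightarrow> real mat) \<Rightarrow> bool" where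
  "psl_rep n x0 R \<longleftrightarrow>
     (\<forall>c. based_loop x0 c \<longrightarrow> R c \<in> carrier_mat n n \<and> Determinant.det (R c) = 1) \<and>
     (\<forall>c d. based_loop x0 c \<and> based_loop x0 d \<and> homotopic_paths UNIV c d \<longrightarrow> psl_eq (R c) (R d)) \<and>
     (\<forall>c d. based_loop x0 c \<and> based_loop x0 d \<longrightarrow> psl_eq (R (c +++ d)) (R d * R c))"

text \<open>The irreducible representation \<open>\<iota>\<^sub>n\<close>: the action of a 2 by 2 matrix on the homogeneous
  polynomials of degree \<open>n - 1\<close> in \<open>e\<^sub>1, e\<^sub>2\<close> with basis \<open>e\<^sub>1\<^sup>n\<^sup>-\<^sup>1\<^sup>-\<^sup>j e\<^sub>2\<^sup>j\<close>, computed with \<open>e\<^sub>1 = 1\<close>.\<close>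

definition sym_power :: "nat \<Rightarrow> real mat \<Rightarrow> real mat" where
  "sym_power n g = mat n n (\<lambda>(i, j).
     poly.coeff ([:g $$ (0, 0), g $$ (1, 0):] ^ (n - 1 - j) * [:g $$ (0, 1), g $$ (1, 1):] ^ j) i)"

definition fuchsian_rep :: "nat \<Rightarrow> ('a::t2_space) \<Rightarrow> ((real \<Rightarrow> 'a) \<Rightarrow> real mat) \<Rightarrow> bool" where
  "fuchsian_rep n x0 R \<longleftrightarrow>
     (\<exists>S. psl_rep 2 x0 S \<and>
       (\<forall>c. based_loop x0 c \<and> psl_eq (S c) (1\<^sub>m 2) \<longrightarrow> homotopic_paths UNIV c (\<lambda>_. x0)) \<and>
       (\<exists>e>0. \<forall>c. based_loop x0 c \<and>
          (\<exists>B. psl_eq (S c) B \<and> (\<forall>i<2. \<forall>j<2. \<bar>B $$ (i, j) - 1\<^sub>m 2 $$ (i, j)\<bar> < e)) \<longrightarrow>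
          psl_eq (S c) (1\<^sub>m 2)) \<and>
       (\<forall>c. based_loop x0 c \<longrightarrow> psl_eq (R c) (sym_power n (S c))))"

definition hitchin_rep :: "nat \<Rightarrow> ('a::t2_space) \<Rightarrow> ((real \<Rightarrow> 'a) \<Rightarrow> real mat) \<Rightarrow> bool" where
  "hitchin_rep n x0 R \<longleftrightarrow>
     (\<exists>Rs :: real \<Rightarrow> (real \<Rightarrow> 'a) \<Rightarrow> real mat.
       (\<forall>s\<in>{0..1}. psl_rep n x0 (Rs s)) \<and>
       (\<forall>c. based_loop x0 c \<longrightarrow> (\<forall>i<n. \<forall>j<n. continuous_on {0..1} (\<lambda>s. Rs s c $$ (i, j)))) \<and>
       fuchsian_rep n x0 (Rs 0) \<and> Rs 1 = R)"

text \<open>The largest eigenvalue of the lift of \<open>\<plusminus>B\<close> whose eigenvalues are positive.\<close>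

definition largest_eigenvalue :: "real mat \<Rightarrow> real" where
  "largest_eigenvalue B = Max {x. x > 0 \<and> (eigenvalue B x \<or> eigenvalue (- B) x)}"


section \<open>Tangent vectors of the Hitchin component\<close>

text \<open>A path \<open>\<delta>\<close> of representations in the Hitchin component starting at the monodromy of
  \<open>D\<close> is tangent to (the class of) the \<open>\<G>\<close>-valued 1-form \<open>\<psi>\<close> if \<open>\<delta> t\<close> is the monodromy of a
  flat connection \<open>D + \<beta> t\<close> for a smooth family \<open>\<beta>\<close> with \<open>\<beta> 0 = 0\<close> and derivative \<open>\<psi>\<close> at 0.\<close>

definition tangent_path ::
  "nat \<Rightarrow> ('a::t2_space) chart set \<Rightarrow> ('a chart \<Rightarrow> 'a \<Rightarrow> real) \<Rightarrow> 'a \<Rightarrow> 'a G_form \<Rightarrow>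
   (real \<Rightarrow> (real \<Rightarrow> 'a) \<Rightarrow> real mat) \<Rightarrow> bool" where
  "tangent_path n A h x0 \<psi> \<delta> \<longleftrightarrow>
     (\<exists>e>0. \<exists>\<beta> :: real \<Rightarrow> 'a G_form.
       (\<forall>ch\<in>A. \<forall>i<n. \<forall>j<n.
          smooth_on (\<lambda>(t, x). fst (\<beta> t ch (chart_inv ch x)) $$ (i, j)) ({-e<..<e} \<times> snd ch ` fst ch) \<and>
          smooth_on (\<lambda>(t, x). snd (\<beta> t ch (chart_inv ch x)) $$ (i, j)) ({-e<..<e} \<times> snd ch ` fst ch)) \<and>
       (\<forall>ch\<in>A. \<forall>p\<in>fst ch. \<beta> 0 ch p = (0\<^sub>m n n, 0\<^sub>m n n) \<and> (\<forall>i<n. \<forall>j<n.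
          ((\<lambda>t. fst (\<beta> t ch p) $$ (i, j)) has_vector_derivative fst (\<psi> ch p) $$ (i, j)) (at 0) \<and>
          ((\<lambda>t. snd (\<beta> t ch p) $$ (i, j)) has_vector_derivative snd (\<psi> ch p) $$ (i, j)) (at 0))) \<and>
       (\<forall>t\<in>{-e<..<e}.
          is_G_form n A (\<beta> t) \<and>
          flat_connection n A (form_add (D_form n h) (\<beta> t)) \<and>
          hitchin_rep n x0 (\<delta> t) \<and>
          is_monodromy n A x0 (form_add (D_form n h) (\<beta> t)) (\<delta> t)))"

end

theory Submission
  imports Defs
begin

hide_const (open) Module.smult UnivPoly.coeff UnivPoly.monom Determinants.det Polynomial.content

text \<open>Rescaling the entry \<open>(i,j)\<close> by \<open>v\<^sup>i\<^sup>-\<^sup>j\<close>, where \<open>v\<close> is the coordinate velocity of the unit speed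
  geodesic, removes the Chern connection, and parallel transport for \<open>D + \<beta>\<close> becomes
  \<open>M' = - [T + b, M]\<close> with the constant matrix \<open>T = Y - X\<close> and \<open>b = t (Q E + (Q E)\<^sup>*) + o(t)\<close>, where
  \<open>E = E\<^sup>0\<^sub>k\<^sub>-\<^sub>1\<close> and \<open>Q = q(\<gamma>',\<dots>,\<gamma>')\<close>. The matrix \<open>T\<close> has the eigenvalues \<open>(n - 1 - 2 j) / sqrt 2\<close>, and its
  eigenvectors are given by Krawtchouk polynomials. In the eigenbasis, after removing the factor
  \<open>exp(- s T)\<close>, the transport is that of a connection \<open>G\<close> of size \<open>O(t)\<close>. So it is \<open>1 - ad \<Gamma> + O(t\<^sup>2)\<close>,
  where \<open>\<Gamma>\<close> is the integral of \<open>G\<close>, and the holonomy is a multiple of \<open>exp(- l T) (1 - \<Gamma>)\<close> up to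
  \<open>O(t\<^sup>2)\<close>; the determinant condition fixes the modulus of the multiple. Hence the logarithm of the largest
  eigenvalue varies by \<open>- Re \<Gamma>\<close> at the top eigenvector \<open>u\<close> of \<open>exp(- l T)\<close>, that is by
  \<open>- 2 \<langle>E u, u\<rangle> / \<langle>u, u\<rangle>\<close> times the integral of \<open>Re Q\<close>.\<close>

text \<open>The monodromy is given only through its adjoint action on the fibre, and for every
  \<open>t\<close> with its own chart and its own identification \<open>g\<close>. So no continuity
  of \<open>\<delta> t\<close> in \<open>t\<close> is available to be differentiated, and transport
  cannot see a scalar factor. The proof therefore collects bounds of order \<open>t^2\<close>, valid
  for each single \<open>t\<close> and insensitive to conjugation and scaling; differentiability at
  \<open>0\<close> is a consequence of these bounds.

  Origin of the constant: the top eigenvector of \<open>exp(- l T)\<close> belongs to the smallest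
  eigenvalue of \<open>T\<close>, and in the monomial basis it is \<open>(1 - x)^(n - 1)\<close>.
  Its alternating signs give \<open>(-1)^(k - 1)\<close>, and the sign in front of
  \<open>\<Gamma>\<close> makes this \<open>(-1)^k\<close>. Raising the degree \<open>k - 1\<close>
  times gives \<open>(n - 1)! / (n - k)!\<close>. A sum of binomial coefficients divided by the
  squared norm \<open>2^(n - 1)\<close> leaves \<open>1 / 2^(k - 1)\<close>, and the adjoint term in
  \<open>b\<close> doubles the result, hence \<open>2^(k - 2)\<close>.\<close>

section \<open>Diagonalisation of the matrix \<open>Y - X\<close>\<close>

lemma square_mult_carrier [simp]:
  "A \<in> carrier_mat n n \<Longrightarrow> B \<in> carrier_mat n n \<Longrightarrow> A * B \<in> carrier_mat n n"
  by (rule mult_carrier_mat)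

lemma mult_mat_entry:
  assumes "A \<in> carrier_mat n n" "B \<in> carrier_mat n n" "i < n" "j < n"
  shows "(A * B) $$ (i, j) = (\<Sum>k<n. A $$ (i, k) * B $$ (k, j))"
  using assms by (simp add: scalar_prod_def atLeast0LessThan)

definition diag_w :: "nat \<Rightarrow> (nat \<Rightarrow> complex) \<Rightarrow> complex mat" where
  "diag_w n w = mat n n (\<lambda>(i, j). if i = j then w i else 0)"

lemma diag_w_carrier [simp]: "diag_w n w \<in> carrier_mat n n"
  by (simp add: diag_w_def)

lemma diag_w_mult_entry:
  assumes "M \<in> carrier_mat n n" "i < n" "j < n"
  shows "(diag_w n w * M) $$ (i, j) = w i * M $$ (i, j)" "(M * diag_w n w) $$ (i, j) = M $$ (i, j) * w j"
proof -
  have "(diag_w n w * M) $$ (i, j) = (\<Sum>k<n. diag_w n w $$ (i, k) * M $$ (k, j))"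
    using assms by (intro mult_mat_entry) auto
  also have "\<dots> = (\<Sum>k<n. if k = i then w i * M $$ (i, j) else 0)"
    using assms by (intro sum.cong) (auto simp: diag_w_def)
  finally show "(diag_w n w * M) $$ (i, j) = w i * M $$ (i, j)" using assms by simp
  have "(M * diag_w n w) $$ (i, j) = (\<Sum>k<n. M $$ (i, k) * diag_w n w $$ (k, j))"
    using assms by (intro mult_mat_entry) auto
  also have "\<dots> = (\<Sum>k<n. if k = j then M $$ (i, j) * w j else 0)"
    using assms by (intro sum.cong) (auto simp: diag_w_def)
  finally show "(M * diag_w n w) $$ (i, j) = M $$ (i, j) * w j" using assms by simp
qed

lemma diag_w_inverse:
  assumes "\<And>i. w i \<noteq> 0"
  shows "diag_w n w * diag_w n (\<lambda>i. 1 / w i) = 1\<^sub>m n" "diag_w n (\<lambda>i. 1 / w i) * diag_w n w = 1\<^sub>m n"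
  using assms by (auto intro!: eq_matI simp: diag_w_mult_entry) (auto simp: diag_w_def)

lemma det_diag_w: "det (diag_w n w) = (\<Prod>i<n. w i)"
proof -
  have "upper_triangular (diag_w n w)" by (auto simp: diag_w_def)
  then have "det (diag_w n w) = prod_list (diag_mat (diag_w n w))"
    by (rule det_upper_triangular[of _ n]) simp
  then show ?thesis
    by (simp add: diag_mat_def diag_w_def prod.list_conv_set_nth atLeast0LessThan)
qed

text \<open>The image of \<open>x^j\<close> under the action of the matrix with rows
  \<open>1, 1\<close> and \<open>1, -1\<close> on polynomials of degree at most \<open>N\<close>.
  This matrix diagonalises \<open>T\<close> for \<open>n = 2\<close>, hence its symmetric powers
  diagonalise \<open>T\<close> in every size. The coefficients are values of Krawtchouk
  polynomials.\<close>

definition kraw_poly :: "nat \<Rightarrow> nat \<Rightarrow> complex poly" where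
  "kraw_poly N j = [:1, 1:] ^ (N - j) * [:1, -1:] ^ j"

lemma degree_kraw_poly: "j \<le> N \<Longrightarrow> degree (kraw_poly N j) = N"
  by (simp add: kraw_poly_def degree_mult_eq degree_power_eq)

text \<open>Up to the weights \<open>sqrt (N choose p)\<close> and the factor \<open>1 / sqrt 2\<close>, the matrix \<open>Y - X\<close> acts on
  coefficient vectors as \<open>f \<mapsto> N x f + (1 - x\<^sup>2) f'\<close>.\<close>

lemma kraw_poly_ode:
  "[:0, of_nat (a + b):] * ([:1, 1:] ^ a * [:1, -1:] ^ b) + [:1, 0, -1:] * pderiv ([:1, 1:] ^ a * [:1, -1:] ^ b)
     = smult (of_nat a - of_nat b) ([:1, 1:] ^ a * [:1, -1:] ^ b :: complex poly)"
proof -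
  \<comment> \<open>A further factor \<open>1 + e x\<close> with \<open>e^2 = 1\<close> raises
    \<open>N\<close> by one and shifts the eigenvalue by \<open>e\<close>, because
    \<open>x (1 + e x) + (1 - x^2) e = x + e = e (1 + e x)\<close>.\<close>
  have 1: "[:0, of_nat (N + 1):] * ([:1, e:] * f) + [:1, 0, -1:] * pderiv ([:1, e:] * f) = smult (\<nu> + e) ([:1, e:] * f)"
    if "[:0, of_nat N:] * f + [:1, 0, -1:] * pderiv f = smult \<nu> f" and "e * e = 1"
    for N \<nu> e and f :: "complex poly"
  proof -
    have "poly ([:0, of_nat (N + 1):] * ([:1, e:] * f) + [:1, 0, -1:] * pderiv ([:1, e:] * f)) x
        = poly (smult (\<nu> + e) ([:1, e:] * f)) x" for x
    proof -
      have h: "of_nat N * x * poly f x + (1 - x * x) * poly (pderiv f) x = \<nu> * poly f x"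
        using arg_cong[OF that(1), of "\<lambda>p. poly p x"] by (simp add: algebra_simps)
      have "poly ([:0, of_nat (N + 1):] * ([:1, e:] * f) + [:1, 0, -1:] * pderiv ([:1, e:] * f)) x
        = (1 + x * e) * (of_nat N * x * poly f x + (1 - x * x) * poly (pderiv f) x) + (x * (e * e) + e + x - x * (e * e)) * poly f x
          + (x * x * e - x * x * e) * poly f x"
        unfolding pderiv_mult using that(2) by (simp add: pderiv_pCons algebra_simps)
      also have "\<dots> = poly (smult (\<nu> + e) ([:1, e:] * f)) x"
        unfolding h using that(2) by (simp add: algebra_simps)
      finally show ?thesis .
    qed
    then show ?thesis by (metis poly_eq_poly_eq_iff ext)
  qed
  show ?thesis
  proof (induction a)
    case 0
    show ?case
    proof (induction b)
      case 0 then show ?case by simp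
    next
      case (Suc b)
      from 1[of b "[:1, -1:] ^ b" "- of_nat b" "-1"] Suc show ?case by (simp add: algebra_simps)
    qed
  next
    case (Suc a)
    have "of_nat (Suc a) - of_nat b = (of_nat a - of_nat b + 1 :: complex)" "Suc a + b = (a + b) + 1" by simp_all
    then show ?case using 1[OF Suc.IH mult_1_left] by (simp only: power_Suc mult.assoc)
  qed
qed

text \<open>Comparison of the coefficients of \<open>x^p\<close> in the differential equation. Only
  the two neighbours of \<open>p\<close> enter, which is the tridiagonal shape of
  \<open>Y - X\<close>.\<close>

lemma kraw_poly_recurrence:
  assumes "j \<le> N"
  shows "(of_nat N + 1 - of_nat p) * (if p = 0 then 0 else coeff (kraw_poly N j) (p - 1))
      + of_nat (p + 1) * coeff (kraw_poly N j) (p + 1)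
    = (of_nat N - 2 * of_nat j) * coeff (kraw_poly N j) p"
proof -
  let ?f = "kraw_poly N j"
  have "[:0, of_nat N:] * ?f + [:1, 0, -1:] * pderiv ?f = smult (of_nat N - 2 * of_nat j) ?f"
    using kraw_poly_ode[of "N - j" j] assms by (simp add: kraw_poly_def of_nat_diff)
  then have "coeff ([:0, of_nat N:] * ?f + [:1, 0, -1:] * pderiv ?f) p = (of_nat N - 2 * of_nat j) * coeff ?f p"
    by simp
  then show ?thesis
    by (cases p; cases "p - 1") (auto simp: coeff_pderiv algebra_simps coeff_pCons split: nat.splits)
qed

text \<open>The sum is a matrix entry of the square of \<open>f \<mapsto> (1 + x)\<^sup>N f((1 - x) / (1 + x))\<close>, and
  \<open>x \<mapsto> (1 - x) / (1 + x)\<close> is an involution.\<close>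

lemma kraw_involution:
  assumes "i \<le> N" "m \<le> N"
  shows "(\<Sum>j\<le>N. coeff (kraw_poly N j) i * coeff (kraw_poly N m) j) = (if i = m then 2 ^ N else 0)"
proof -
  let ?P = "(\<Sum>j\<le>N. smult (coeff (kraw_poly N m) j) (kraw_poly N j))" and ?Q = "monom (2 ^ N) m :: complex poly"
  have *: "poly ?P x = poly ?Q x" if "x \<noteq> -1" for x
  proof -
    \<comment> \<open>Here \<open>1 + y = 2 / (1 + x)\<close> and
      \<open>1 - y = 2 x / (1 + x)\<close>, so a second substitution returns \<open>x^m\<close> up
      to powers of \<open>2\<close> and of \<open>1 + x\<close>.\<close>
    define y where "y = (1 - x) / (1 + x)"
    from that have x: "1 + x \<noteq> 0" by (metis add.commute add_eq_0_iff)
    have y1: "(1 + x) * (1 + y) = 2" "(1 + x) * (1 - y) = 2 * x" "(1 + x) * y = 1 - x"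
      using x by (simp_all add: y_def field_simps)
    have "poly ?P x = (\<Sum>j\<le>N. coeff (kraw_poly N m) j * ((1 + x) ^ (N - j) * (1 - x) ^ j))"
      by (simp add: poly_sum kraw_poly_def)
    also have "\<dots> = (\<Sum>j\<le>N. coeff (kraw_poly N m) j * ((1 + x) ^ N * y ^ j))"
    proof (rule sum.cong[OF refl])
      fix j assume "j \<in> {..N}"
      then have "(1 + x) ^ N = (1 + x) ^ (N - j) * (1 + x) ^ j" by (simp flip: power_add)
      then have "(1 + x) ^ N * y ^ j = (1 + x) ^ (N - j) * ((1 + x) * y) ^ j"
        unfolding power_mult_distrib by (simp add: algebra_simps)
      then show "coeff (kraw_poly N m) j * ((1 + x) ^ (N - j) * (1 - x) ^ j) = coeff (kraw_poly N m) j * ((1 + x) ^ N * y ^ j)"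
        unfolding y1 by simp
    qed
    also have "\<dots> = (1 + x) ^ N * poly (kraw_poly N m) y"
      by (simp add: poly_altdef degree_kraw_poly assms sum_distrib_left algebra_simps)
    also have "\<dots> = ((1 + x) ^ (N - m) * (1 + x) ^ m) * ((1 + y) ^ (N - m) * (1 - y) ^ m)"
      using assms by (simp add: kraw_poly_def flip: power_add)
    also have "\<dots> = ((1 + x) * (1 + y)) ^ (N - m) * ((1 + x) * (1 - y)) ^ m"
      unfolding power_mult_distrib by (simp add: algebra_simps)
    also have "\<dots> = 2 ^ (N - m) * 2 ^ m * x ^ m" unfolding y1 power_mult_distrib by simp
    also have "\<dots> = poly ?Q x" using assms by (simp add: poly_monom flip: power_add)
    finally show ?thesis .
  qed
  \<comment> \<open>The substitution has a pole at \<open>-1\<close>. The extra factor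
    \<open>1 + x\<close> vanishes there, so the product is zero everywhere and the factor can be
    cancelled among polynomials.\<close>
  have "poly ([:1, 1:] * (?P - ?Q)) x = 0" for x
    using *[of x] by (cases "x = -1") auto
  then have "[:1, 1:] * (?P - ?Q) = 0" by (metis poly_all_0_iff_0)
  then have "?P = ?Q" by (metis mult_eq_0_iff one_neq_zero pCons_eq_0_iff right_minus_eq)
  then have "coeff ?P i = coeff ?Q i" by simp
  then show ?thesis by (simp add: coeff_sum mult.commute)
qed

text \<open>In the invariant hermitian form the monomial \<open>x^p\<close> has norm
  \<open>1 / sqrt (N choose p)\<close>. A coefficient divided by this weight is a coordinate in the
  orthonormal basis in which \<open>X_mat\<close> and \<open>Y_mat\<close> are written.\<close>

definition binom_weight :: "nat \<Rightarrow> nat \<Rightarrow> real" where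
  "binom_weight N p = sqrt (real (N choose p))"

lemma binom_weight_pos: "p \<le> N \<Longrightarrow> binom_weight N p > 0"
  by (simp add: binom_weight_def)

lemma binom_weight_sq: "binom_weight N p * binom_weight N p = real (N choose p)"
  by (simp add: binom_weight_def)

text \<open>Square roots of \<open>(N choose p) * (N - p) = (N choose Suc p) * Suc p\<close>,
  multiplied by \<open>N - p\<close> or by \<open>Suc p\<close>. In this form the coefficients
  \<open>c_coeff\<close> turn into integers over \<open>sqrt 2\<close> in the monomial
  basis.\<close>

lemma binom_weight_Suc:
  assumes "p < N"
  shows "binom_weight N (Suc p) * sqrt (real (Suc p) * (real N - real p)) = binom_weight N p * (real N - real p)"
    and "binom_weight N p * sqrt (real (Suc p) * (real N - real p)) = binom_weight N (Suc p) * real (Suc p)"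
proof -
  have "real ((N choose p) * (N - p)) = real ((N choose Suc p) * Suc p)"
    by (metis Suc_times_binomial_eq assms binomial_absorb_comp diff_Suc_1 gr0_implies_Suc less_nat_zero_code mult.commute not_gr_zero)
  then have e: "real (N choose p) * (real N - real p) = real (N choose Suc p) * real (Suc p)"
    using assms by (simp add: of_nat_diff algebra_simps)
  have "binom_weight N (Suc p) * sqrt (real (Suc p) * (real N - real p)) = sqrt (real (N choose Suc p) * real (Suc p) * (real N - real p))"
    by (simp add: binom_weight_def real_sqrt_mult mult.assoc)
  also have "\<dots> = sqrt (real (N choose p) * (real N - real p) ^ 2)" by (simp only: e[symmetric]) (simp add: power2_eq_square mult.assoc)
  also have "\<dots> = binom_weight N p * (real N - real p)" using assms by (simp add: binom_weight_def real_sqrt_mult)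
  finally show "binom_weight N (Suc p) * sqrt (real (Suc p) * (real N - real p)) = binom_weight N p * (real N - real p)" .
  have "binom_weight N p * sqrt (real (Suc p) * (real N - real p)) = sqrt (real (N choose p) * (real N - real p) * real (Suc p))"
    by (simp add: binom_weight_def real_sqrt_mult)
  also have "\<dots> = sqrt (real (N choose Suc p) * (real (Suc p)) ^ 2)" by (simp only: e) (simp add: power2_eq_square mult.assoc)
  also have "\<dots> = binom_weight N (Suc p) * real (Suc p)" by (simp only: real_sqrt_mult binom_weight_def) simp
  finally show "binom_weight N p * sqrt (real (Suc p) * (real N - real p)) = binom_weight N (Suc p) * real (Suc p)" .
qed

definition kraw_mat :: "nat \<Rightarrow> complex mat" where
  "kraw_mat n = mat n n (\<lambda>(i, j). coeff (kraw_poly (n - 1) j) i / complex_of_real (binom_weight (n - 1) i))"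

text \<open>With \<open>K\<close> the matrix of coefficients and \<open>W\<close> the diagonal
  matrix of weights, \<open>kraw_mat\<close> is \<open>W^-1 K\<close>. Since
  \<open>K^2 = 2^(n - 1)\<close> by \<open>kraw_involution\<close>, the inverse is
  \<open>K W / 2^(n - 1)\<close>.\<close>

definition kraw_inv_mat :: "nat \<Rightarrow> complex mat" where
  "kraw_inv_mat n = mat n n (\<lambda>(i, j).
     coeff (kraw_poly (n - 1) j) i * complex_of_real (binom_weight (n - 1) j) / 2 ^ (n - 1))"

lemma kraw_mat_carrier [simp]: "kraw_mat n \<in> carrier_mat n n" "kraw_inv_mat n \<in> carrier_mat n n"
  by (simp_all add: kraw_mat_def kraw_inv_mat_def)

lemma kraw_inv_mult: "kraw_inv_mat n * kraw_mat n = 1\<^sub>m n"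
proof (rule eq_matI)
  fix i j assume ij: "i < dim_row (1\<^sub>m n)" "j < dim_col (1\<^sub>m n)"
  then have n: "{..<n} = {..n - 1}" "i \<le> n - 1" "j \<le> n - 1" by auto
  have "(kraw_inv_mat n * kraw_mat n) $$ (i, j) = (\<Sum>k<n. kraw_inv_mat n $$ (i, k) * kraw_mat n $$ (k, j))"
    using ij by (intro mult_mat_entry) auto
  also have "\<dots> = (\<Sum>k<n. coeff (kraw_poly (n - 1) k) i * coeff (kraw_poly (n - 1) j) k / 2 ^ (n - 1))"
  proof (rule sum.cong[OF refl])
    fix k assume k: "k \<in> {..<n}"
    then have "binom_weight (n - 1) k > 0" by (intro binom_weight_pos) auto
    then show "kraw_inv_mat n $$ (i, k) * kraw_mat n $$ (k, j)
      = coeff (kraw_poly (n - 1) k) i * coeff (kraw_poly (n - 1) j) k / 2 ^ (n - 1)"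
      using ij k by (simp add: kraw_inv_mat_def kraw_mat_def)
  qed
  also have "\<dots> = (\<Sum>k\<le>n - 1. coeff (kraw_poly (n - 1) k) i * coeff (kraw_poly (n - 1) j) k) / 2 ^ (n - 1)"
    by (simp add: n(1) sum_divide_distrib)
  also have "\<dots> = (1\<^sub>m n) $$ (i, j)"
    using kraw_involution[OF n(2,3)] ij by simp
  finally show "(kraw_inv_mat n * kraw_mat n) $$ (i, j) = (1\<^sub>m n) $$ (i, j)" .
qed (simp_all add: kraw_inv_mat_def kraw_mat_def)

lemma kraw_mult_inv: "kraw_mat n * kraw_inv_mat n = 1\<^sub>m n"
  using mat_mult_left_right_inverse[OF _ _ kraw_inv_mult] by simp

text \<open>The factor \<open>1 / sqrt 2\<close> is the one contained in \<open>c_coeff\<close>. The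
  values decrease in \<open>b\<close>, so the largest eigenvalue of \<open>exp(- l T)\<close> has
  index \<open>n - 1\<close>.\<close>

definition T_eig :: "nat \<Rightarrow> nat \<Rightarrow> real" where
  "T_eig n b = (real (n - 1) - 2 * real b) / sqrt 2"

lemma sum_two_entries:
  assumes "p < (n::nat)"
  shows "(\<Sum>k<n. (if k = Suc p then f k else if p = Suc k then g k else 0))
     = (if Suc p < n then f (Suc p) else 0) + (if p = 0 then 0 else g (p - 1 :: nat) :: complex)"
proof -
  have "(\<Sum>k<n. (if k = Suc p then f k else if p = Suc k then g k else 0))
    = (\<Sum>k<n. (if k = Suc p then f k else 0)) + (\<Sum>k<n. (if k = p - 1 \<and> p \<noteq> 0 then g k else 0))"
    unfolding sum.distrib[symmetric] by (intro sum.cong) auto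
  then show ?thesis using assms by (cases "p = 0") (auto simp: sum.delta)
qed

lemma c_coeff_weights:
  assumes "Suc p < n"
  shows "c_coeff n (Suc p) / complex_of_real (binom_weight (n - 1) (Suc p))
      = of_nat (Suc p) / complex_of_real (sqrt 2 * binom_weight (n - 1) p)"
    and "c_coeff n (Suc p) / complex_of_real (binom_weight (n - 1) p)
      = (of_nat (n - 1) - of_nat p) / complex_of_real (sqrt 2 * binom_weight (n - 1) (Suc p))"
proof -
  have c: "sqrt (real (Suc p) * (real n - real (Suc p)) / 2) = sqrt (real (Suc p) * (real (n - 1) - real p)) / sqrt 2"
    using assms by (simp add: real_sqrt_divide of_nat_diff)
  have w: "binom_weight (n - 1) p > 0" "binom_weight (n - 1) (Suc p) > 0"
    using assms by (auto intro!: binom_weight_pos)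
  note b = binom_weight_Suc[of p "n - 1"]
  have "sqrt (real (Suc p) * (real n - real (Suc p)) / 2) / binom_weight (n - 1) (Suc p)
      = real (Suc p) / (sqrt 2 * binom_weight (n - 1) p)"
    unfolding c using b(2) assms w by (simp add: field_simps)
  then show "c_coeff n (Suc p) / complex_of_real (binom_weight (n - 1) (Suc p))
      = of_nat (Suc p) / complex_of_real (sqrt 2 * binom_weight (n - 1) p)"
    unfolding c_coeff_def by (metis of_real_divide of_real_of_nat_eq)
  have "sqrt (real (Suc p) * (real n - real (Suc p)) / 2) / binom_weight (n - 1) p
      = (real (n - 1) - real p) / (sqrt 2 * binom_weight (n - 1) (Suc p))"
    unfolding c using b(1) assms w by (simp add: field_simps)
  then show "c_coeff n (Suc p) / complex_of_real (binom_weight (n - 1) p)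
      = (of_nat (n - 1) - of_nat p) / complex_of_real (sqrt 2 * binom_weight (n - 1) (Suc p))"
    unfolding c_coeff_def by (metis of_real_divide of_real_diff of_real_of_nat_eq)
qed

lemma XY_mat_carrier [simp]: "X_mat n \<in> carrier_mat n n" "Y_mat n \<in> carrier_mat n n"
  by (simp_all add: X_mat_def Y_mat_def)

lemma T_kraw:
  assumes "p < n" "b < n"
  shows "((Y_mat n - X_mat n) * kraw_mat n) $$ (p, b) = complex_of_real (T_eig n b) * kraw_mat n $$ (p, b)"
proof -
  define K where "K i = coeff (kraw_poly (n - 1) b) i" for i
  define w where "w i = complex_of_real (binom_weight (n - 1) i)" for i
  have Sb: "kraw_mat n $$ (i, b) = K i / w i" if "i < n" for i
    using that assms by (simp add: kraw_mat_def K_def w_def)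
  have "((Y_mat n - X_mat n) * kraw_mat n) $$ (p, b) = (\<Sum>k<n. (Y_mat n - X_mat n) $$ (p, k) * kraw_mat n $$ (k, b))"
    using assms by (intro mult_mat_entry) (auto intro!: minus_carrier_mat)
  also have "\<dots> = (\<Sum>k<n. (if k = Suc p then c_coeff n (Suc p) * (K k / w k) else if p = Suc k then c_coeff n (Suc k) * (K k / w k) else 0))"
  proof (rule sum.cong[OF refl])
    fix k assume k: "k \<in> {..<n}"
    then have "(Y_mat n - X_mat n) $$ (p, k) = (if k = Suc p then c_coeff n (Suc p) else if p = Suc k then c_coeff n (Suc k) else 0)"
      using assms by (auto simp: X_mat_def Y_mat_def)
    then show "(Y_mat n - X_mat n) $$ (p, k) * kraw_mat n $$ (k, b) = (if k = Suc p then c_coeff n (Suc p) * (K k / w k) else if p = Suc k then c_coeff n (Suc k) * (K k / w k) else 0)"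
      using k Sb by auto
  qed
  also have "\<dots> = (if Suc p < n then c_coeff n (Suc p) * (K (Suc p) / w (Suc p)) else 0)
       + (if p = 0 then 0 else c_coeff n (Suc (p - 1)) * (K (p - 1) / w (p - 1)))"
    by (rule sum_two_entries[OF assms(1)])
  also have "(if Suc p < n then c_coeff n (Suc p) * (K (Suc p) / w (Suc p)) else 0)
      = of_nat (p + 1) * K (p + 1) / (sqrt 2 * w p)"
  proof (cases "Suc p < n")
    case True
    have "c_coeff n (Suc p) * (K (Suc p) / w (Suc p)) = c_coeff n (Suc p) / w (Suc p) * K (Suc p)" by simp
    also have "\<dots> = of_nat (p + 1) * K (p + 1) / (sqrt 2 * w p)"
      unfolding w_def c_coeff_weights(1)[OF True] by simp
    finally show ?thesis using True by simp
  next
    case False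
    \<comment> \<open>In the last row the neighbour \<open>p + 1\<close> lies outside the matrix.
      The recurrence still has a term for it, which vanishes because the polynomial has degree
      \<open>n - 1\<close>.\<close>
    then have "degree (kraw_poly (n - 1) b) < p + 1" using assms by (simp add: degree_kraw_poly)
    then have "K (p + 1) = 0" unfolding K_def by (rule coeff_eq_0)
    then show ?thesis using False by simp
  qed
  also have "(if p = 0 then 0 else c_coeff n (Suc (p - 1)) * (K (p - 1) / w (p - 1)))
      = (of_nat (n - 1) + 1 - of_nat p) * (if p = 0 then 0 else K (p - 1)) / (sqrt 2 * w p)"
  proof (cases p)
    case (Suc m)
    have m: "Suc m < n" using Suc assms by simp
    have "c_coeff n (Suc m) * (K m / w m) = c_coeff n (Suc m) / w m * K m" by simp
    also have "\<dots> = (of_nat (n - 1) - of_nat m) * K m / (sqrt 2 * w (Suc m))"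
      unfolding w_def c_coeff_weights(2)[OF m] by simp
    finally show ?thesis using Suc by simp
  qed simp
  also have "of_nat (p + 1) * K (p + 1) / (sqrt 2 * w p) + (of_nat (n - 1) + 1 - of_nat p) * (if p = 0 then 0 else K (p - 1)) / (sqrt 2 * w p)
      = ((of_nat (n - 1) + 1 - of_nat p) * (if p = 0 then 0 else K (p - 1)) + of_nat (p + 1) * K (p + 1)) / (sqrt 2 * w p)"
    by (simp only: add_divide_distrib add.commute)
  also have "\<dots> = ((of_nat (n - 1) - 2 * of_nat b) * K p) / (sqrt 2 * w p)"
    unfolding K_def using assms by (subst kraw_poly_recurrence) auto
  also have "\<dots> = complex_of_real (T_eig n b) * kraw_mat n $$ (p, b)"
    using assms by (simp add: Sb T_eig_def)
  finally show ?thesis .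
qed

lemma kraw_inv_T_kraw:
  assumes "i < n" "j < n"
  shows "(kraw_inv_mat n * ((Y_mat n - X_mat n) * kraw_mat n)) $$ (i, j) = (if i = j then complex_of_real (T_eig n j) else 0)"
proof -
  have "(kraw_inv_mat n * ((Y_mat n - X_mat n) * kraw_mat n)) $$ (i, j)
     = (\<Sum>k<n. kraw_inv_mat n $$ (i, k) * ((Y_mat n - X_mat n) * kraw_mat n) $$ (k, j))"
    using assms by (intro mult_mat_entry) (auto intro!: minus_carrier_mat mult_carrier_mat[of _ n n])
  also have "\<dots> = (\<Sum>k<n. complex_of_real (T_eig n j) * (kraw_inv_mat n $$ (i, k) * kraw_mat n $$ (k, j)))"
    using assms by (intro sum.cong) (auto simp: T_kraw)
  also have "\<dots> = complex_of_real (T_eig n j) * (kraw_inv_mat n * kraw_mat n) $$ (i, j)"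
    using assms by (subst mult_mat_entry[of _ n]) (auto simp: sum_distrib_left)
  finally show ?thesis using assms by (simp add: kraw_inv_mult)
qed

text \<open>Column \<open>n - 1\<close> comes from \<open>(1 - x)^(n - 1)\<close>, row
  \<open>n - 1\<close> of the inverse from the leading coefficients of
  \<open>(1 + x)^(n - 1 - p) (1 - x)^p\<close>. Both are multiples of one real vector
  \<open>u\<close> of squared norm \<open>2^(n - 1)\<close>, so in the eigenbasis the last diagonal
  entry of a matrix \<open>M\<close> is the quotient of \<open><M u, u>\<close> by
  \<open><u, u>\<close>.\<close>

lemma kraw_top:
  assumes "p < n"
  shows "kraw_mat n $$ (p, n - 1) = (-1) ^ p * complex_of_real (binom_weight (n - 1) p)"
    and "kraw_inv_mat n $$ (n - 1, p) = (-1) ^ p * complex_of_real (binom_weight (n - 1) p) / 2 ^ (n - 1)"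
proof -
  have w: "binom_weight (n - 1) p > 0" using assms by (intro binom_weight_pos) auto
  have "coeff ([:1, -1:] ^ (n - 1)) p = of_nat (n - 1 choose p) * (-1) ^ p"
    using assms by (subst coeff_linear_poly_power) auto
  then show "kraw_mat n $$ (p, n - 1) = (-1) ^ p * complex_of_real (binom_weight (n - 1) p)"
    using assms w by (simp add: kraw_mat_def kraw_poly_def field_simps of_real_mult[symmetric] binom_weight_sq del: of_real_mult)
  have "coeff (kraw_poly (n - 1) p) (n - 1) = lead_coeff (kraw_poly (n - 1) p)"
    using degree_kraw_poly[of p "n - 1"] assms by simp
  also have "\<dots> = (-1) ^ p" by (simp add: kraw_poly_def lead_coeff_mult lead_coeff_power)
  finally show "kraw_inv_mat n $$ (n - 1, p) = (-1) ^ p * complex_of_real (binom_weight (n - 1) p) / 2 ^ (n - 1)"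
    using assms by (simp add: kraw_inv_mat_def)
qed

section \<open>Powers of the raising matrix and their expectation in the top eigenvector\<close>

lemma E0_mat_carrier [simp]: "E0_mat n m \<in> carrier_mat n n"
  by (simp add: E0_mat_def)

text \<open>In the monomial basis \<open>- sqrt 2 X\<close> sends \<open>x^j\<close> to
  \<open>(N - j) x^(j + 1)\<close> with \<open>N = n - 1\<close>. Its power produces a falling
  factorial, and the quotient of weights translates back to the orthonormal basis.\<close>

lemma E0_mat_entry:
  assumes "i < n" "j < n"
  shows "E0_mat n m $$ (i, j) =
    (if i = j + m then complex_of_real (binom_weight (n - 1) j / binom_weight (n - 1) i * (\<Prod>r<m. real (n - 1) - real (j + r))) else 0)"
  using assms
proof (induction m arbitrary: i j)
  case 0
  then have "j \<le> n - 1" by simp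
  from binom_weight_pos[OF this] 0 show ?case by (auto simp: E0_mat_def X_mat_def)
next
  case (Suc m)
  let ?X = "- complex_of_real (sqrt 2) \<cdot>\<^sub>m X_mat n"
  have X: "?X \<in> carrier_mat n n" by simp
  have "E0_mat n (Suc m) $$ (i, j) = (E0_mat n m * ?X) $$ (i, j)" by (simp add: E0_mat_def)
  also have "\<dots> = (\<Sum>k<n. E0_mat n m $$ (i, k) * ?X $$ (k, j))"
    using Suc.prems by (intro mult_mat_entry) auto
  also have "\<dots> = (\<Sum>k<n. if k = Suc j then E0_mat n m $$ (i, Suc j) * (complex_of_real (sqrt 2) * c_coeff n (Suc j)) else 0)"
    using Suc.prems by (intro sum.cong) (auto simp: X_mat_def)
  also have "\<dots> = (if Suc j < n then E0_mat n m $$ (i, Suc j) * (complex_of_real (sqrt 2) * c_coeff n (Suc j)) else 0)"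
    by simp
  also have "\<dots> = (if i = j + Suc m then complex_of_real (binom_weight (n - 1) j / binom_weight (n - 1) i * (\<Prod>r<Suc m. real (n - 1) - real (j + r))) else 0)"
  proof (cases "Suc j < n")
    case False
    then show ?thesis using Suc.prems by auto
  next
    case True
    have w: "binom_weight (n - 1) (Suc j) > 0" using True by (intro binom_weight_pos) auto
    have s: "sqrt 2 * sqrt (real (Suc j) * (real n - real (Suc j)) / 2) = sqrt (real (Suc j) * (real (n - 1) - real j))"
      using True by (simp add: real_sqrt_mult[symmetric] of_nat_diff)
    have "complex_of_real (sqrt 2) * c_coeff n (Suc j) = complex_of_real (sqrt (real (Suc j) * (real (n - 1) - real j)))"
      unfolding c_coeff_def of_real_mult[symmetric] s ..
    also have "sqrt (real (Suc j) * (real (n - 1) - real j)) = binom_weight (n - 1) j / binom_weight (n - 1) (Suc j) * (real (n - 1) - real j)"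
      using binom_weight_Suc(1)[of j "n - 1"] True w by (simp add: field_simps)
    finally have e: "complex_of_real (sqrt 2) * c_coeff n (Suc j) = complex_of_real (binom_weight (n - 1) j / binom_weight (n - 1) (Suc j) * (real (n - 1) - real j))" .
    have "(\<Prod>r<Suc m. real (n - 1) - real (j + r)) = (real (n - 1) - real j) * (\<Prod>r<m. real (n - 1) - real (Suc j + r))"
      by (subst prod.lessThan_Suc_shift) simp
    then have "binom_weight (n - 1) (Suc j) / b * (\<Prod>r<m. real (n - 1) - real (Suc j + r)) *
        (binom_weight (n - 1) j / binom_weight (n - 1) (Suc j) * (real (n - 1) - real j))
      = binom_weight (n - 1) j / b * (\<Prod>r<Suc m. real (n - 1) - real (j + r))" for b
      using w by simp
    then show ?thesis using True Suc.prems unfolding e Suc.IH[OF Suc.prems(1) True]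
      by (auto simp only: of_real_mult[symmetric] if_True if_False mult_zero_left add_Suc_right add_Suc split: if_splits)
  qed
  finally show ?case .
qed

text \<open>Only \<open>i = j + m\<close> contributes; there the signs combine to
  \<open>(-1)^m\<close> and the weight of \<open>i\<close> cancels. What remains is \<open>(N choose
  j) (N - j)! / (N - j - m)! = N! / (N - m)! (N - m choose j)\<close> with \<open>N = n - 1\<close>,
  and these binomial coefficients sum to \<open>2^(N - m)\<close>.\<close>

lemma E0_mat_expectation_aux:
  assumes "m < n"
  shows "(\<Sum>j<n. \<Sum>i<n. if i = j + m then (-1) ^ i * (-1) ^ j * (binom_weight (n - 1) i * binom_weight (n - 1) j *
           (binom_weight (n - 1) j / binom_weight (n - 1) i * (\<Prod>r<m. real (n - 1) - real (j + r)))) else 0)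
       = (-1) ^ m * 2 ^ (n - 1 - m) * fact (n - 1) / fact (n - 1 - m)" (is "?L = _")
proof -
  let ?N = "n - 1"
  have "?L = (\<Sum>j<n. if j + m < n then (-1) ^ m * (fact ?N / fact (?N - m) * real (?N - m choose j)) else 0)"
  proof (rule sum.cong[OF refl])
    fix j assume j: "j \<in> {..<n}"
    show "(\<Sum>i<n. if i = j + m then (-1) ^ i * (-1) ^ j * (binom_weight (n - 1) i * binom_weight (n - 1) j *
           (binom_weight (n - 1) j / binom_weight (n - 1) i * (\<Prod>r<m. real (n - 1) - real (j + r)))) else 0)
      = (if j + m < n then (-1) ^ m * (fact ?N / fact (?N - m) * real (?N - m choose j)) else 0)"
    proof (cases "j + m < n")
      case True
      have w: "binom_weight ?N (j + m) > 0" using True by (intro binom_weight_pos) auto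
      have p: "(\<Prod>r<m. real ?N - real (j + r)) = fact (?N - j) / fact (?N - j - m)"
        using True
      proof (induction m)
        case (Suc m)
        have "(\<Prod>r<Suc m. real ?N - real (j + r)) = fact (?N - j) / fact (?N - j - m) * (real ?N - real (j + m))"
          using Suc by simp
        moreover have "?N - j - m = Suc (?N - j - Suc m)" "real ?N - real (j + m) = real (?N - j - m)" 
          using Suc.prems by (auto simp: of_nat_diff)
        ultimately show ?case by (metis (no_types, lifting) fact_Suc fact_nonzero nonzero_divide_mult_cancel_left of_nat_fact times_divide_eq_left times_divide_eq_right divide_divide_eq_left mult.commute mult_divide_mult_cancel_left nat.distinct(1) of_nat_eq_0_iff)
      qed simp
      have "(-1) ^ (j + m) * (-1) ^ j * (binom_weight ?N (j + m) * binom_weight ?N j *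
           (binom_weight ?N j / binom_weight ?N (j + m) * (\<Prod>r<m. real ?N - real (j + r))))
          = (-1) ^ m * ((binom_weight ?N j * binom_weight ?N j) * (\<Prod>r<m. real ?N - real (j + r)))"
        using w by (simp add: power_add mult.assoc flip: power_mult_distrib)
      also have "\<dots> = (-1) ^ m * (real (?N choose j) * (fact (?N - j) / fact (?N - j - m)))"
        unfolding p binom_weight_sq ..
      also have "real (?N choose j) * (fact (?N - j) / fact (?N - j - m)) = fact ?N / fact (?N - m) * real (?N - m choose j)"
      proof -
        have "?N - m - j = ?N - j - m" "j \<le> ?N" "j \<le> ?N - m" using True by simp_all
        then show ?thesis by (simp add: binomial_fact del: One_nat_def)
      qed
      finally show ?thesis using True by simp
    qed simp
  qed
  also have "\<dots> = (\<Sum>j\<le>?N - m. (-1) ^ m * (fact ?N / fact (?N - m) * real (?N - m choose j)))"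
    using assms by (intro sum.mono_neutral_cong_right) auto
  also have "\<dots> = (-1) ^ m * (fact ?N / fact (?N - m) * real (\<Sum>j\<le>?N - m. ?N - m choose j))"
    by (simp only: sum_distrib_left[symmetric] of_nat_sum)
  also have "\<dots> = (-1) ^ m * 2 ^ (n - 1 - m) * fact (n - 1) / fact (n - 1 - m)"
    by (simp only: choose_row_sum) simp
  finally show ?thesis .
qed

text \<open>The expectations of \<open>E0_mat n m\<close> and of its adjoint in the top eigenvector;
  they agree because matrix and vector are real. Dividing by the squared norm
  \<open>2^(n - 1)\<close> leaves \<open>2^m\<close> in the denominator.\<close>

lemma E0_mat_expectation:
  assumes "m < n"
  shows "(\<Sum>i<n. \<Sum>j<n. kraw_inv_mat n $$ (n - 1, i) * E0_mat n m $$ (i, j) * kraw_mat n $$ (j, n - 1))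
       = complex_of_real ((-1) ^ m * fact (n - 1) / (2 ^ m * fact (n - 1 - m)))" (is "?A = ?R")
    and "(\<Sum>i<n. \<Sum>j<n. kraw_inv_mat n $$ (n - 1, i) * cnj (E0_mat n m $$ (j, i)) * kraw_mat n $$ (j, n - 1))
       = complex_of_real ((-1) ^ m * fact (n - 1) / (2 ^ m * fact (n - 1 - m)))" (is "?B = ?R")
proof -
  define F where "F i j = (if i = j + m then (-1) ^ i * (-1) ^ j * (binom_weight (n - 1) i * binom_weight (n - 1) j *
           (binom_weight (n - 1) j / binom_weight (n - 1) i * (\<Prod>r<m. real (n - 1) - real (j + r)))) else 0)" for i j
  have S: "(\<Sum>j<n. \<Sum>i<n. F i j) / 2 ^ (n - 1) = (-1) ^ m * fact (n - 1) / (2 ^ m * fact (n - 1 - m))"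
  proof -
    have "2 ^ (n - 1) = (2 ^ (n - 1 - m) * 2 ^ m :: real)" using assms by (simp flip: power_add)
    then show ?thesis unfolding F_def E0_mat_expectation_aux[OF assms] by simp
  qed
  have "?A = (\<Sum>i<n. \<Sum>j<n. complex_of_real (F i j / 2 ^ (n - 1)))"
    by (intro sum.cong refl) (auto simp: F_def kraw_top E0_mat_entry simp del: One_nat_def)
  also have "\<dots> = complex_of_real ((\<Sum>i<n. \<Sum>j<n. F i j) / 2 ^ (n - 1))"
    by (simp only: of_real_sum sum_divide_distrib)
  finally show "?A = ?R" unfolding S[symmetric] by (subst sum.swap)
  have "?B = (\<Sum>i<n. \<Sum>j<n. complex_of_real (F j i / 2 ^ (n - 1)))"
    by (intro sum.cong refl) (auto simp: F_def kraw_top E0_mat_entry simp del: One_nat_def)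
  also have "\<dots> = complex_of_real ((\<Sum>i<n. \<Sum>j<n. F j i) / 2 ^ (n - 1))"
    by (simp only: of_real_sum sum_divide_distrib)
  finally show "?B = ?R" unfolding S[symmetric] .
qed

section \<open>Transport along a small connection\<close>

lemma mat_entries_bound_mult:
  fixes A B :: "complex mat"
  assumes "A \<in> carrier_mat n n" "B \<in> carrier_mat n n" "i < n" "j < n"
    and "\<And>i j. i < n \<Longrightarrow> j < n \<Longrightarrow> cmod (A $$ (i, j)) \<le> a"
    and "\<And>i j. i < n \<Longrightarrow> j < n \<Longrightarrow> cmod (B $$ (i, j)) \<le> b"
  shows "cmod ((A * B) $$ (i, j)) \<le> real n * a * b"
proof -
  have a: "0 \<le> a" using assms(5)[OF assms(3,4)] norm_ge_zero order_trans by blast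
  have "cmod ((A * B) $$ (i, j)) \<le> (\<Sum>k<n. cmod (A $$ (i, k) * B $$ (k, j)))"
    unfolding mult_mat_entry[OF assms(1-4)] by (rule norm_sum)
  also have "\<dots> \<le> (\<Sum>k<n. a * b)"
    unfolding norm_mult using assms a by (intro sum_mono mult_mono) auto
  finally show ?thesis by (simp add: mult.assoc)
qed

lemma commutator_entry:
  fixes A B :: "complex mat"
  assumes "A \<in> carrier_mat n n" "B \<in> carrier_mat n n" "i < n" "j < n"
  shows "(A * B - B * A) $$ (i, j) = (\<Sum>k<n. A $$ (i, k) * B $$ (k, j)) - (\<Sum>k<n. B $$ (i, k) * A $$ (k, j))"
proof -
  have "(A * B - B * A) $$ (i, j) = (A * B) $$ (i, j) - (B * A) $$ (i, j)"
    using assms by (intro index_minus_mat) auto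
  then show ?thesis using assms by (simp only: mult_mat_entry)
qed

lemma commutator_entry_bound:
  fixes A B :: "complex mat"
  assumes "A \<in> carrier_mat n n" "B \<in> carrier_mat n n" "i < n" "j < n"
    and "\<And>i j. i < n \<Longrightarrow> j < n \<Longrightarrow> cmod (A $$ (i, j)) \<le> a"
    and "\<And>i j. i < n \<Longrightarrow> j < n \<Longrightarrow> cmod (B $$ (i, j)) \<le> b"
  shows "cmod ((A * B - B * A) $$ (i, j)) \<le> 2 * real n * a * b"
proof -
  have "(A * B - B * A) $$ (i, j) = (A * B) $$ (i, j) - (B * A) $$ (i, j)"
    using assms by (intro index_minus_mat) auto
  then have "cmod ((A * B - B * A) $$ (i, j)) \<le> cmod ((A * B) $$ (i, j)) + cmod ((B * A) $$ (i, j))"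
    using norm_triangle_ineq4 by metis
  also have "\<dots> \<le> real n * a * b + real n * b * a"
    using assms by (intro add_mono mat_entries_bound_mult) auto
  finally show ?thesis by (simp add: algebra_simps)
qed

text \<open>No Gronwall estimate is needed: the maximum of \<open>\<bar>M\<bar>\<close> over the interval bounds itself.\<close>

lemma small_transport_estimate:
  fixes G M :: "real \<Rightarrow> complex mat"
  assumes G: "\<And>s. s \<in> {0..1} \<Longrightarrow> G s \<in> carrier_mat n n"
    and M: "\<And>s. s \<in> {0..1} \<Longrightarrow> M s \<in> carrier_mat n n"
    and contG: "\<And>i j. i < n \<Longrightarrow> j < n \<Longrightarrow> continuous_on {0..1} (\<lambda>s. G s $$ (i, j))"
    and deriv: "\<And>s i j. s \<in> {0..1} \<Longrightarrow> i < n \<Longrightarrow> j < n \<Longrightarrow>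
      ((\<lambda>s. M s $$ (i, j)) has_vector_derivative - (G s * M s - M s * G s) $$ (i, j)) (at s within {0..1})"
    and eps: "\<And>s i j. s \<in> {0..1} \<Longrightarrow> i < n \<Longrightarrow> j < n \<Longrightarrow> cmod (G s $$ (i, j)) \<le> \<epsilon>"
    and small: "4 * real n * \<epsilon> \<le> 1" and "n > 0"
    and init: "\<And>i j. i < n \<Longrightarrow> j < n \<Longrightarrow> cmod (M 0 $$ (i, j)) \<le> 1"
    and \<Gamma>: "\<Gamma> = mat n n (\<lambda>(i, j). integral {0..1} (\<lambda>s. G s $$ (i, j)))"
    and ij: "i < n" "j < n"
  shows "cmod (M 1 $$ (i, j) - M 0 $$ (i, j) + (\<Gamma> * M 0 - M 0 * \<Gamma>) $$ (i, j)) \<le> 8 * (real n)\<^sup>2 * \<epsilon>\<^sup>2"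
proof -
  have eps0: "0 \<le> \<epsilon>" using order_trans[OF norm_ge_zero eps[of 0 0 0]] \<open>n > 0\<close> by simp
  have contM: "continuous_on {0..1} (\<lambda>s. M s $$ (i, j))" if "i < n" "j < n" for i j
    unfolding continuous_on_eq_continuous_within
    by (intro ballI has_vector_derivative_continuous[OF deriv[OF _ that]])
  have "\<exists>B. \<forall>s\<in>{0..1}. cmod (M s $$ (i, j)) \<le> B" if "i < n" "j < n" for i j
    using compact_imp_bounded[OF compact_continuous_image[OF contM[OF that] compact_Icc]]
    unfolding bounded_iff by auto
  then obtain B where B: "\<And>i j s. i < n \<Longrightarrow> j < n \<Longrightarrow> s \<in> {0..1} \<Longrightarrow> cmod (M s $$ (i, j)) \<le> B i j" by metis
  \<comment> \<open>The commutator mixes the entries, so one bound has to serve for all entries and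
    all times at once.\<close>
  define S where "S = (\<Union>s\<in>{0..1}. \<Union>i\<in>{..<n}. \<Union>j\<in>{..<n}. {cmod (M s $$ (i, j))})"
  define m where "m = Sup S"
  have bdd: "bdd_above S"
  proof (rule bdd_aboveI)
    fix x assume "x \<in> S"
    then obtain s i j where x: "x = cmod (M s $$ (i, j))" "s \<in> {0..1}" "i < n" "j < n" by (auto simp: S_def)
    have "x \<le> B i j" using x B by auto
    also have "\<dots> = (\<Sum>p\<in>{(i, j)}. B (fst p) (snd p))" by simp
    also have "\<dots> \<le> (\<Sum>p\<in>{..<n} \<times> {..<n}. B (fst p) (snd p))"
    proof (rule sum_mono2)
      show "0 \<le> B (fst p) (snd p)" if "p \<in> {..<n} \<times> {..<n} - {(i, j)}" for p
        using that B[of "fst p" "snd p" 0] by (auto intro: order_trans[OF norm_ge_zero])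
    qed (use x in auto)
    finally show "x \<le> (\<Sum>p\<in>{..<n} \<times> {..<n}. B (fst p) (snd p))" .
  qed
  have Mm: "cmod (M s $$ (i, j)) \<le> m" if "s \<in> {0..1}" "i < n" "j < n" for s i j
    unfolding m_def by (rule cSup_upper[OF _ bdd]) (use that in \<open>unfold S_def, blast\<close>)
  have Sne: "S \<noteq> {}" using \<open>n > 0\<close> by (auto simp: S_def)
  have diff: "cmod (M s $$ (i, j) - M 0 $$ (i, j)) \<le> 2 * real n * \<epsilon> * m" if "s \<in> {0..1}" "i < n" "j < n" for s i j
  proof -
    have "cmod (M s $$ (i, j) - M 0 $$ (i, j)) \<le> (2 * real n * \<epsilon> * m) * norm (s - 0)"
    proof (rule differentiable_bound[where f' = "\<lambda>s h. h *\<^sub>R - (G s * M s - M s * G s) $$ (i, j)"])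
      show "convex {0..1::real}" by simp
      fix r assume r: "r \<in> {0..1::real}"
      show "((\<lambda>s. M s $$ (i, j)) has_derivative (\<lambda>h. h *\<^sub>R - (G r * M r - M r * G r) $$ (i, j))) (at r within {0..1})"
        using deriv[OF r that(2,3)] by (simp add: has_vector_derivative_def)
      have "cmod ((G r * M r - M r * G r) $$ (i, j)) \<le> 2 * real n * \<epsilon> * m"
        using G M r that eps Mm by (intro commutator_entry_bound) auto
      moreover have "onorm (\<lambda>h. h *\<^sub>R - (G r * M r - M r * G r) $$ (i, j)) \<le> cmod ((G r * M r - M r * G r) $$ (i, j))"
        by (rule onorm_le) simp
      ultimately show "onorm (\<lambda>h. h *\<^sub>R - (G r * M r - M r * G r) $$ (i, j)) \<le> 2 * real n * \<epsilon> * m" by linarith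
    qed (use that in auto)
    also have "\<dots> \<le> (2 * real n * \<epsilon> * m) * 1"
    proof (rule mult_left_mono)
      show "norm (s - 0) \<le> 1" using that by simp
      have "0 \<le> m" using norm_ge_zero Mm[OF that] by (rule order_trans)
      then show "0 \<le> 2 * real n * \<epsilon> * m" using eps0 by simp
    qed
    finally show ?thesis by simp
  qed
  have m0: "0 \<le> m" using order_trans[OF norm_ge_zero Mm[of 0 0 0]] \<open>n > 0\<close> by simp
  have "m \<le> 1 + 2 * real n * \<epsilon> * m"
    unfolding m_def
  proof (rule cSup_least[OF Sne], fold m_def)
    fix x assume "x \<in> S"
    then obtain s i j where x: "x = cmod (M s $$ (i, j))" "s \<in> {0..1}" "i < n" "j < n" by (auto simp: S_def)
    have "x \<le> cmod (M 0 $$ (i, j)) + cmod (M s $$ (i, j) - M 0 $$ (i, j))"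
      unfolding x(1) using norm_triangle_sub by blast
    with diff[OF x(2-4)] init[OF x(3,4)] show "x \<le> 1 + 2 * real n * \<epsilon> * m" by linarith
  qed
  \<comment> \<open>The smallness of \<open>\<epsilon>\<close> gives
    \<open>2 n \<epsilon> m \<le> m / 2\<close>, which is absorbed into the left-hand side of the
    preceding inequality.\<close>
  moreover have "(4 * real n * \<epsilon>) * m \<le> 1 * m" by (rule mult_right_mono[OF small m0])
  ultimately have m2: "m \<le> 2" by linarith
  have diff': "cmod ((M s - M 0) $$ (i, j)) \<le> 4 * real n * \<epsilon>" if "s \<in> {0..1}" "i < n" "j < n" for s i j
  proof -
    have "(2 * real n * \<epsilon>) * m \<le> (2 * real n * \<epsilon>) * 2" using eps0 by (intro mult_left_mono[OF m2]) simp
    then have "2 * real n * \<epsilon> * m \<le> 4 * real n * \<epsilon>" by simp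
    moreover have "(M s - M 0) $$ (i, j) = M s $$ (i, j) - M 0 $$ (i, j)"
      using M[of 0] M[of s] that by (intro index_minus_mat) auto
    ultimately show ?thesis using diff[OF that] by (auto intro: order_trans)
  qed
  \<comment> \<open>The commutator is split at \<open>M 0\<close>. The part \<open>C\<close>
    integrates to the commutator with \<open>\<Gamma>\<close>; the part \<open>R\<close> is a
    commutator of two small factors, bounded by \<open>2 n\<close> times \<open>\<epsilon>\<close>
    times \<open>4 n \<epsilon>\<close>, and this is the constant \<open>8 n^2\<close>.\<close>
  define R where "R s = (G s * (M s - M 0) - (M s - M 0) * G s) $$ (i, j)" for s
  define C where "C s = (G s * M 0 - M 0 * G s) $$ (i, j)" for s
  have M0: "M 0 \<in> carrier_mat n n" using M by simp
  have split: "(G s * M s - M s * G s) $$ (i, j) = C s + R s" if "s \<in> {0..1}" for s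
  proof -
    have d: "M s - M 0 \<in> carrier_mat n n" using M0 M[OF that] by (intro minus_carrier_mat)
    have e: "(M s - M 0) $$ (a, b) = M s $$ (a, b) - M 0 $$ (a, b)" if "a < n" "b < n" for a b
      using M0 M[OF \<open>s \<in> {0..1}\<close>] that by (intro index_minus_mat) auto
    show ?thesis
      unfolding C_def R_def commutator_entry[OF G[OF that] M[OF that] ij] commutator_entry[OF G[OF that] M0 ij]
        commutator_entry[OF G[OF that] d ij]
      using ij by (simp add: e sum.distrib sum_subtractf algebra_simps)
  qed
  have Cint: "(C has_integral (\<Gamma> * M 0 - M 0 * \<Gamma>) $$ (i, j)) {0..1}"
  proof -
    have g: "((\<lambda>s. G s $$ (a, b)) has_integral \<Gamma> $$ (a, b)) {0..1}" if "a < n" "b < n" for a b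
      using integrable_integral[OF integrable_continuous_interval[OF contG[OF that]]] that by (simp add: \<Gamma>)
    have "((\<lambda>s. (\<Sum>k<n. G s $$ (i, k) * M 0 $$ (k, j)) - (\<Sum>k<n. M 0 $$ (i, k) * G s $$ (k, j)))
       has_integral (\<Sum>k<n. \<Gamma> $$ (i, k) * M 0 $$ (k, j)) - (\<Sum>k<n. M 0 $$ (i, k) * \<Gamma> $$ (k, j))) {0..1}"
      using ij by (intro has_integral_diff has_integral_sum has_integral_mult_left has_integral_mult_right g) auto
    moreover have "(\<Gamma> * M 0 - M 0 * \<Gamma>) $$ (i, j) = (\<Sum>k<n. \<Gamma> $$ (i, k) * M 0 $$ (k, j)) - (\<Sum>k<n. M 0 $$ (i, k) * \<Gamma> $$ (k, j))"
      using M0 ij \<Gamma> by (intro commutator_entry) auto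
    moreover have "C s = (\<Sum>k<n. G s $$ (i, k) * M 0 $$ (k, j)) - (\<Sum>k<n. M 0 $$ (i, k) * G s $$ (k, j))" if "s \<in> {0..1}" for s
      unfolding C_def using M0 G[OF that] ij by (intro commutator_entry) auto
    ultimately show ?thesis by (metis (no_types, lifting) has_integral_eq)
  qed
  have "((\<lambda>s. - (G s * M s - M s * G s) $$ (i, j)) has_integral M 1 $$ (i, j) - M 0 $$ (i, j)) {0..1}"
    by (rule fundamental_theorem_of_calculus) (use deriv ij in auto)
  then have "((\<lambda>s. - (C s + R s)) has_integral M 1 $$ (i, j) - M 0 $$ (i, j)) {0..1}"
    by (rule has_integral_eq[rotated]) (simp add: split)
  from has_integral_add[OF this Cint]
  have "((\<lambda>s. - R s) has_integral M 1 $$ (i, j) - M 0 $$ (i, j) + (\<Gamma> * M 0 - M 0 * \<Gamma>) $$ (i, j)) {0..1}" by simp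
  then have *: "((\<lambda>s. - R s) has_integral M 1 $$ (i, j) - M 0 $$ (i, j) + (\<Gamma> * M 0 - M 0 * \<Gamma>) $$ (i, j)) (cbox 0 1)"
    by simp
  have "cmod (M 1 $$ (i, j) - M 0 $$ (i, j) + (\<Gamma> * M 0 - M 0 * \<Gamma>) $$ (i, j)) \<le> (2 * real n * \<epsilon> * (4 * real n * \<epsilon>)) * content (cbox 0 1 :: real set)"
  proof (rule has_integral_bound[OF _ *])
    fix s :: real assume s: "s \<in> cbox 0 1"
    then have "G s \<in> carrier_mat n n" "M s - M 0 \<in> carrier_mat n n" using G[of s] M[of s] M0 by (auto intro: minus_carrier_mat)
    then show "cmod (- R s) \<le> 2 * real n * \<epsilon> * (4 * real n * \<epsilon>)"
      unfolding R_def norm_minus_cancel using s ij eps diff'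
      by (intro commutator_entry_bound) auto
  qed (use eps0 in auto)
  then show ?thesis by (simp add: power2_eq_square algebra_simps)
qed

section \<open>Recovering a matrix from its action by conjugation\<close>

definition unit_mat :: "nat \<Rightarrow> nat \<Rightarrow> nat \<Rightarrow> complex mat" where
  "unit_mat n i j = mat n n (\<lambda>(a, b). if a = i \<and> b = j then 1 else 0)"

lemma unit_mat_carrier [simp]: "unit_mat n i j \<in> carrier_mat n n"
  by (simp add: unit_mat_def)

text \<open>Off-diagonal elementary matrices have trace zero, as the fibres of the bundle require.
  The equation \<open>M * C = C * unit_mat n i j\<close> expresses conjugation without an inverse of
  \<open>C\<close>, and it is unchanged when \<open>C\<close> is multiplied by a scalar.\<close>

definition conj_near_ad :: "nat \<Rightarrow> complex mat \<Rightarrow> complex mat \<Rightarrow> real \<Rightarrow> bool" where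
  "conj_near_ad n \<Gamma> C r \<longleftrightarrow> (\<forall>i<n. \<forall>j<n. i \<noteq> j \<longrightarrow>
     (\<exists>M\<in>carrier_mat n n. M * C = C * unit_mat n i j \<and> (\<forall>a<n. \<forall>b<n.
        cmod (M $$ (a, b) - unit_mat n i j $$ (a, b) + (\<Gamma> * unit_mat n i j - unit_mat n i j * \<Gamma>) $$ (a, b)) \<le> r)))"

lemma sum_bound_n:
  fixes f :: "nat \<Rightarrow> complex"
  assumes "\<And>k. k < n \<Longrightarrow> cmod (f k) \<le> B"
  shows "cmod (\<Sum>k<n. f k) \<le> real n * B"
  using sum_norm_bound[of "{..<n}" f B] assms by simp

text \<open>Conjugation by \<open>C\<close> is \<open>1 - ad \<Gamma>\<close> up to second order on the elementary matrices, so \<open>C\<close> is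
  proportional to \<open>1 - \<Gamma>\<close> up to second order.\<close>

lemma near_identity_conjugation:
  fixes C \<Gamma> :: "complex mat"
  assumes C: "C \<in> carrier_mat n n" and n: "n \<ge> 2" and N: "N < n"
    and C0: "\<exists>i<n. \<exists>j<n. C $$ (i, j) \<noteq> 0"
    and \<Gamma>: "\<Gamma> \<in> carrier_mat n n" and eps: "\<And>i j. i < n \<Longrightarrow> j < n \<Longrightarrow> cmod (\<Gamma> $$ (i, j)) \<le> \<epsilon>"
    and conj: "conj_near_ad n \<Gamma> C (K * \<epsilon>\<^sup>2)"
    and K: "K \<ge> 0" and L: "L = 1 + real n + real n * K" and small: "L * \<epsilon> \<le> 1/2"
  shows "C $$ (N, N) \<noteq> 0"
    and "\<And>i j. i < n \<Longrightarrow> j < n \<Longrightarrow> cmod (C $$ (i, j) / C $$ (N, N) - (if i = j then 1 else 0)) \<le> 2 * L * \<epsilon>"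
    and "\<And>i j. i < n \<Longrightarrow> j < n \<Longrightarrow>
       cmod (C $$ (i, j) / C $$ (N, N) - (if i = j then 1 + \<Gamma> $$ (N, N) else 0) + \<Gamma> $$ (i, j)) \<le> 2 * real n * (L + K) * \<epsilon>\<^sup>2"
proof -
  have e0: "0 \<le> \<epsilon>" using order_trans[OF norm_ge_zero eps[OF N N]] .
  have "\<epsilon> \<le> L * \<epsilon>" using e0 K by (simp add: L algebra_simps)
  then have e1: "\<epsilon> \<le> 1" using small by linarith
  then have e2: "\<epsilon>\<^sup>2 \<le> \<epsilon>" using e0 by (simp add: power2_eq_square mult_left_le)
  \<comment> \<open>Entry \<open>(a, j)\<close> of \<open>M * C = C * unit_mat n i j\<close>. On the
    right only \<open>C $$ (a, i)\<close> survives; on the left \<open>M\<close> is the elementary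
    matrix minus its commutator with \<open>\<Gamma>\<close>, plus a row \<open>r\<close> of
    errors.\<close>
  have eq: "\<exists>r. C $$ (a, i) = (if a = i then C $$ (j, j) else 0) - \<Gamma> $$ (a, i) * C $$ (j, j)
        + (if a = i then \<Sum>k<n. \<Gamma> $$ (j, k) * C $$ (k, j) else 0) + (\<Sum>k<n. r k * C $$ (k, j))
        \<and> (\<forall>k<n. cmod (r k) \<le> K * \<epsilon>\<^sup>2)"
    if a: "a < n" and i: "i < n" and j: "j < n" and ne: "i \<noteq> j" for a i j
  proof -
    let ?U = "unit_mat n i j"
    obtain M where M: "M \<in> carrier_mat n n" "M * C = C * ?U"
      "\<And>a b. a < n \<Longrightarrow> b < n \<Longrightarrow> cmod (M $$ (a, b) - ?U $$ (a, b) +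
            (\<Gamma> * ?U - ?U * \<Gamma>) $$ (a, b)) \<le> K * \<epsilon>\<^sup>2"
      using conj[unfolded conj_near_ad_def, rule_format, OF i j ne] by blast
    define r where "r b = M $$ (a, b) - ?U $$ (a, b) +
            (\<Gamma> * ?U - ?U * \<Gamma>) $$ (a, b)" for b
    have E: "?U $$ (x, y) = (if x = i \<and> y = j then 1 else 0)" if "x < n" "y < n" for x y
      using that by (simp add: unit_mat_def)
    have comm: "(\<Gamma> * ?U - ?U * \<Gamma>) $$ (a, b)
        = (if b = j then \<Gamma> $$ (a, i) else 0) - (if a = i then \<Gamma> $$ (j, b) else 0)" if b: "b < n" for b
    proof -
      have "(\<Gamma> * ?U - ?U * \<Gamma>) $$ (a, b)
        = (\<Sum>k<n. \<Gamma> $$ (a, k) * ?U $$ (k, b)) - (\<Sum>k<n. ?U $$ (a, k) * \<Gamma> $$ (k, b))"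
        using \<Gamma> a b by (intro commutator_entry) auto
      also have "(\<Sum>k<n. \<Gamma> $$ (a, k) * ?U $$ (k, b)) = (\<Sum>k<n. if k = i then (if b = j then \<Gamma> $$ (a, i) else 0) else 0)"
        using b by (intro sum.cong) (auto simp: E)
      also have "(\<Sum>k<n. ?U $$ (a, k) * \<Gamma> $$ (k, b)) = (\<Sum>k<n. if k = j then (if a = i then \<Gamma> $$ (j, b) else 0) else 0)"
        using a by (intro sum.cong) (auto simp: E)
      finally show ?thesis using i j by simp
    qed
    have Mab: "M $$ (a, b) = (if a = i \<and> b = j then 1 else 0) - (if b = j then \<Gamma> $$ (a, i) else 0) + (if a = i then \<Gamma> $$ (j, b) else 0) + r b"
      if b: "b < n" for b
      unfolding r_def comm[OF b] using a b by (simp add: E)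
    have "C $$ (a, i) = (\<Sum>k<n. if k = i then C $$ (a, i) else 0)" using i by simp
    also have "\<dots> = (\<Sum>k<n. C $$ (a, k) * ?U $$ (k, j))"
      using j by (intro sum.cong) (auto simp: E)
    also have "\<dots> = (M * C) $$ (a, j)" unfolding M(2) using C a j by (subst mult_mat_entry) auto
    also have "\<dots> = (\<Sum>k<n. M $$ (a, k) * C $$ (k, j))" using C M(1) a j by (intro mult_mat_entry) auto
    also have "\<dots> = (\<Sum>k<n. (if k = j then (if a = i then C $$ (j, j) else 0) - \<Gamma> $$ (a, i) * C $$ (j, j) else 0)
         + (if a = i then \<Gamma> $$ (j, k) * C $$ (k, j) else 0) + r k * C $$ (k, j))"
      by (intro sum.cong) (auto simp: Mab algebra_simps)
    also have "\<dots> = (if a = i then C $$ (j, j) else 0) - \<Gamma> $$ (a, i) * C $$ (j, j)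
        + (if a = i then \<Sum>k<n. \<Gamma> $$ (j, k) * C $$ (k, j) else 0) + (\<Sum>k<n. r k * C $$ (k, j))"
      using j by (simp add: sum.distrib)
    finally have "C $$ (a, i) = (if a = i then C $$ (j, j) else 0) - \<Gamma> $$ (a, i) * C $$ (j, j)
        + (if a = i then \<Sum>k<n. \<Gamma> $$ (j, k) * C $$ (k, j) else 0) + (\<Sum>k<n. r k * C $$ (k, j))" .
    moreover have "\<forall>k<n. cmod (r k) \<le> K * \<epsilon>\<^sup>2" using M(3)[OF a] unfolding r_def by blast
    ultimately show ?thesis by blast
  qed
  \<comment> \<open>First-order version of \<open>eq\<close>: its three error terms account for the
    summands \<open>1\<close>, \<open>n\<close> and \<open>n K\<close> of \<open>L\<close>. The
    bound is relative to the size \<open>m\<close> of the entries, because the scale of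
    \<open>C\<close> is not known.\<close>
  have first: "cmod (C $$ (a, i) - (if a = i then C $$ (j, j) else 0)) \<le> L * \<epsilon> * m"
    if a: "a < n" and i: "i < n" and j: "j < n" and ne: "i \<noteq> j"
      and m: "\<And>a b. a < n \<Longrightarrow> b < n \<Longrightarrow> cmod (C $$ (a, b)) \<le> m" for a i j m
  proof -
    have m0: "0 \<le> m" using order_trans[OF norm_ge_zero m[OF N N]] .
    obtain r where r: "C $$ (a, i) = (if a = i then C $$ (j, j) else 0) - \<Gamma> $$ (a, i) * C $$ (j, j)
        + (if a = i then \<Sum>k<n. \<Gamma> $$ (j, k) * C $$ (k, j) else 0) + (\<Sum>k<n. r k * C $$ (k, j))"
        "\<And>k. k < n \<Longrightarrow> cmod (r k) \<le> K * \<epsilon>\<^sup>2"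
      using eq[OF a i j ne] by blast
    have t1: "cmod (\<Gamma> $$ (a, i) * C $$ (j, j)) \<le> \<epsilon> * m"
      unfolding norm_mult using eps[OF a i] m[OF j j] e0 by (intro mult_mono) auto
    have t2: "cmod (if a = i then \<Sum>k<n. \<Gamma> $$ (j, k) * C $$ (k, j) else 0) \<le> real n * (\<epsilon> * m)"
    proof -
      have "cmod (\<Sum>k<n. \<Gamma> $$ (j, k) * C $$ (k, j)) \<le> real n * (\<epsilon> * m)"
        unfolding norm_mult using eps j m e0 by (intro sum_bound_n) (auto simp: norm_mult intro!: mult_mono)
      then show ?thesis using e0 m0 by simp
    qed
    have t3: "cmod (\<Sum>k<n. r k * C $$ (k, j)) \<le> real n * (K * \<epsilon> * m)"
    proof (rule sum_bound_n)
      fix k assume k: "k < n"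
      have "cmod (r k) \<le> K * \<epsilon>" using r(2)[OF k] mult_left_mono[OF e2 K] by linarith
      then show "cmod (r k * C $$ (k, j)) \<le> K * \<epsilon> * m"
        unfolding norm_mult using m[OF k j] e0 K by (intro mult_mono) auto
    qed
    have "C $$ (a, i) - (if a = i then C $$ (j, j) else 0) = - (\<Gamma> $$ (a, i) * C $$ (j, j))
        + (if a = i then \<Sum>k<n. \<Gamma> $$ (j, k) * C $$ (k, j) else 0) + (\<Sum>k<n. r k * C $$ (k, j))"
      by (subst r(1)) simp
    then have "cmod (C $$ (a, i) - (if a = i then C $$ (j, j) else 0)) \<le> cmod (\<Gamma> $$ (a, i) * C $$ (j, j)) +
       cmod (if a = i then \<Sum>k<n. \<Gamma> $$ (j, k) * C $$ (k, j) else 0) + cmod (\<Sum>k<n. r k * C $$ (k, j))"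
      by (simp only: norm_minus_cancel[of "\<Gamma> $$ (a, i) * C $$ (j, j)", symmetric]) (intro norm_triangle_mono order_refl)
    also have "\<dots> \<le> L * \<epsilon> * m" using t1 t2 t3 by (simp add: L algebra_simps)
    finally show ?thesis .
  qed
  define m where "m = Max ((\<lambda>(a, b). cmod (C $$ (a, b))) ` ({..<n} \<times> {..<n}))"
  have ne: "({..<n} \<times> {..<n}) \<noteq> {}" using N by auto
  have m: "cmod (C $$ (a, b)) \<le> m" if "a < n" "b < n" for a b
    unfolding m_def by (rule Max_ge) (use that in auto)
  have "m \<in> (\<lambda>(a, b). cmod (C $$ (a, b))) ` ({..<n} \<times> {..<n})"
    unfolding m_def by (rule Max_in) (use ne in auto)
  then obtain p q where pq: "p < n" "q < n" "m = cmod (C $$ (p, q))" by auto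
  have mpos: "m > 0"
  proof -
    from C0 obtain i j where "i < n" "j < n" "C $$ (i, j) \<noteq> 0" by blast
    then show ?thesis using m[of i j] by (metis zero_less_norm_iff order_less_le_trans)
  qed
  have half: "L * \<epsilon> * m \<le> m / 2" using mult_right_mono[OF small, of m] mpos by simp
  \<comment> \<open>The entry at \<open>N\<close> is fit for normalisation: off-diagonal entries
    have modulus at most \<open>m / 2\<close>, so none of them is the largest, and diagonal entries
    differ from the one at \<open>N\<close> by at most \<open>m / 2\<close>.\<close>
  have mN: "m \<le> 2 * cmod (C $$ (N, N))"
  proof (cases "p = q")
    case False
    obtain j where j: "j < n" "j \<noteq> q" using n by (metis One_nat_def less_2_cases_iff less_le_trans zero_neq_one)
    have "m \<le> L * \<epsilon> * m" using first[OF pq(1,2) j(1) j(2)[symmetric] m] False pq(3) by simp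
    then show ?thesis using half mpos by linarith
  next
    case True
    show ?thesis
    proof (cases "q = N")
      case True then show ?thesis using \<open>p = q\<close> pq mpos by simp
    next
      case False
      have "cmod (C $$ (p, p) - C $$ (N, N)) \<le> L * \<epsilon> * m"
        using first[OF pq(1,2) N False m] True by simp
      then have "m - cmod (C $$ (N, N)) \<le> L * \<epsilon> * m"
        using norm_triangle_ineq2[of "C $$ (p, p)" "C $$ (N, N)"] pq(3) True by simp
      then show ?thesis using half by linarith
    qed
  qed
  then show CN: "C $$ (N, N) \<noteq> 0" using mpos by auto
  define c where "c i j = C $$ (i, j) / C $$ (N, N)" for i j
  have cNN: "c N N = 1" using CN by (simp add: c_def)
  have c2: "cmod (c a b) \<le> 2" if "a < n" "b < n" for a b
    using m[OF that] mN CN by (simp add: c_def norm_divide field_simps)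
  have cfirst: "cmod (c a i - (if a = i then c j j else 0)) \<le> 2 * L * \<epsilon>"
    if a: "a < n" and i: "i < n" and j: "j < n" and ne: "i \<noteq> j" for a i j
  proof -
    have "c a i - (if a = i then c j j else 0) = (C $$ (a, i) - (if a = i then C $$ (j, j) else 0)) / C $$ (N, N)"
      by (simp add: c_def diff_divide_distrib)
    then have "cmod (c a i - (if a = i then c j j else 0)) \<le> L * \<epsilon> * m / cmod (C $$ (N, N))"
      using first[OF a i j ne m] by (simp add: norm_divide divide_right_mono)
    also have "\<dots> \<le> L * \<epsilon> * (2 * cmod (C $$ (N, N))) / cmod (C $$ (N, N))"
      using mN e0 K by (intro divide_right_mono mult_left_mono) (auto simp: L)
    finally show ?thesis using CN by simp
  qed
  have L0: "L \<ge> 0" using K by (simp add: L)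
  have one: "cmod (c i j - (if i = j then 1 else 0)) \<le> 2 * L * \<epsilon>" if i: "i < n" and j: "j < n" for i j
  proof (cases "i = j")
    case True
    show ?thesis
    proof (cases "j = N")
      case True then show ?thesis using \<open>i = j\<close> cNN L0 e0 by simp
    next
      case False
      then show ?thesis using cfirst[OF i j N False] cNN True by simp
    qed
  next
    case False
    then show ?thesis using cfirst[OF i j i] by simp
  qed
  then show "cmod (C $$ (i, j) / C $$ (N, N) - (if i = j then 1 else 0)) \<le> 2 * L * \<epsilon>" if "i < n" "j < n" for i j
    using that by (simp add: c_def)
  \<comment> \<open>Second order: the first-order bounds \<open>one\<close> are put back into those
    terms of \<open>eq\<close> that already carry a factor \<open>\<Gamma>\<close>.\<close>
  have two: "cmod (c a i - (if a = i then 1 + \<Gamma> $$ (N, N) else 0) + \<Gamma> $$ (a, i)) \<le> 2 * real n * (L + K) * \<epsilon>\<^sup>2"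
    if a: "a < n" and i: "i < n" for a i
  proof (cases "a = N \<and> i = N")
    case True
    then show ?thesis using cNN L0 K by simp
  next
    case False
    \<comment> \<open>On the diagonal, \<open>j = N\<close> compares the entry with
      \<open>c N N = 1\<close>. Off the diagonal any index other than \<open>i\<close> would do, and
      \<open>a\<close> is one.\<close>
    define j where "j = (if a = i then N else a)"
    have j: "j < n" "i \<noteq> j" using False a N by (auto simp: j_def)
    obtain r where r: "C $$ (a, i) = (if a = i then C $$ (j, j) else 0) - \<Gamma> $$ (a, i) * C $$ (j, j)
        + (if a = i then \<Sum>k<n. \<Gamma> $$ (j, k) * C $$ (k, j) else 0) + (\<Sum>k<n. r k * C $$ (k, j))"
        "\<And>k. k < n \<Longrightarrow> cmod (r k) \<le> K * \<epsilon>\<^sup>2"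
      using eq[OF a i j] by blast
    have ceq: "c a i = (if a = i then c j j else 0) - \<Gamma> $$ (a, i) * c j j
        + (if a = i then \<Sum>k<n. \<Gamma> $$ (j, k) * c k j else 0) + (\<Sum>k<n. r k * c k j)"
      unfolding c_def by (subst r(1)) (simp add: add_divide_distrib diff_divide_distrib sum_divide_distrib)
    have "cmod (\<Sum>k<n. r k * c k j) \<le> real n * (K * \<epsilon>\<^sup>2 * 2)"
      using r(2) c2 j K by (intro sum_bound_n) (auto simp: norm_mult intro!: mult_mono)
    moreover have "cmod (c a i - (if a = i then 1 + \<Gamma> $$ (N, N) else 0) + \<Gamma> $$ (a, i) - (\<Sum>k<n. r k * c k j))
       \<le> real n * (\<epsilon> * (2 * L * \<epsilon>))"
    proof (cases "a = i")
      case True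
      then have jN: "j = N" by (simp add: j_def)
      have "(\<Sum>k<n. \<Gamma> $$ (N, k) * (c k N - (if k = N then 1 else 0)))
         = (\<Sum>k<n. \<Gamma> $$ (N, k) * c k N) - (\<Sum>k<n. if k = N then \<Gamma> $$ (N, N) else 0)"
        unfolding sum_subtractf[symmetric] by (intro sum.cong) (auto simp: algebra_simps)
      also have "\<dots> = (\<Sum>k<n. \<Gamma> $$ (N, k) * c k N) - \<Gamma> $$ (N, N)" using N by simp
      also have "\<dots> = c a i - (1 + \<Gamma> $$ (N, N)) + \<Gamma> $$ (a, i) - (\<Sum>k<n. r k * c k j)"
        using ceq True by (simp add: jN cNN)
      finally have "c a i - (if a = i then 1 + \<Gamma> $$ (N, N) else 0) + \<Gamma> $$ (a, i) - (\<Sum>k<n. r k * c k j)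
         = (\<Sum>k<n. \<Gamma> $$ (N, k) * (c k N - (if k = N then 1 else 0)))" using True by simp
      moreover have "cmod (\<Sum>k<n. \<Gamma> $$ (N, k) * (c k N - (if k = N then 1 else 0))) \<le> real n * (\<epsilon> * (2 * L * \<epsilon>))"
        unfolding norm_mult using eps[OF N] one[OF _ N] e0 by (intro sum_bound_n) (simp add: norm_mult mult_mono)
      ultimately show ?thesis by simp
    next
      case False
      then have "c a i - (if a = i then 1 + \<Gamma> $$ (N, N) else 0) + \<Gamma> $$ (a, i) - (\<Sum>k<n. r k * c k j)
         = - (\<Gamma> $$ (a, i) * (c j j - 1))" using ceq by (simp add: algebra_simps)
      moreover have "cmod (\<Gamma> $$ (a, i) * (c j j - 1)) \<le> \<epsilon> * (2 * L * \<epsilon>)"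
        unfolding norm_mult using eps[OF a i] one[OF j(1) j(1)] e0 by (intro mult_mono) auto
      moreover have "1 * (\<epsilon> * (2 * L * \<epsilon>)) \<le> real n * (\<epsilon> * (2 * L * \<epsilon>))"
        using n L0 e0 by (intro mult_right_mono) auto
      ultimately show ?thesis by (simp only: norm_minus_cancel mult_1_left)
    qed
    ultimately have "cmod (c a i - (if a = i then 1 + \<Gamma> $$ (N, N) else 0) + \<Gamma> $$ (a, i))
       \<le> real n * (\<epsilon> * (2 * L * \<epsilon>)) + real n * (K * \<epsilon>\<^sup>2 * 2)"
      using norm_triangle_sub[of "c a i - (if a = i then 1 + \<Gamma> $$ (N, N) else 0) + \<Gamma> $$ (a, i)" "\<Sum>k<n. r k * c k j"]
      by linarith
    then show ?thesis by (simp add: power2_eq_square algebra_simps)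
  qed
  show "cmod (C $$ (i, j) / C $$ (N, N) - (if i = j then 1 + \<Gamma> $$ (N, N) else 0) + \<Gamma> $$ (i, j)) \<le> 2 * real n * (L + K) * \<epsilon>\<^sup>2"
    if "i < n" "j < n" for i j
    using two[OF that] by (simp add: c_def)
qed

section \<open>Perturbation of a dominant eigenvalue\<close>

lemma eigenvalue_entries:
  fixes Z :: "complex mat"
  assumes Z: "Z \<in> carrier_mat n n" and "eigenvalue Z \<nu>"
  shows "\<exists>u. (\<exists>i<n. u i \<noteq> 0) \<and> (\<forall>i<n. (\<Sum>j<n. Z $$ (i, j) * u j) = \<nu> * u i)"
proof -
  obtain v where v: "v \<in> carrier_vec n" "v \<noteq> 0\<^sub>v n" "Z *\<^sub>v v = \<nu> \<cdot>\<^sub>v v"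
    using assms by (auto simp: eigenvalue_def eigenvector_def)
  have "\<exists>i<n. vec_index v i \<noteq> 0"
  proof (rule ccontr)
    assume "\<not> ?thesis"
    then have "v = 0\<^sub>v n" using v(1) by (intro eq_vecI) auto
    with v show False by simp
  qed
  moreover have "(\<Sum>j<n. Z $$ (i, j) * vec_index v j) = \<nu> * vec_index v i" if "i < n" for i
  proof -
    have "vec_index (Z *\<^sub>v v) i = (\<Sum>j<n. Z $$ (i, j) * vec_index v j)"
      using Z v(1) that by (simp add: scalar_prod_def atLeast0LessThan)
    then show ?thesis using v that by simp
  qed
  ultimately show ?thesis by blast
qed

lemma max_entry:
  fixes u :: "nat \<Rightarrow> complex"
  assumes "n > 0"
  obtains p where "p < n" "\<And>i. i < n \<Longrightarrow> cmod (u i) \<le> cmod (u p)"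
proof -
  have "Max ((\<lambda>i. cmod (u i)) ` {..<n}) \<in> (\<lambda>i. cmod (u i)) ` {..<n}" using assms by (intro Max_in) auto
  then obtain p where "p < n" "Max ((\<lambda>i. cmod (u i)) ` {..<n}) = cmod (u p)" by auto
  moreover have "cmod (u i) \<le> Max ((\<lambda>i. cmod (u i)) ` {..<n})" if "i < n" for i
    using that by (intro Max_ge) auto
  ultimately show ?thesis using that by metis
qed

text \<open>The rows of the perturbation have total size at most \<open>\<eta>\<close>, while the
  gap below \<open>d N\<close> is \<open>4 * \<eta>\<close>. An eigenvalue within
  \<open>\<eta>\<close> of \<open>d N\<close> therefore stays \<open>3 * \<eta>\<close> away from
  the other diagonal entries. The bounds are explicit because they are applied at each
  \<open>t\<close> separately, with \<open>\<epsilon>\<close> proportional to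
  \<open>\<bar>t\<bar>\<close>.\<close>

locale near_diagonal =
  fixes n N :: nat and Z :: "complex mat" and d :: "nat \<Rightarrow> real" and \<epsilon> \<eta> :: real
  assumes Z: "Z \<in> carrier_mat n n" and N: "N < n"
    and near: "\<And>i j. i < n \<Longrightarrow> j < n \<Longrightarrow> cmod (Z $$ (i, j) - (if i = j then complex_of_real (d i) else 0)) \<le> \<epsilon>"
    and small: "real n * \<epsilon> \<le> \<eta>" and \<eta>: "\<eta> > 0"
    and gap: "\<And>i. i < n \<Longrightarrow> i \<noteq> N \<Longrightarrow> d i + 4 * \<eta> \<le> d N"
    and pos: "\<And>i. i < n \<Longrightarrow> d i > 0"
begin

lemma eps_nonneg: "\<epsilon> \<ge> 0"
  using order_trans[OF norm_ge_zero near[OF N N]] .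

lemma remainder_bound:
  fixes u :: "nat \<Rightarrow> complex"
  assumes "i < n" "\<And>j. j < n \<Longrightarrow> cmod (u j) \<le> m"
  shows "cmod ((\<Sum>j<n. Z $$ (i, j) * u j) - d i * u i) \<le> real n * \<epsilon> * m"
proof -
  have "(\<Sum>j<n. Z $$ (i, j) * u j) - d i * u i = (\<Sum>j<n. Z $$ (i, j) * u j) - (\<Sum>j<n. if j = i then d i * u i else 0)"
    using assms(1) by simp
  also have "\<dots> = (\<Sum>j<n. (Z $$ (i, j) - (if i = j then complex_of_real (d i) else 0)) * u j)"
    unfolding sum_subtractf[symmetric] by (intro sum.cong) (auto simp: algebra_simps)
  finally have e: "(\<Sum>j<n. Z $$ (i, j) * u j) - d i * u i = (\<Sum>j<n. (Z $$ (i, j) - (if i = j then complex_of_real (d i) else 0)) * u j)" .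
  show ?thesis unfolding e mult.assoc[of "real n"]
  proof (rule sum_bound_n)
    fix j assume j: "j < n"
    show "cmod ((Z $$ (i, j) - (if i = j then complex_of_real (d i) else 0)) * u j) \<le> \<epsilon> * m"
      unfolding norm_mult using near[OF assms(1) j] assms(2)[OF j] eps_nonneg by (intro mult_mono) auto
  qed
qed

text \<open>Gershgorin's argument: the eigenvector equation is read at an entry of largest
  modulus.\<close>

lemma eigenvalue_near_some:
  assumes "eigenvalue Z \<nu>"
  shows "\<exists>i<n. cmod (\<nu> - d i) \<le> real n * \<epsilon>"
proof -
  obtain u where u: "\<exists>i<n. u i \<noteq> 0" "\<And>i. i < n \<Longrightarrow> (\<Sum>j<n. Z $$ (i, j) * u j) = \<nu> * u i"
    using eigenvalue_entries[OF Z assms] by blast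
  have "n > 0" using N by simp
  then obtain p where p: "p < n" "\<And>i. i < n \<Longrightarrow> cmod (u i) \<le> cmod (u p)" using max_entry[of n u] by blast
  have up: "cmod (u p) > 0" using u(1) p(2) by (metis zero_less_norm_iff order_less_le_trans)
  have "cmod ((\<nu> - d p) * u p) \<le> real n * \<epsilon> * cmod (u p)"
    using remainder_bound[OF p(1), of u "cmod (u p)"] p u(2)[OF p(1)] by (simp add: algebra_simps)
  then have "cmod (\<nu> - d p) \<le> real n * \<epsilon>" using up by (simp add: norm_mult)
  then show ?thesis using p by blast
qed

lemma eigenvalue_small_or_near:
  assumes "eigenvalue Z \<nu>"
  shows "cmod (\<nu> - d N) \<le> \<eta> \<or> cmod \<nu> < d N - \<eta>"
proof -
  obtain i where i: "i < n" "cmod (\<nu> - d i) \<le> real n * \<epsilon>" using eigenvalue_near_some[OF assms] by blast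
  show ?thesis
  proof (cases "i = N")
    case False
    have "cmod \<nu> \<le> cmod (complex_of_real (d i)) + cmod (\<nu> - d i)" by (metis norm_triangle_sub)
    then have "cmod \<nu> \<le> d i + \<eta>" using i small pos[OF i(1)] by simp
    then show ?thesis using gap[OF i(1) False] \<eta> by simp
  qed (use i small in simp)
qed

lemma gap_dist:
  fixes \<nu> :: complex
  assumes "cmod (\<nu> - d N) \<le> \<eta>" "i < n" "i \<noteq> N"
  shows "cmod (\<nu> - d i) \<ge> 3 * \<eta>"
proof -
  have "cmod (complex_of_real (d N - d i)) \<le> cmod (\<nu> - d i) + cmod (\<nu> - d N)"
    using norm_triangle_ineq4[of "\<nu> - d i" "\<nu> - d N"] by simp
  moreover have "cmod (complex_of_real (d N - d i)) = d N - d i"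
    unfolding norm_of_real using gap[OF assms(2,3)] \<eta> by simp
  ultimately show ?thesis using assms gap[OF assms(2,3)] by linarith
qed

text \<open>If the largest entry of the eigenvector were not at \<open>N\<close>, the equation there
  would give \<open>3 * \<eta> \<le> \<eta>\<close>. Once it is at \<open>N\<close>, the same
  inequality makes all other entries small.\<close>

lemma top_eigenvector:
  assumes "eigenvalue Z \<nu>" "cmod (\<nu> - d N) \<le> \<eta>"
  shows "\<exists>u. u N = 1 \<and> (\<forall>i<n. i \<noteq> N \<longrightarrow> cmod (u i) \<le> real n * \<epsilon> / (3 * \<eta>)) \<and> (\<forall>i<n. (\<Sum>j<n. Z $$ (i, j) * u j) = \<nu> * u i)"
proof -
  obtain u where u: "\<exists>i<n. u i \<noteq> 0" "\<And>i. i < n \<Longrightarrow> (\<Sum>j<n. Z $$ (i, j) * u j) = \<nu> * u i"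
    using eigenvalue_entries[OF Z assms(1)] by blast
  have "n > 0" using N by simp
  then obtain p where p: "p < n" "\<And>i. i < n \<Longrightarrow> cmod (u i) \<le> cmod (u p)" using max_entry[of n u] by blast
  have up: "cmod (u p) > 0" using u(1) p(2) by (metis zero_less_norm_iff order_less_le_trans)
  have b: "3 * \<eta> * cmod (u i) \<le> real n * \<epsilon> * cmod (u p)" if i: "i < n" "i \<noteq> N" for i
  proof -
    have "cmod ((\<nu> - d i) * u i) \<le> real n * \<epsilon> * cmod (u p)"
      using remainder_bound[OF i(1), of u "cmod (u p)"] p u(2)[OF i(1)] by (simp add: algebra_simps)
    moreover have "3 * \<eta> * cmod (u i) \<le> cmod (\<nu> - d i) * cmod (u i)"
      using gap_dist[OF assms(2) i] by (intro mult_right_mono) auto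
    ultimately show ?thesis by (simp add: norm_mult)
  qed
  have pN: "p = N"
  proof (rule ccontr)
    assume "p \<noteq> N"
    then have "3 * \<eta> * cmod (u p) \<le> \<eta> * cmod (u p)"
      using b[OF p(1)] mult_right_mono[OF small, of "cmod (u p)"] up by linarith
    then show False using up \<eta> by simp
  qed
  have uN: "u N \<noteq> 0" using up pN by auto
  have "cmod (u i / u N) \<le> real n * \<epsilon> / (3 * \<eta>)" if i: "i < n" "i \<noteq> N" for i
    using b[OF i] uN \<eta> by (simp add: pN norm_divide field_simps)
  moreover have "(\<Sum>j<n. Z $$ (i, j) * (u j / u N)) = \<nu> * (u i / u N)" if "i < n" for i
    using u(2)[OF that] by (simp flip: sum_divide_distrib)
  ultimately show ?thesis using uN by (intro exI[of _ "\<lambda>i. u i / u N"]) auto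
qed

text \<open>With \<open>u N = 1\<close>, row \<open>N\<close> of the eigenvector equation expresses
  the difference through products \<open>Z $$ (N, j) * u j\<close> with \<open>j \<noteq> N\<close>,
  and both factors are of order \<open>\<epsilon>\<close>.\<close>

lemma top_eigenvalue_expansion:
  assumes "eigenvalue Z \<nu>" "cmod (\<nu> - d N) \<le> \<eta>"
  shows "cmod (\<nu> - Z $$ (N, N)) \<le> (real n)\<^sup>2 * \<epsilon>\<^sup>2 / (3 * \<eta>)"
proof -
  obtain u where u: "u N = 1" "\<And>i. i < n \<Longrightarrow> i \<noteq> N \<Longrightarrow> cmod (u i) \<le> real n * \<epsilon> / (3 * \<eta>)"
    "\<And>i. i < n \<Longrightarrow> (\<Sum>j<n. Z $$ (i, j) * u j) = \<nu> * u i"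
    using top_eigenvector[OF assms] by blast
  have "\<nu> - Z $$ (N, N) = (\<Sum>j<n. Z $$ (N, j) * u j) - (\<Sum>j<n. if j = N then Z $$ (N, N) else 0)"
    using u N by simp
  also have "\<dots> = (\<Sum>j<n. if j = N then 0 else Z $$ (N, j) * u j)"
    unfolding sum_subtractf[symmetric] using u by (intro sum.cong) auto
  finally have e: "\<nu> - Z $$ (N, N) = (\<Sum>j<n. if j = N then 0 else Z $$ (N, j) * u j)" .
  have "cmod (\<nu> - Z $$ (N, N)) \<le> real n * (\<epsilon> * (real n * \<epsilon> / (3 * \<eta>)))"
    unfolding e
  proof (rule sum_bound_n)
    fix j assume j: "j < n"
    show "cmod (if j = N then 0 else Z $$ (N, j) * u j) \<le> \<epsilon> * (real n * \<epsilon> / (3 * \<eta>))"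
    proof (cases "j = N")
      case False
      then have "cmod (Z $$ (N, j)) \<le> \<epsilon>" using near[OF N j] by simp
      then have "cmod (Z $$ (N, j)) * cmod (u j) \<le> \<epsilon> * (real n * \<epsilon> / (3 * \<eta>))"
        using False u(2)[OF j] eps_nonneg by (intro mult_mono) auto
      then show ?thesis using False by (simp add: norm_mult)
    qed (use eps_nonneg \<eta> in simp)
  qed
  then show ?thesis by (simp add: power2_eq_square algebra_simps)
qed

text \<open>The difference \<open>w\<close> of the two eigenvectors normalised at \<open>N\<close>
  vanishes at \<open>N\<close>. At its largest entry the factor \<open>\<nu> - d p\<close> is at
  least \<open>3 * \<eta>\<close>, while the errors, including the one from
  \<open>\<nu> - \<nu>'\<close>, amount to at most \<open>2 * \<eta>\<close>; hence
  \<open>w = 0\<close> and the eigenvalues agree.\<close>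

lemma top_eigenvalue_unique:
  assumes "eigenvalue Z \<nu>" "cmod (\<nu> - d N) \<le> \<eta>" "eigenvalue Z \<nu>'" "cmod (\<nu>' - d N) \<le> \<eta>"
  shows "\<nu> = \<nu>'"
proof -
  obtain u where u: "u N = 1" "\<And>i. i < n \<Longrightarrow> (\<Sum>j<n. Z $$ (i, j) * u j) = \<nu> * u i"
    using top_eigenvector[OF assms(1,2)] by blast
  obtain u' where u': "u' N = 1" "\<And>i. i < n \<Longrightarrow> i \<noteq> N \<Longrightarrow> cmod (u' i) \<le> real n * \<epsilon> / (3 * \<eta>)"
    "\<And>i. i < n \<Longrightarrow> (\<Sum>j<n. Z $$ (i, j) * u' j) = \<nu>' * u' i"
    using top_eigenvector[OF assms(3,4)] by blast
  define w where "w i = u i - u' i" for i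
  have w: "(\<Sum>j<n. Z $$ (i, j) * w j) = \<nu> * w i + (\<nu> - \<nu>') * u' i" if "i < n" for i
    using u(2)[OF that] u'(3)[OF that] by (simp add: w_def right_diff_distrib sum_subtractf algebra_simps)
  have wN: "w N = 0" by (simp add: w_def u u')
  have "n > 0" using N by simp
  then obtain p where p: "p < n" "\<And>i. i < n \<Longrightarrow> cmod (w i) \<le> cmod (w p)" using max_entry[of n w] by blast
  have dnu: "cmod (\<nu> - \<nu>') \<le> real n * \<epsilon> * cmod (w p)"
    using remainder_bound[OF N, of w "cmod (w p)"] p w[OF N] wN u' by simp
  have "w p = 0"
  proof (rule ccontr)
    assume wp: "w p \<noteq> 0"
    then have "p \<noteq> N" using wN by auto
    have rb: "cmod ((\<Sum>j<n. Z $$ (p, j) * w j) - d p * w p) \<le> real n * \<epsilon> * cmod (w p)"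
      by (rule remainder_bound[OF p(1) p(2)])
    have eq: "(\<nu> - d p) * w p = ((\<Sum>j<n. Z $$ (p, j) * w j) - d p * w p) - (\<nu> - \<nu>') * u' p"
      using w[OF p(1)] by (simp add: algebra_simps)
    have "cmod ((\<nu> - d p) * w p) \<le> real n * \<epsilon> * cmod (w p) + cmod ((\<nu> - \<nu>') * u' p)"
      unfolding eq using rb norm_triangle_ineq4[of "(\<Sum>j<n. Z $$ (p, j) * w j) - d p * w p" "(\<nu> - \<nu>') * u' p"] by linarith
    also have "cmod ((\<nu> - \<nu>') * u' p) \<le> real n * \<epsilon> * cmod (w p) * 1"
      unfolding norm_mult
    proof (rule mult_mono[OF dnu])
      have "real n * \<epsilon> / (3 * \<eta>) \<le> 1" using small \<eta> by simp
      then show "cmod (u' p) \<le> 1" using u'(2)[OF p(1) \<open>p \<noteq> N\<close>] by linarith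
    qed (use eps_nonneg in auto)
    finally have "cmod (\<nu> - d p) * cmod (w p) \<le> 2 * (real n * \<epsilon>) * cmod (w p)"
      unfolding norm_mult by (simp add: mult.left_commute mult.assoc)
    then have "cmod (\<nu> - d p) \<le> 2 * (real n * \<epsilon>)" using wp by simp
    then show False using gap_dist[OF assms(2) p(1) \<open>p \<noteq> N\<close>] small \<eta> by linarith
  qed
  then show ?thesis using dnu by simp
qed

lemma dominant_eigenvalue:
  assumes "eigenvalue Z \<mu>" "cmod (\<mu> - d N) \<le> \<eta>" "eigenvalue Z \<nu>"
  shows "cmod \<nu> \<le> cmod \<mu>" "cmod \<nu> = cmod \<mu> \<Longrightarrow> \<nu> = \<mu>"
proof -
  have "d N - \<eta> \<le> cmod \<mu>"
    using assms(2) norm_triangle_ineq2[of "complex_of_real (d N)" \<mu>] pos[OF N] by (simp add: norm_minus_commute)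
  then show "cmod \<nu> \<le> cmod \<mu>" "cmod \<nu> = cmod \<mu> \<Longrightarrow> \<nu> = \<mu>"
    using eigenvalue_small_or_near[OF assms(3)] top_eigenvalue_unique[OF assms(3) _ assms(1,2)] by auto
qed

end

text \<open>The estimates above locate given eigenvalues but do not produce one. At \<open>x\<close>
  the characteristic polynomial has as modulus the product of the distances from \<open>x\<close> to
  the eigenvalues, so a small determinant forces one of these distances to be small.\<close>

lemma eigenvalue_near_exists:
  fixes Z :: "complex mat"
  assumes Z: "Z \<in> carrier_mat n n" and n: "n > 0" and r: "r > 0"
    and det: "cmod (det (Z - x \<cdot>\<^sub>m 1\<^sub>m n)) < r ^ n"
  shows "\<exists>\<mu>. eigenvalue Z \<mu> \<and> cmod (\<mu> - x) \<le> r"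
proof -
  obtain as where as: "char_poly Z = (\<Prod>a\<leftarrow>as. [:- a, 1:])" "length as = n"
    using char_poly_factorized[OF Z] by blast
  have "poly (char_poly Z) x = det (- (char_matrix Z x))"
    by (rule char_poly_matrix[OF Z])
  also have "- (char_matrix Z x) = (-1) \<cdot>\<^sub>m (Z - x \<cdot>\<^sub>m 1\<^sub>m n)"
    using Z by (intro eq_matI) (auto simp: char_matrix_def)
  also have "det \<dots> = (-1) ^ n * det (Z - x \<cdot>\<^sub>m 1\<^sub>m n)"
    using Z by (subst det_smult) simp
  finally have e: "cmod (poly (char_poly Z) x) < r ^ n"
    using det by (simp add: norm_mult norm_power)
  have "\<exists>a\<in>set as. cmod (a - x) \<le> r"
  proof (rule ccontr)
    assume "\<not> ?thesis"
    then have *: "\<And>a. a \<in> set as \<Longrightarrow> r \<le> cmod (a - x)" by force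
    have "r ^ length as \<le> cmod (poly (\<Prod>a\<leftarrow>as. [:- a, 1:]) x)"
      using *
    proof (induction as)
      case (Cons a as)
      have "r * r ^ length as \<le> cmod (a - x) * cmod (poly (\<Prod>a\<leftarrow>as. [:- a, 1:]) x)"
        using Cons r by (intro mult_mono) auto
      also have "\<dots> = cmod ((x - a) * poly (\<Prod>a\<leftarrow>as. [:- a, 1:]) x)"
        by (simp only: norm_mult norm_minus_commute)
      also have "(x - a) * poly (\<Prod>a\<leftarrow>as. [:- a, 1:]) x = poly (\<Prod>a\<leftarrow>a # as. [:- a, 1:]) x"
        by (simp add: algebra_simps)
      finally show ?case by simp
    qed simp
    then show False using e as by simp
  qed
  then obtain a where a: "a \<in> set as" "cmod (a - x) \<le> r" by blast
  have "poly (char_poly Z) a = 0"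
    unfolding as(1) using a(1) by (induction as) auto
  then show ?thesis using a eigenvalue_root_char_poly[OF Z] by blast
qed

section \<open>Determinants of families of matrices\<close>

lemma tendsto_det:
  fixes Z :: "'a \<Rightarrow> complex mat"
  assumes "\<And>t. Z t \<in> carrier_mat n n" "W \<in> carrier_mat n n"
    and "\<And>i j. i < n \<Longrightarrow> j < n \<Longrightarrow> ((\<lambda>t. Z t $$ (i, j)) \<longlongrightarrow> W $$ (i, j)) F"
  shows "((\<lambda>t. det (Z t)) \<longlongrightarrow> det W) F"
proof -
  have "((\<lambda>t. \<Sum>p\<in>{p. p permutes {0..<n}}. signof p * (\<Prod>i = 0..<n. Z t $$ (i, p i)))
     \<longlongrightarrow> (\<Sum>p\<in>{p. p permutes {0..<n}}. signof p * (\<Prod>i = 0..<n. W $$ (i, p i)))) F"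
    by (intro tendsto_intros assms) (auto simp: permutes_in_image)
  then show ?thesis unfolding det_def'[OF assms(1)] det_def'[OF assms(2)] .
qed

text \<open>Jacobi's formula at the identity. A permutation other than \<open>id\<close> moves at
  least two points, so after one factor of its product is differentiated another factor is still an
  off-diagonal entry of the identity.\<close>

lemma has_real_derivative_det:
  fixes Z :: "real \<Rightarrow> complex mat"
  assumes Z: "\<And>t. Z t \<in> carrier_mat n n" and Z0: "Z 0 = 1\<^sub>m n"
    and der: "\<And>i j. i < n \<Longrightarrow> j < n \<Longrightarrow> ((\<lambda>t. Z t $$ (i, j)) has_vector_derivative Z' i j) (at 0)"
  shows "((\<lambda>t. det (Z t)) has_vector_derivative (\<Sum>i<n. Z' i i)) (at 0)"
proof -
  let ?P = "{p. p permutes {0..<n}}"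
  have prod: "((\<lambda>t. \<Prod>i\<in>{0..<n}. Z t $$ (i, p i)) has_derivative
     (\<lambda>y. \<Sum>i\<in>{0..<n}. y *\<^sub>R Z' i (p i) * (\<Prod>j\<in>{0..<n} - {i}. Z 0 $$ (j, p j)))) (at 0)" if "p \<in> ?P" for p
    using der that unfolding has_vector_derivative_def
    by (intro has_derivative_prod) (auto simp: permutes_in_image)
  have val: "(\<Sum>i\<in>{0..<n}. y *\<^sub>R Z' i (p i) * (\<Prod>j\<in>{0..<n} - {i}. Z 0 $$ (j, p j)))
      = (if p = id then y *\<^sub>R (\<Sum>i<n. Z' i i) else 0)" if p: "p \<in> ?P" for p y
  proof (cases "p = id")
    case True
    have "(\<Prod>j\<in>{0..<n} - {i}. Z 0 $$ (j, j)) = 1" for i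
      by (intro prod.neutral) (auto simp: Z0)
    then show ?thesis using True by (simp add: scaleR_sum_right atLeast0LessThan)
  next
    case False
    then obtain i0 where i0: "p i0 \<noteq> i0" by (metis ext id_apply)
    have "(\<Prod>j\<in>{0..<n} - {i}. Z 0 $$ (j, p j)) = 0" if i: "i < n" for i
    proof -
      have inj: "inj p" and in0: "i0 < n" "p i0 < n"
        using p i0 permutes_inj permutes_not_in[of p "{0..<n}" i0] permutes_in_image[of p "{0..<n}" i0] by auto
      have "p (p i0) \<noteq> p i0" using inj i0 by (metis injD)
      then obtain j where j: "j < n" "j \<noteq> i" "p j \<noteq> j" using i0 in0 by metis
      then have "Z 0 $$ (j, p j) = 0" using p permutes_in_image[of p "{0..<n}" j] by (simp add: Z0)
      then show ?thesis using j by (intro prod_zero) auto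
    qed
    then have "(\<Sum>i\<in>{0..<n}. y *\<^sub>R Z' i (p i) * (\<Prod>j\<in>{0..<n} - {i}. Z 0 $$ (j, p j))) = 0"
      by (intro sum.neutral) (simp del: prod_zero_iff)
    then show ?thesis using False by simp
  qed
  have "((\<lambda>t. \<Sum>p\<in>?P. signof p * (\<Prod>i\<in>{0..<n}. Z t $$ (i, p i))) has_derivative
     (\<lambda>y. \<Sum>p\<in>?P. signof p * (if p = id then y *\<^sub>R (\<Sum>i<n. Z' i i) else 0))) (at 0)"
  proof (intro has_derivative_sum has_derivative_mult_right)
    fix p assume p: "p \<in> ?P"
    show "((\<lambda>t. \<Prod>i\<in>{0..<n}. Z t $$ (i, p i)) has_derivative (\<lambda>y. if p = id then y *\<^sub>R (\<Sum>i<n. Z' i i) else 0)) (at 0)"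
      using prod[OF p] unfolding val[OF p] .
  qed
  moreover have "(\<Sum>p\<in>?P. signof p * (if p = id then y *\<^sub>R (\<Sum>i<n. Z' i i) else 0)) = y *\<^sub>R (\<Sum>i<n. Z' i i)" for y
  proof -
    have "(\<Sum>p\<in>?P. signof p * (if p = id then y *\<^sub>R (\<Sum>i<n. Z' i i) else 0)) = (\<Sum>p\<in>?P. if p = id then y *\<^sub>R (\<Sum>i<n. Z' i i) else 0)"
      by (intro sum.cong) auto
    then show ?thesis by (simp add: finite_permutations permutes_id)
  qed
  ultimately show ?thesis
    using det_def'[OF Z] by (simp add: has_vector_derivative_def)
qed

lemma eigenvalue_smult_iff:
  fixes Z :: "complex mat"
  assumes Z: "Z \<in> carrier_mat n n" and z: "z \<noteq> 0"
  shows "eigenvalue (z \<cdot>\<^sub>m Z) (z * \<nu>) \<longleftrightarrow> eigenvalue Z \<nu>"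
proof -
  have "eigenvector (z \<cdot>\<^sub>m Z) v (z * \<nu>) \<longleftrightarrow> eigenvector Z v \<nu>" for v
  proof (cases "v \<in> carrier_vec n")
    case True
    have "(z \<cdot>\<^sub>m Z) *\<^sub>v v = z \<cdot>\<^sub>v (Z *\<^sub>v v)"
      using Z True by (intro eq_vecI) (auto simp: scalar_prod_def sum_distrib_left mult.assoc)
    moreover have "z \<cdot>\<^sub>v x = (z * \<nu>) \<cdot>\<^sub>v v \<longleftrightarrow> x = \<nu> \<cdot>\<^sub>v v" if "x \<in> carrier_vec n" for x
    proof
      assume e: "z \<cdot>\<^sub>v x = (z * \<nu>) \<cdot>\<^sub>v v"
      show "x = \<nu> \<cdot>\<^sub>v v"
      proof (rule eq_vecI)
        fix i assume "i < dim_vec (\<nu> \<cdot>\<^sub>v v)"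
        then have i: "i < n" using True by simp
        have "vec_index (z \<cdot>\<^sub>v x) i = vec_index ((z * \<nu>) \<cdot>\<^sub>v v) i" using e by simp
        then show "vec_index x i = vec_index (\<nu> \<cdot>\<^sub>v v) i" using i that True z by simp
      qed (use that True in simp)
    qed (auto simp: smult_smult_assoc)
    moreover have "Z *\<^sub>v v \<in> carrier_vec n" using Z True by simp
    ultimately show ?thesis using Z unfolding eigenvector_def by auto
  qed (use Z in \<open>auto simp: eigenvector_def\<close>)
  then show ?thesis by (simp add: eigenvalue_def)
qed

text \<open>The conjugate of \<open>z \<mu>\<close> is an eigenvalue of the real matrix \<open>B\<close> with the same modulus; this forces \<open>z \<mu>\<close> to be real.\<close>

lemma largest_eigenvalue_dominant:
  fixes B :: "real mat" and Z :: "complex mat"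
  assumes B: "B \<in> carrier_mat n n" and Z: "Z \<in> carrier_mat n n" and z: "z \<noteq> 0"
    and sim: "similar_mat (map_mat complex_of_real B) (z \<cdot>\<^sub>m Z)"
    and \<mu>: "eigenvalue Z \<mu>" "\<mu> \<noteq> 0"
    and dom: "\<And>\<nu>. eigenvalue Z \<nu> \<Longrightarrow> cmod \<nu> \<le> cmod \<mu>" "\<And>\<nu>. eigenvalue Z \<nu> \<Longrightarrow> cmod \<nu> = cmod \<mu> \<Longrightarrow> \<nu> = \<mu>"
  shows "largest_eigenvalue B = cmod z * cmod \<mu>"
proof -
  interpret of_real_hom: field_hom complex_of_real by standard auto
  let ?B = "map_mat complex_of_real B"
  have Bc: "?B \<in> carrier_mat n n" using B by simp
  have cp: "char_poly ?B = map_poly complex_of_real (char_poly B)" by (rule of_real_hom.char_poly_hom[OF B])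
  have ev: "eigenvalue ?B x \<longleftrightarrow> eigenvalue Z (x / z)" for x
  proof -
    have zZ: "z \<cdot>\<^sub>m Z \<in> carrier_mat n n" using Z by simp
    have "eigenvalue ?B x \<longleftrightarrow> eigenvalue (z \<cdot>\<^sub>m Z) (z * (x / z))"
      using eigenvalue_root_char_poly[OF Bc] eigenvalue_root_char_poly[OF zZ] char_poly_similar[OF sim] z by simp
    then show ?thesis using eigenvalue_smult_iff[OF Z z] by blast
  qed
  have evr: "eigenvalue B x \<longleftrightarrow> eigenvalue ?B (complex_of_real x)" for x
    unfolding eigenvalue_root_char_poly[OF B] eigenvalue_root_char_poly[OF Bc] cp by simp
  have "eigenvalue ?B (z * \<mu>)" using ev z \<mu> by simp
  then have "poly (char_poly ?B) (z * \<mu>) = 0" unfolding eigenvalue_root_char_poly[OF Bc] .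
  moreover have "poly (char_poly ?B) (cnj x) = cnj (poly (char_poly ?B) x)" for x
    unfolding cp by (simp add: poly_altdef)
  ultimately have "poly (char_poly ?B) (cnj (z * \<mu>)) = 0" by (metis complex_cnj_zero)
  then have "eigenvalue Z (cnj (z * \<mu>) / z)"
    using ev eigenvalue_root_char_poly[OF Bc] by blast
  moreover have "cmod (cnj (z * \<mu>) / z) = cmod \<mu>" using z by (simp add: norm_divide norm_mult)
  ultimately have "cnj (z * \<mu>) / z = \<mu>" using dom(2) by blast
  then have "cnj (z * \<mu>) = z * \<mu>" using z by (simp add: field_simps)
  then obtain r where r: "z * \<mu> = complex_of_real r" by (metis Reals_cnj_iff Reals_cases)
  have absr: "\<bar>r\<bar> = cmod z * cmod \<mu>" by (metis norm_mult norm_of_real r)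
  have evr': "eigenvalue B r" unfolding evr r[symmetric] using ev z \<mu> by simp
  have neg: "eigenvalue (- B) x \<longleftrightarrow> eigenvalue B (- x)" for x
  proof -
    have "char_matrix (- B) x = - char_matrix B (- x)"
      unfolding char_matrix_def using B by (intro eq_matI) auto
    moreover have mB: "- B \<in> carrier_mat n n" using B by simp
    moreover have "det (- char_matrix B (- x)) = (-1) ^ n * det (char_matrix B (- x))"
    proof -
      have "- char_matrix B (- x) = (-1) \<cdot>\<^sub>m char_matrix B (- x)" by (intro eq_matI) auto
      then show ?thesis using B by (simp add: char_matrix_def)
    qed
    ultimately show ?thesis unfolding eigenvalue_det[OF B] eigenvalue_det[OF mB] by simp
  qed
  let ?S = "{x. x > 0 \<and> (eigenvalue B x \<or> eigenvalue (- B) x)}"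
  have le: "\<bar>x\<bar> \<le> cmod z * cmod \<mu>" if "eigenvalue B x" for x
  proof -
    have "eigenvalue Z (complex_of_real x / z)" using that evr ev by blast
    then have "cmod (complex_of_real x / z) \<le> cmod \<mu>" by (rule dom(1))
    then show ?thesis using z by (simp add: norm_divide field_simps)
  qed
  have "finite ?S"
  proof (rule finite_subset)
    show "?S \<subseteq> {x. poly (char_poly B) x = 0} \<union> uminus ` {x. poly (char_poly B) x = 0}"
    proof
      fix x assume "x \<in> ?S"
      then have "eigenvalue B x \<or> eigenvalue B (- x)" using neg by auto
      then show "x \<in> {x. poly (char_poly B) x = 0} \<union> uminus ` {x. poly (char_poly B) x = 0}"
        unfolding eigenvalue_root_char_poly[OF B] by (auto intro: image_eqI[of _ _ "- x"])
    qed
    have "char_poly B \<noteq> 0" using degree_monic_char_poly[OF B] by (metis coeff_0 zero_neq_one)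
    then show "finite ({x. poly (char_poly B) x = 0} \<union> uminus ` {x. poly (char_poly B) x = 0})"
      by (simp add: poly_roots_finite)
  qed
  \<comment> \<open>The sign of \<open>r\<close> is not known; \<open>largest_eigenvalue\<close>
    admits both \<open>B\<close> and \<open>- B\<close>, and one of them has the eigenvalue
    \<open>\<bar>r\<bar>\<close>.\<close>
  moreover have "\<bar>r\<bar> \<in> ?S"
    using evr' neg[of "- r"] absr z \<mu>(2) by (cases "r \<ge> 0") auto
  moreover have "x \<le> \<bar>r\<bar>" if "x \<in> ?S" for x
    using that le[of x] le[of "- x"] neg absr by auto
  ultimately have "Max ?S = \<bar>r\<bar>" by (intro Max_eqI) auto
  then show ?thesis unfolding largest_eigenvalue_def absr .
qed

text \<open>This is how quantities that are only estimated at each \<open>t\<close>, or chosen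
  separately for each \<open>t\<close>, become differentiable at \<open>0\<close>.\<close>

lemma has_vector_derivative_quadratic_error:
  fixes f g :: "real \<Rightarrow> 'a::real_normed_vector"
  assumes f: "(f has_vector_derivative a) (at 0)"
    and e: "eventually (\<lambda>t. norm (g t - f t) \<le> K * t\<^sup>2) (nhds 0)"
  shows "(g has_vector_derivative a) (at 0)"
proof -
  \<comment> \<open>The filter \<open>nhds 0\<close>, unlike \<open>at 0\<close>, includes
    \<open>t = 0\<close>, where the bound is zero.\<close>
  have e0: "g 0 = f 0" using eventually_nhds_x_imp_x[OF e] by simp
  have "((\<lambda>t. norm (g t - f t) / \<bar>t\<bar>) \<longlongrightarrow> 0) (at 0)"
  proof (rule tendsto_sandwich)
    show "eventually (\<lambda>t. 0 \<le> norm (g t - f t) / \<bar>t\<bar>) (at 0)" by (intro always_eventually) auto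
    show "eventually (\<lambda>t. norm (g t - f t) / \<bar>t\<bar> \<le> K * \<bar>t\<bar>) (at 0)"
      using e unfolding eventually_at_filter
    proof (rule eventually_mono)
      fix t assume h: "norm (g t - f t) \<le> K * t\<^sup>2"
      have "K * t\<^sup>2 = K * \<bar>t\<bar> * \<bar>t\<bar>" by (simp add: power2_eq_square)
      then show "t \<noteq> 0 \<longrightarrow> t \<in> UNIV \<longrightarrow> norm (g t - f t) / \<bar>t\<bar> \<le> K * \<bar>t\<bar>" using h by (auto simp: pos_divide_le_eq power2_eq_square)
    qed
    show "((\<lambda>t. K * \<bar>t\<bar>) \<longlongrightarrow> 0) (at 0)" by (rule tendsto_eq_intros refl)+ simp_all
  qed auto
  then have "((\<lambda>t. g t - f t) has_vector_derivative 0) (at 0)"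
    by (simp add: has_vector_derivative_def has_derivative_at e0)
  from has_vector_derivative_add[OF this f] show ?thesis by simp
qed

lemma has_real_derivative_ln_cmod:
  fixes f :: "real \<Rightarrow> complex"
  assumes f: "(f has_vector_derivative a) (at 0)" and f0: "f 0 = complex_of_real r" "r > 0"
  shows "((\<lambda>t. ln (cmod (f t))) has_real_derivative Re a / r) (at 0)"
proof -
  have re: "((\<lambda>t. Re (f t)) has_real_derivative Re a) (at 0)" and im: "((\<lambda>t. Im (f t)) has_real_derivative Im a) (at 0)"
    using f by (simp_all add: has_vector_derivative_complex_iff)
  define u where "u t = (Re (f t))\<^sup>2 + (Im (f t))\<^sup>2" for t
  have u0: "u 0 = r\<^sup>2" by (simp add: u_def f0)
  have u: "(u has_real_derivative 2 * r * Re a) (at 0)"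
    using DERIV_add[OF DERIV_power[OF re, of 2] DERIV_power[OF im, of 2]] by (simp add: u_def[abs_def] f0 algebra_simps)
  have "((\<lambda>t. ln (u t) / 2) has_real_derivative Re a / r) (at 0)"
    by (rule derivative_eq_intros u refl | use u0 f0(2) in \<open>simp add: power2_eq_square\<close>)+
  moreover have "(\<lambda>t. ln (cmod (f t))) = (\<lambda>t. ln (u t) / 2)"
  proof
    \<comment> \<open>At a zero of \<open>f\<close> both sides agree through the default value
      \<open>ln 0 = 0\<close>.\<close>
    show "ln (cmod (f t)) = ln (u t) / 2" for t
      by (cases "u t = 0") (auto simp: cmod_def u_def ln_sqrt add_nonneg_eq_0_iff order_less_le)
  qed
  ultimately show ?thesis by simp
qed

lemma eventually_abs_le:
  fixes a b :: real
  assumes "b > 0"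
  shows "eventually (\<lambda>t. a * \<bar>t\<bar> \<le> b) (nhds 0)"
proof -
  have "((\<lambda>t. a * \<bar>t\<bar>) \<longlongrightarrow> a * \<bar>0\<bar>) (nhds 0)"
    by (intro tendsto_intros) (simp add: tendsto_ident_at[unfolded at_within_def] filterlim_def filtermap_ident)
  then have "eventually (\<lambda>t. a * \<bar>t\<bar> < b) (nhds 0)" using assms by (intro order_tendstoD) auto
  then show ?thesis by (rule eventually_mono) simp
qed

text \<open>\<open>B t\<close> is conjugate to \<open>z t\<close> times
  \<open>Z t = D * c t\<close>, where \<open>c t\<close> is \<open>C t\<close> divided by its entry
  \<open>z t\<close> at \<open>(N, N)\<close>. This normalisation makes \<open>Z t $$ (N, N)\<close>
  equal to \<open>d N\<close> exactly, so the top eigenvalue of \<open>Z t\<close> is stationary and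
  the whole variation lies in \<open>z t\<close>. Its modulus follows from
  \<open>z^n det c = 1\<close>: as \<open>\<kappa>\<close> has trace zero, \<open>det c\<close> has
  derivative \<open>n \<kappa> N N\<close>. Eigenvalues and determinants are invariant under
  conjugation, so \<open>H\<close> may depend on \<open>t\<close> in any way.\<close>

lemma ln_largest_eigenvalue_variation:
  fixes B :: "real \<Rightarrow> real mat" and H H' :: "real \<Rightarrow> complex mat" and d :: "nat \<Rightarrow> real"
    and \<Gamma> :: "real \<Rightarrow> complex mat" and \<kappa> :: "nat \<Rightarrow> nat \<Rightarrow> complex"
  assumes n: "n \<ge> 2" and N: "N < n"
    and d: "\<And>i. d i > 0" "\<And>i. i < n \<Longrightarrow> i \<noteq> N \<Longrightarrow> d i < d N" "(\<Prod>i<n. d i) = 1"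
    and D: "D = diag_w n (\<lambda>i. complex_of_real (d i))"
    and D': "D' = diag_w n (\<lambda>i. 1 / complex_of_real (d i))"
    and H: "\<And>t. H t \<in> carrier_mat n n" "\<And>t. H' t \<in> carrier_mat n n" "\<And>t. H t * H' t = 1\<^sub>m n" "\<And>t. H' t * H t = 1\<^sub>m n"
    and B: "eventually (\<lambda>t. B t \<in> carrier_mat n n \<and> det (B t) = 1) (nhds 0)"
    and C: "C = (\<lambda>t. D' * (H t * map_mat complex_of_real (B t) * H' t))"
    and \<Gamma>: "eventually (\<lambda>t. \<Gamma> t \<in> carrier_mat n n \<and> (\<forall>i<n. \<forall>j<n. cmod (\<Gamma> t $$ (i, j)) \<le> \<rho> * \<bar>t\<bar>)) (nhds 0)"
    and \<kappa>: "\<And>i j. i < n \<Longrightarrow> j < n \<Longrightarrow> ((\<lambda>t. \<Gamma> t $$ (i, j)) has_vector_derivative \<kappa> i j) (at 0)" "(\<Sum>i<n. \<kappa> i i) = 0"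
    and conj: "eventually (\<lambda>t. conj_near_ad n (\<Gamma> t) (C t) (K * (\<rho> * \<bar>t\<bar>)\<^sup>2)) (nhds 0)"
    and K: "K \<ge> 0" "\<rho> \<ge> 0"
  shows "((\<lambda>t. ln (largest_eigenvalue (B t))) has_real_derivative - Re (\<kappa> N N)) (at 0)"
proof -
  define L where "L = 1 + real n + real n * K"
  define z where "z t = C t $$ (N, N)" for t
  define c where "c t = mat n n (\<lambda>(i, j). C t $$ (i, j) / z t)" for t
  define Z where "Z t = D * c t" for t
  have Dc: "D \<in> carrier_mat n n" "D' \<in> carrier_mat n n" and cc: "c t \<in> carrier_mat n n" and Zc: "Z t \<in> carrier_mat n n" for t
    by (auto simp: D D' c_def Z_def)
  have "complex_of_real (d i) \<noteq> 0" for i using d(1)[of i] by simp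
  then have DD: "D * D' = 1\<^sub>m n" unfolding D D' by (rule diag_w_inverse)
  have detD: "det D = 1" unfolding D det_diag_w using d(3) by (metis of_real_1 of_real_prod)
  have Hdet: "det (H t) * det (H' t) = 1" for t
    using det_mult[OF H(1)[of t] H(2)[of t]] H(3) by simp
  have BH: "map_mat complex_of_real (B t) = H' t * (D * C t) * H t" "C t \<in> carrier_mat n n"
    "det (C t) = 1"
    if "B t \<in> carrier_mat n n" "det (B t) = 1" for t
  proof -
    let ?B = "map_mat complex_of_real (B t)"
    have Bc: "?B \<in> carrier_mat n n" using that by simp
    show CC: "C t \<in> carrier_mat n n" using Dc H Bc by (auto simp: C)
    have "D * C t = H t * ?B * H' t"
    proof -
      have "D * C t = (D * D') * (H t * ?B * H' t)"
        unfolding C using assoc_mult_mat[OF Dc(1,2), of "H t * ?B * H' t" n] H Bc by simp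
      moreover have "H t * ?B * H' t \<in> carrier_mat n n" using H Bc by simp
      ultimately show ?thesis unfolding DD by (simp only: left_mult_one_mat)
    qed
    then have "H' t * (D * C t) * H t = H' t * (H t * ?B * H' t) * H t" by simp
    also have "\<dots> = (H' t * H t) * ?B * (H' t * H t)"
    proof -
      have c1: "H t * ?B \<in> carrier_mat n n" "H' t * H t \<in> carrier_mat n n" using H Bc by auto
      have "H' t * (H t * ?B * H' t) = (H' t * (H t * ?B)) * H' t" using assoc_mult_mat[OF H(2) c1(1) H(2)] by simp
      also have "H' t * (H t * ?B) = (H' t * H t) * ?B" using assoc_mult_mat[OF H(2,1) Bc] by simp
      finally show ?thesis using assoc_mult_mat[of "H' t * H t * ?B" n n "H' t" n "H t" n] c1 Bc H by auto
    qed
    also have "\<dots> = ?B" unfolding H(4) using Bc by simp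
    finally show "?B = H' t * (D * C t) * H t" by simp
    then have "det ?B = det (H' t) * (det D * det (C t)) * det (H t)"
      using det_mult[of "H' t * (D * C t)" n "H t"] det_mult[of "H' t" n "D * C t"] det_mult[of D n "C t"] H Dc CC by auto
    moreover have "det ?B = 1"
      using that of_real_hom.hom_det[of "B t", where 'a = complex] by simp
    ultimately have "(det (H t) * det (H' t)) * det (C t) = 1" using detD by (simp add: algebra_simps)
    then show "det (C t) = 1" unfolding Hdet by simp
  qed
  have s12: "eventually (\<lambda>t. L * \<rho> * \<bar>t\<bar> \<le> 1 / 2) (nhds 0)" by (rule eventually_abs_le) simp
  have ev1: "eventually (\<lambda>t. z t \<noteq> 0 \<and> det (C t) = 1 \<and> C t \<in> carrier_mat n n \<and>
      B t \<in> carrier_mat n n \<and> map_mat complex_of_real (B t) = H' t * (D * C t) * H t \<and>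
      (\<forall>i<n. \<forall>j<n. cmod (c t $$ (i, j) - (if i = j then 1 else 0)) \<le> 2 * L * \<rho> * \<bar>t\<bar> \<and>
        cmod (c t $$ (i, j) - ((if i = j then 1 + \<Gamma> t $$ (N, N) else 0) - \<Gamma> t $$ (i, j))) \<le> (2 * real n * (L + K) * \<rho>\<^sup>2) * t\<^sup>2)) (nhds 0)"
    using B \<Gamma> conj s12
  proof eventually_elim
    case (elim t)
    have G: "\<Gamma> t \<in> carrier_mat n n" "\<And>i j. i < n \<Longrightarrow> j < n \<Longrightarrow> cmod (\<Gamma> t $$ (i, j)) \<le> \<rho> * \<bar>t\<bar>"
      using elim by auto
    have Bt: "B t \<in> carrier_mat n n" "det (B t) = 1" using elim by auto
    note BH' = BH[OF Bt]
    have C0: "\<exists>i<n. \<exists>j<n. C t $$ (i, j) \<noteq> 0"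
    proof (rule ccontr)
      assume "\<not> ?thesis"
      then have "C t = 0\<^sub>m n n" using BH'(2) by (intro eq_matI) auto
      then have "det (C t) = 0" using n by (simp add: det_zero)
      then show False using BH'(3) by simp
    qed
    have sm: "L * (\<rho> * \<bar>t\<bar>) \<le> 1 / 2" using elim(4) by (simp add: mult.assoc)
    have nic: "C t $$ (N, N) \<noteq> 0"
      "\<And>i j. i < n \<Longrightarrow> j < n \<Longrightarrow> cmod (C t $$ (i, j) / C t $$ (N, N) - (if i = j then 1 else 0)) \<le> 2 * L * (\<rho> * \<bar>t\<bar>)"
      "\<And>i j. i < n \<Longrightarrow> j < n \<Longrightarrow> cmod (C t $$ (i, j) / C t $$ (N, N) - (if i = j then 1 + \<Gamma> t $$ (N, N) else 0) + \<Gamma> t $$ (i, j))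
          \<le> 2 * real n * (L + K) * (\<rho> * \<bar>t\<bar>)\<^sup>2"
      by (rule near_identity_conjugation[OF BH'(2) n N C0 G(1) _ elim(3) K(1) L_def sm]; use G(2) in blast)+
    have "cmod (c t $$ (i, j) - (if i = j then 1 else 0)) \<le> 2 * L * \<rho> * \<bar>t\<bar>" if "i < n" "j < n" for i j
      using nic(2)[OF that] that by (simp add: c_def z_def mult.assoc)
    moreover have "cmod (c t $$ (i, j) - ((if i = j then 1 + \<Gamma> t $$ (N, N) else 0) - \<Gamma> t $$ (i, j))) \<le> (2 * real n * (L + K) * \<rho>\<^sup>2) * t\<^sup>2"
      if "i < n" "j < n" for i j
      using nic(3)[OF that] that by (simp add: c_def z_def power_mult_distrib algebra_simps)
    ultimately show ?case using nic(1) BH' Bt unfolding z_def by blast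
  qed
  have c0: "c 0 = 1\<^sub>m n"
    using eventually_nhds_x_imp_x[OF ev1] cc[of 0] by (intro eq_matI) auto
  have cder: "((\<lambda>t. c t $$ (i, j)) has_vector_derivative (if i = j then \<kappa> N N else 0) - \<kappa> i j) (at 0)"
    if ij: "i < n" "j < n" for i j
  proof (rule has_vector_derivative_quadratic_error)
    show "((\<lambda>t. (if i = j then 1 + \<Gamma> t $$ (N, N) else 0) - \<Gamma> t $$ (i, j)) has_vector_derivative (if i = j then \<kappa> N N else 0) - \<kappa> i j) (at 0)"
      using \<kappa>(1)[OF ij] \<kappa>(1)[OF N N] by (auto intro!: derivative_eq_intros)
    show "eventually (\<lambda>t. cmod (c t $$ (i, j) - ((if i = j then 1 + \<Gamma> t $$ (N, N) else 0) - \<Gamma> t $$ (i, j))) \<le> (2 * real n * (L + K) * \<rho>\<^sup>2) * t\<^sup>2) (nhds 0)"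
      using ev1 by (rule eventually_mono) (use ij in auto)
  qed
  have "((\<lambda>t. det (c t)) has_vector_derivative (\<Sum>i<n. (if i = i then \<kappa> N N else 0) - \<kappa> i i)) (at 0)"
    using cder by (intro has_real_derivative_det cc c0)
  then have detder: "((\<lambda>t. det (c t)) has_vector_derivative of_nat n * \<kappa> N N) (at 0)"
    using \<kappa>(2) by (simp add: sum_subtractf)
  have ctend: "((\<lambda>t. c t $$ (i, j)) \<longlongrightarrow> (if i = j then 1 else 0)) (nhds 0)" if ij: "i < n" "j < n" for i j
  proof -
    have "((\<lambda>t. c t $$ (i, j)) \<longlongrightarrow> c 0 $$ (i, j)) (nhds 0)"
      using has_vector_derivative_continuous[OF cder[OF ij]] by (simp add: continuous_at tendsto_nhds_iff)
    then show ?thesis using ij by (simp add: c0)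
  qed
  have ZE: "Z t $$ (i, j) = d i * c t $$ (i, j)" if "i < n" "j < n" for i j t
    unfolding Z_def D by (rule diag_w_mult_entry(1)[OF cc that])
  obtain \<eta> where \<eta>: "\<eta> > 0" "\<And>i. i < n \<Longrightarrow> i \<noteq> N \<Longrightarrow> d i + 4 * \<eta> \<le> d N"
  proof -
    \<comment> \<open>A quarter of each gap matches the factor \<open>4\<close> in
      \<open>near_diagonal\<close>; the inserted \<open>1\<close> spares a case distinction for an
      empty set.\<close>
    let ?S = "(\<lambda>i. (d N - d i) / 4) ` ({..<n} - {N})"
    have fin: "finite (insert 1 ?S)" by simp
    have "Min (insert 1 ?S) > 0" using d(2) by (subst Min_gr_iff) auto
    moreover have "Min (insert 1 ?S) \<le> (d N - d i) / 4" if "i < n" "i \<noteq> N" for i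
      using that by (intro Min_le) auto
    ultimately show ?thesis using that[of "Min (insert 1 ?S)"] by (fastforce simp: field_simps)
  qed
  define E where "E = d N * (2 * L * \<rho>)"
  have dle: "d i \<le> d N" if "i < n" for i using d(2)[OF that] by (cases "i = N") auto
  \<comment> \<open>In the limit the matrix is diagonal with a zero at \<open>N\<close>. Through
    \<open>eigenvalue_near_exists\<close> this supplies an eigenvalue of \<open>Z t\<close> near
    \<open>d N\<close>.\<close>
  have detZ: "((\<lambda>t. det (Z t - complex_of_real (d N) \<cdot>\<^sub>m 1\<^sub>m n)) \<longlongrightarrow> 0) (nhds 0)"
  proof -
    let ?W = "diag_w n (\<lambda>i. complex_of_real (d i - d N))"
    have "((\<lambda>t. det (Z t - complex_of_real (d N) \<cdot>\<^sub>m 1\<^sub>m n)) \<longlongrightarrow> det ?W) (nhds 0)"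
    proof (rule tendsto_det)
      fix i j assume ij: "i < n" "j < n"
      have "((\<lambda>t. complex_of_real (d i) * c t $$ (i, j) - (if i = j then complex_of_real (d N) else 0))
         \<longlongrightarrow> complex_of_real (d i) * (if i = j then 1 else 0) - (if i = j then complex_of_real (d N) else 0)) (nhds 0)"
        by (intro tendsto_diff tendsto_mult_left tendsto_const ctend ij)
      moreover have "(Z t - complex_of_real (d N) \<cdot>\<^sub>m 1\<^sub>m n) $$ (i, j)
          = complex_of_real (d i) * c t $$ (i, j) - (if i = j then complex_of_real (d N) else 0)" for t
        using ij Zc[of t] ZE[OF ij] by simp
      moreover have "?W $$ (i, j) = complex_of_real (d i) * (if i = j then 1 else 0) - (if i = j then complex_of_real (d N) else 0)"
        using ij by (simp add: diag_w_def)
      ultimately show "((\<lambda>t. (Z t - complex_of_real (d N) \<cdot>\<^sub>m 1\<^sub>m n) $$ (i, j)) \<longlongrightarrow> ?W $$ (i, j)) (nhds 0)"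
        by (simp only:)
    qed (use Zc in \<open>auto intro!: minus_carrier_mat\<close>)
    moreover have "det ?W = 0" unfolding det_diag_w using N by (intro prod_zero) auto
    ultimately show ?thesis by simp
  qed
  have evd: "eventually (\<lambda>t. cmod (det (Z t - complex_of_real (d N) \<cdot>\<^sub>m 1\<^sub>m n)) < \<eta> ^ n) (nhds 0)"
    using order_tendstoD(2)[OF tendsto_norm[OF detZ], of "\<eta> ^ n"] \<eta>(1) by simp
  have ev2: "eventually (\<lambda>t. \<exists>\<mu>. largest_eigenvalue (B t) = cmod (z t) * cmod \<mu> \<and>
       cmod (\<mu> - complex_of_real (d N)) \<le> ((real n)\<^sup>2 * E\<^sup>2 / (3 * \<eta>)) * t\<^sup>2 \<and> \<mu> \<noteq> 0) (nhds 0)"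
    using ev1 eventually_abs_le[of \<eta> "real n * E", OF \<eta>(1)] evd
  proof (eventually_elim)
    case (elim t)
    have "cmod (Z t $$ (i, j) - (if i = j then complex_of_real (d i) else 0)) \<le> E * \<bar>t\<bar>" if ij: "i < n" "j < n" for i j
    proof -
      have "Z t $$ (i, j) - (if i = j then complex_of_real (d i) else 0) = d i * (c t $$ (i, j) - (if i = j then 1 else 0))"
        by (simp add: ZE[OF ij] right_diff_distrib)
      then have "cmod (Z t $$ (i, j) - (if i = j then complex_of_real (d i) else 0)) = d i * cmod (c t $$ (i, j) - (if i = j then 1 else 0))"
        using d(1)[of i] by (simp add: norm_mult del: of_real_mult)
      also have "\<dots> \<le> d N * (2 * L * \<rho> * \<bar>t\<bar>)"
        using elim(1) ij d(1)[of i] d(1)[of N] dle[OF ij(1)] by (intro mult_mono) auto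
      finally show ?thesis by (simp add: E_def mult.assoc)
    qed
    then interpret near_diagonal n N "Z t" d "E * \<bar>t\<bar>" \<eta>
      using elim(2) \<eta> d N Zc by unfold_locales (auto simp: mult.assoc)
    have "n > 0" using n by simp
    then obtain \<mu> where \<mu>: "eigenvalue (Z t) \<mu>" "cmod (\<mu> - complex_of_real (d N)) \<le> \<eta>"
      using eigenvalue_near_exists[OF Zc _ \<eta>(1), of t "complex_of_real (d N)"] elim(3) \<eta>(1) by auto
    have z: "z t \<noteq> 0" using elim(1) by simp
    have "Z t $$ (N, N) = complex_of_real (d N)" using z by (simp add: ZE[OF N N] c_def N z_def)
    then have \<mu>2: "cmod (\<mu> - complex_of_real (d N)) \<le> ((real n)\<^sup>2 * E\<^sup>2 / (3 * \<eta>)) * t\<^sup>2"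
      using top_eigenvalue_expansion[OF \<mu>] by (simp add: power_mult_distrib algebra_simps)
    have "d N - \<eta> > 0"
    proof -
      obtain i where i: "i < n" "i \<noteq> N" using n by (metis One_nat_def less_2_cases_iff less_le_trans zero_neq_one)
      show ?thesis using \<eta> gap[OF i] pos[OF i(1)] by linarith
    qed
    then have \<mu>0: "\<mu> \<noteq> 0" using \<mu>(2) d(1) by auto
    have sim: "similar_mat (map_mat complex_of_real (B t)) (z t \<cdot>\<^sub>m Z t)"
    proof (rule similar_matI)
      have CC: "C t \<in> carrier_mat n n" using elim(1) by simp
      have "C t = z t \<cdot>\<^sub>m c t" using z CC by (intro eq_matI) (auto simp: c_def)
      then have "D * C t = z t \<cdot>\<^sub>m Z t" unfolding Z_def using mult_smult_distrib[OF Dc(1) cc] by simp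
      then show "map_mat complex_of_real (B t) = H' t * (z t \<cdot>\<^sub>m Z t) * H t" using elim(1) by simp
      show "{map_mat complex_of_real (B t), z t \<cdot>\<^sub>m Z t, H' t, H t} \<subseteq> carrier_mat n n"
      proof -
        have "B t \<in> carrier_mat n n" using elim(1) by blast
        then have "map_mat complex_of_real (B t) \<in> carrier_mat n n" by simp
        then show ?thesis using H Zc by simp
      qed
    qed (use H in auto)
    have "largest_eigenvalue (B t) = cmod (z t) * cmod \<mu>"
      using elim(1) dominant_eigenvalue[OF \<mu>] by (intro largest_eigenvalue_dominant[OF _ Zc z sim \<mu>(1) \<mu>0]) auto
    then show ?case using \<mu>2 \<mu>0 by blast
  qed
  \<comment> \<open>A choice for each \<open>t\<close> separately; the quadratic bound alone gives
    the derivative \<open>0\<close> at \<open>0\<close>.\<close>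
  then obtain \<mu> where \<mu>: "eventually (\<lambda>t. largest_eigenvalue (B t) = cmod (z t) * cmod (\<mu> t) \<and>
       cmod (\<mu> t - complex_of_real (d N)) \<le> ((real n)\<^sup>2 * E\<^sup>2 / (3 * \<eta>)) * t\<^sup>2 \<and> \<mu> t \<noteq> 0) (nhds 0)"
    unfolding eventually_ex by blast
  have "(\<mu> has_vector_derivative 0) (at 0)"
    by (rule has_vector_derivative_quadratic_error[of "\<lambda>_. complex_of_real (d N)"])
      (auto intro: eventually_mono[OF \<mu>])
  moreover have "\<mu> 0 = complex_of_real (d N)" using eventually_nhds_x_imp_x[OF \<mu>] by simp
  ultimately have m1: "((\<lambda>t. ln (cmod (\<mu> t))) has_real_derivative 0) (at 0)"
    using has_real_derivative_ln_cmod[of \<mu> 0 "d N"] d(1) by simp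
  have m2: "((\<lambda>t. ln (cmod (det (c t)))) has_real_derivative Re (of_nat n * \<kappa> N N)) (at 0)"
    using has_real_derivative_ln_cmod[OF detder, of 1] by (simp add: c0)
  have m3: "((\<lambda>t. ln (cmod (\<mu> t)) - ln (cmod (det (c t))) / real n) has_real_derivative - Re (\<kappa> N N)) (at 0)"
    by (rule derivative_eq_intros m1 m2 refl)+ (use n in auto)
  have "eventually (\<lambda>t. ln (largest_eigenvalue (B t)) = ln (cmod (\<mu> t)) - ln (cmod (det (c t))) / real n) (nhds 0)"
    using \<mu> ev1
  proof eventually_elim
    case (elim t)
    have z: "z t \<noteq> 0" and CC: "C t \<in> carrier_mat n n" using elim by auto
    have "C t = z t \<cdot>\<^sub>m c t" using z CC by (intro eq_matI) (auto simp: c_def)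
    then have "1 = z t ^ n * det (c t)" using elim(2) cc[of t] by (metis det_smult carrier_matD(2))
    then have e: "cmod (z t) ^ n * cmod (det (c t)) = 1" by (metis norm_mult norm_one norm_power)
    then have "det (c t) \<noteq> 0" by auto
    then have "ln (cmod (z t) ^ n * cmod (det (c t))) = real n * ln (cmod (z t)) + ln (cmod (det (c t)))"
      using z by (simp add: ln_mult ln_realpow)
    then have "real n * ln (cmod (z t)) + ln (cmod (det (c t))) = 0" unfolding e by simp
    then have "ln (cmod (z t)) = - ln (cmod (det (c t))) / real n" using n by (simp add: field_simps)
    then show ?case using elim(1) z by (simp add: ln_mult)
  qed
  from DERIV_cong_ev[OF refl this refl] m3 show ?thesis by simp
qed

section \<open>Gauge transformations by diagonal weights\<close>

text \<open>Conjugation by \<open>diag_w n w\<close> in entries. For \<open>w i = v^i\<close> the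
  factor \<open>v^(i - j)\<close> evaluates \<open>dz^(i - j)\<close> on the vector with coordinate
  \<open>v\<close>.\<close>

definition weight_conj :: "nat \<Rightarrow> (nat \<Rightarrow> complex) \<Rightarrow> complex mat \<Rightarrow> complex mat" where
  "weight_conj n w M = mat n n (\<lambda>(i, j). M $$ (i, j) * (w i / w j))"

lemma weight_conj_carrier [simp]: "weight_conj n w M \<in> carrier_mat n n"
  by (simp add: weight_conj_def)

lemma weight_conj_entry: "i < n \<Longrightarrow> j < n \<Longrightarrow> weight_conj n w M $$ (i, j) = M $$ (i, j) * (w i / w j)"
  by (simp add: weight_conj_def)

lemma weight_conj_mult:
  assumes "A \<in> carrier_mat n n" "B \<in> carrier_mat n n" "\<And>i. w i \<noteq> 0"
  shows "weight_conj n w (A * B) = weight_conj n w A * weight_conj n w B"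
proof (rule eq_matI)
  fix i j assume "i < dim_row (weight_conj n w A * weight_conj n w B)" "j < dim_col (weight_conj n w A * weight_conj n w B)"
  then have ij: "i < n" "j < n" by (auto simp: weight_conj_def)
  have "(weight_conj n w A * weight_conj n w B) $$ (i, j) = (\<Sum>k<n. weight_conj n w A $$ (i, k) * weight_conj n w B $$ (k, j))"
    using ij by (intro mult_mat_entry) auto
  also have "\<dots> = (\<Sum>k<n. A $$ (i, k) * B $$ (k, j) * (w i / w j))"
    using ij assms(3) by (intro sum.cong) (auto simp: weight_conj_entry)
  also have "\<dots> = weight_conj n w (A * B) $$ (i, j)"
    unfolding weight_conj_entry[OF ij] mult_mat_entry[OF assms(1,2) ij] by (simp only: sum_distrib_right)
  finally show "weight_conj n w (A * B) $$ (i, j) = (weight_conj n w A * weight_conj n w B) $$ (i, j)" by simp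
qed (auto simp: weight_conj_def)

lemma weight_conj_commutator:
  assumes "A \<in> carrier_mat n n" "B \<in> carrier_mat n n" "\<And>i. w i \<noteq> 0" "i < n" "j < n"
  shows "(A * B - B * A) $$ (i, j) * (w i / w j) = (weight_conj n w A * weight_conj n w B - weight_conj n w B * weight_conj n w A) $$ (i, j)"
proof -
  have 1: "(A * B - B * A) $$ (i, j) = (A * B) $$ (i, j) - (B * A) $$ (i, j)"
    using assms by (intro index_minus_mat) auto
  have "(weight_conj n w (A * B) - weight_conj n w (B * A)) $$ (i, j) = weight_conj n w (A * B) $$ (i, j) - weight_conj n w (B * A) $$ (i, j)"
    using assms by (intro index_minus_mat) (auto simp: weight_conj_def)
  then show ?thesis
    unfolding 1 weight_conj_mult[OF assms(1-3), symmetric] weight_conj_mult[OF assms(2,1,3), symmetric]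
    using assms(4,5) by (simp add: weight_conj_entry algebra_simps)
qed

lemma weight_conj_inverse:
  assumes "\<And>i. w i \<noteq> 0" "M \<in> carrier_mat n n"
  shows "weight_conj n w (weight_conj n (\<lambda>i. 1 / w i) M) = M"
  using assms by (intro eq_matI) (auto simp: weight_conj_def)

lemma weight_conj_eq_diag_w:
  assumes "M \<in> carrier_mat n n"
  shows "weight_conj n w M = diag_w n w * M * diag_w n (\<lambda>i. 1 / w i)"
proof (rule eq_matI)
  fix i j assume "i < dim_row (diag_w n w * M * diag_w n (\<lambda>i. 1 / w i))" "j < dim_col (diag_w n w * M * diag_w n (\<lambda>i. 1 / w i))"
  then have ij: "i < n" "j < n" by (auto simp: diag_w_def)
  have "diag_w n w * M \<in> carrier_mat n n" using assms by (auto intro: mult_carrier_mat[of _ n n])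
  then show "weight_conj n w M $$ (i, j) = (diag_w n w * M * diag_w n (\<lambda>i. 1 / w i)) $$ (i, j)"
    using ij assms by (simp only: diag_w_mult_entry) (simp add: weight_conj_entry)
qed (auto simp: weight_conj_def diag_w_def)

text \<open>The gauge rule that replaces \<open>F\<close> by \<open>w F w^-1 - w' w^-1\<close>. For
  diagonal \<open>w\<close> the last term is the diagonal matrix of logarithmic derivatives
  \<open>\<theta>\<close>.\<close>

lemma weight_conj_transport:
  fixes M F :: "real \<Rightarrow> complex mat" and w :: "real \<Rightarrow> nat \<Rightarrow> complex"
  assumes F: "F s \<in> carrier_mat n n" and M: "M s \<in> carrier_mat n n" and w: "\<And>i. w s i \<noteq> 0"
    and dM: "((\<lambda>r. M r $$ (i, j)) has_vector_derivative - (F s * M s - M s * F s) $$ (i, j)) (at s within T)"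
    and dw: "\<And>i. ((\<lambda>r. w r i) has_vector_derivative \<theta> i * w s i) (at s within T)"
    and ij: "i < n" "j < n"
  shows "((\<lambda>r. M r $$ (i, j) * (w r i / w r j)) has_vector_derivative
     - ((weight_conj n (w s) (F s) - diag_w n \<theta>) * weight_conj n (w s) (M s) - weight_conj n (w s) (M s) * (weight_conj n (w s) (F s) - diag_w n \<theta>)) $$ (i, j))
     (at s within T)"
proof -
  let ?M = "weight_conj n (w s) (M s)" and ?F = "weight_conj n (w s) (F s)"
  have inv: "((\<lambda>r. inverse (w r j)) has_vector_derivative - (\<theta> j * inverse (w s j))) (at s within T)"
    using field_vector_diff_chain_within[OF dw[of j] DERIV_subset[OF DERIV_inverse[OF w[of j]]], of "(\<lambda>r. w r j) ` T"] w[of j]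
    by (simp add: o_def field_simps power2_eq_square)
  have "((\<lambda>r. M r $$ (i, j) * (w r i * inverse (w r j))) has_vector_derivative
      M s $$ (i, j) * (w s i * - (\<theta> j * inverse (w s j)) + (\<theta> i * w s i) * inverse (w s j))
      + - (F s * M s - M s * F s) $$ (i, j) * (w s i * inverse (w s j))) (at s within T)"
    by (intro has_vector_derivative_mult dM dw inv)
  moreover have "M s $$ (i, j) * (w s i * - (\<theta> j * inverse (w s j)) + (\<theta> i * w s i) * inverse (w s j))
      + - (F s * M s - M s * F s) $$ (i, j) * (w s i * inverse (w s j))
     = - ((?F - diag_w n \<theta>) * ?M - ?M * (?F - diag_w n \<theta>)) $$ (i, j)"
  proof -
    have e: "(?F - diag_w n \<theta>) $$ (a, b) = ?F $$ (a, b) - diag_w n \<theta> $$ (a, b)" if "a < n" "b < n" for a b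
      using that by (intro index_minus_mat) (auto simp: diag_w_def)
    have "((?F - diag_w n \<theta>) * ?M - ?M * (?F - diag_w n \<theta>)) $$ (i, j)
        = (\<Sum>k<n. (?F - diag_w n \<theta>) $$ (i, k) * ?M $$ (k, j)) - (\<Sum>k<n. ?M $$ (i, k) * (?F - diag_w n \<theta>) $$ (k, j))"
      using ij by (intro commutator_entry minus_carrier_mat) auto
    also have "\<dots> = ((\<Sum>k<n. ?F $$ (i, k) * ?M $$ (k, j)) - (\<Sum>k<n. ?M $$ (i, k) * ?F $$ (k, j)))
        - ((\<Sum>k<n. diag_w n \<theta> $$ (i, k) * ?M $$ (k, j)) - (\<Sum>k<n. ?M $$ (i, k) * diag_w n \<theta> $$ (k, j)))"
      using ij by (simp add: e left_diff_distrib right_diff_distrib sum_subtractf)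
    also have "(\<Sum>k<n. ?F $$ (i, k) * ?M $$ (k, j)) - (\<Sum>k<n. ?M $$ (i, k) * ?F $$ (k, j)) = (?F * ?M - ?M * ?F) $$ (i, j)"
      using ij by (intro commutator_entry[symmetric]) auto
    also have "(\<Sum>k<n. diag_w n \<theta> $$ (i, k) * ?M $$ (k, j)) = \<theta> i * ?M $$ (i, j)"
      using ij by (subst mult_mat_entry[symmetric]) (auto simp: diag_w_mult_entry)
    also have "(\<Sum>k<n. ?M $$ (i, k) * diag_w n \<theta> $$ (k, j)) = ?M $$ (i, j) * \<theta> j"
      using ij by (subst mult_mat_entry[symmetric]) (auto simp: diag_w_mult_entry)
    finally show ?thesis
      unfolding weight_conj_commutator[OF F M w ij, symmetric] weight_conj_entry[OF ij]
      by (simp add: divide_inverse algebra_simps)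
  qed
  ultimately show ?thesis by (simp add: divide_inverse)
qed

text \<open>The mean value inequality in \<open>t\<close>. Uniformity in \<open>\<tau>\<close> comes
  from uniform continuity of the derivative on a compact rectangle, for which the open interval is
  cut down to a closed one of half the size.\<close>

lemma uniform_first_order:
  fixes B bd :: "real \<Rightarrow> real \<Rightarrow> complex"
  assumes e: "e > 0"
    and der: "\<And>t \<tau>. t \<in> {-e<..<e} \<Longrightarrow> \<tau> \<in> {a..b} \<Longrightarrow> ((\<lambda>t. B t \<tau>) has_vector_derivative bd t \<tau>) (at t)"
    and cont: "continuous_on ({-e<..<e} \<times> {a..b}) (\<lambda>(t, \<tau>). bd t \<tau>)"
    and B0: "\<And>\<tau>. \<tau> \<in> {a..b} \<Longrightarrow> B 0 \<tau> = 0" and r: "r > 0"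
  shows "eventually (\<lambda>t. \<forall>\<tau>\<in>{a..b}. cmod (B t \<tau> - t *\<^sub>R bd 0 \<tau>) \<le> r * \<bar>t\<bar>) (nhds 0)"
proof -
  have "compact ({- (e / 2)..e / 2} \<times> {a..b})" by (intro compact_Times compact_Icc)
  moreover have "continuous_on ({- (e / 2)..e / 2} \<times> {a..b}) (\<lambda>(t, \<tau>). bd t \<tau>)"
    by (rule continuous_on_subset[OF cont]) (use e in auto)
  ultimately have "uniformly_continuous_on ({- (e / 2)..e / 2} \<times> {a..b}) (\<lambda>(t, \<tau>). bd t \<tau>)"
    by (rule compact_uniformly_continuous[rotated])
  then obtain \<delta> where \<delta>: "\<delta> > 0" "\<And>p p'. p \<in> {- (e / 2)..e / 2} \<times> {a..b} \<Longrightarrow> p' \<in> {- (e / 2)..e / 2} \<times> {a..b} \<Longrightarrow>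
      dist p' p < \<delta> \<Longrightarrow> dist ((\<lambda>(t, \<tau>). bd t \<tau>) p') ((\<lambda>(t, \<tau>). bd t \<tau>) p) < r"
    using r unfolding uniformly_continuous_on_def by metis
  have "cmod (B t \<tau> - t *\<^sub>R bd 0 \<tau>) \<le> r * \<bar>t\<bar>" if t: "\<bar>t\<bar> < min \<delta> (e / 2)" and \<tau>: "\<tau> \<in> {a..b}" for t \<tau>
  proof -
    define S where "S = {- \<bar>t\<bar>..\<bar>t\<bar>}"
    have S: "x \<in> {-e<..<e}" "x \<in> {- (e / 2)..e / 2}" "dist (x, \<tau>) (0, \<tau>) < \<delta>" if "x \<in> S" for x
      using that t e by (auto simp: S_def dist_Pair_Pair dist_real_def)
    have "norm ((\<lambda>t. B t \<tau> - t *\<^sub>R bd 0 \<tau>) t - (\<lambda>t. B t \<tau> - t *\<^sub>R bd 0 \<tau>) 0) \<le> r * norm (t - 0)"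
    proof (rule differentiable_bound[where S = S and f' = "\<lambda>x h. h *\<^sub>R (bd x \<tau> - bd 0 \<tau>)"])
      fix x assume x: "x \<in> S"
      have "((\<lambda>t. B t \<tau> - t *\<^sub>R bd 0 \<tau>) has_vector_derivative bd x \<tau> - bd 0 \<tau>) (at x)"
        using der[OF S(1)[OF x] \<tau>] by (auto intro!: derivative_eq_intros)
      then show "((\<lambda>t. B t \<tau> - t *\<^sub>R bd 0 \<tau>) has_derivative (\<lambda>h. h *\<^sub>R (bd x \<tau> - bd 0 \<tau>))) (at x within S)"
        unfolding has_vector_derivative_def by (rule has_derivative_at_withinI)
      have "dist (bd x \<tau>) (bd 0 \<tau>) < r"
        using \<delta>(2)[of "(0, \<tau>)" "(x, \<tau>)"] S[OF x] \<tau> e by simp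
      moreover have "onorm (\<lambda>h. h *\<^sub>R (bd x \<tau> - bd 0 \<tau>)) \<le> cmod (bd x \<tau> - bd 0 \<tau>)"
        by (rule onorm_le) simp
      ultimately show "onorm (\<lambda>h. h *\<^sub>R (bd x \<tau> - bd 0 \<tau>)) \<le> r" by (simp add: dist_norm)
    qed (auto simp: S_def)
    then show ?thesis using B0[OF \<tau>] by simp
  qed
  moreover have "eventually (\<lambda>t. \<bar>t\<bar> < min \<delta> (e / 2)) (nhds 0)"
    unfolding eventually_nhds_metric using \<delta>(1) e
    by (intro exI[of _ "min \<delta> (e / 2)"]) (auto simp: dist_real_def)
  ultimately show ?thesis by (auto elim!: eventually_mono simp del: min_less_iff_conj)
qed

section \<open>Closed geodesics and their parallel transport\<close>

locale closed_geodesic =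
  fixes A :: "('a::t2_space) chart set" and h :: "'a chart \<Rightarrow> 'a \<Rightarrow> real" and \<gamma> :: "real \<Rightarrow> 'a" and l :: real
  assumes atlas: "riemann_atlas A" and metric: "conformal_metric A h"
    and geodesic: "simple_closed_geodesic A h \<gamma> l"
begin

lemma l_pos: "l > 0" and periodic: "\<gamma> (t + l) = \<gamma> t"
  using geodesic by (auto simp: simple_closed_geodesic_def)

lemma cont_\<gamma>: "continuous_on UNIV \<gamma>"
  using geodesic by (simp add: simple_closed_geodesic_def unit_speed_geodesic_def)

text \<open>The same choice as in \<open>differential_along\<close>, so that the two can be
  identified by unfolding.\<close>

definition cht :: "real \<Rightarrow> 'a chart" where
  "cht t = (SOME ch. ch \<in> A \<and> \<gamma> t \<in> fst ch)"

lemma cht: "cht t \<in> A" "\<gamma> t \<in> fst (cht t)"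
proof -
  have "\<exists>ch. ch \<in> A \<and> \<gamma> t \<in> fst ch" using atlas unfolding riemann_atlas_def by blast
  then have "cht t \<in> A \<and> \<gamma> t \<in> fst (cht t)" unfolding cht_def by (rule someI_ex)
  then show "cht t \<in> A" "\<gamma> t \<in> fst (cht t)" by auto
qed

lemma chart_open:
  assumes "ch \<in> A"
  shows "open (fst ch)" "open (snd ch ` fst ch)" "homeomorphism (fst ch) (snd ch ` fst ch) (snd ch) (chart_inv ch)"
  using atlas assms by (auto simp: riemann_atlas_def)

lemma chart_inv_coord: "ch \<in> A \<Longrightarrow> p \<in> fst ch \<Longrightarrow> chart_inv ch (snd ch p) = p"
  using chart_open(3) by (simp add: homeomorphism_def)

lemma open_times: "ch \<in> A \<Longrightarrow> open {t. \<gamma> t \<in> fst ch}"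
  using open_vimage[OF chart_open(1), of ch \<gamma>] cont_\<gamma> by (simp add: vimage_def)

abbreviation V :: "'a chart \<Rightarrow> real \<Rightarrow> complex" where
  "V ch \<equiv> coord_velocity ch \<gamma>"

context
  fixes ch t assumes ch: "ch \<in> A" and t: "\<gamma> t \<in> fst ch"
begin

lemma V_deriv: "((\<lambda>s. snd ch (\<gamma> s)) has_vector_derivative V ch t) (at t)"
  using geodesic ch t
  by (simp add: simple_closed_geodesic_def unit_speed_geodesic_def coord_velocity_def vector_derivative_works)

lemma V_accel: "(V ch has_vector_derivative - chern_coeff h ch (\<gamma> t) * (V ch t)\<^sup>2) (at t)"
  and V_unit: "tangent_norm h ch (\<gamma> t) (V ch t) = 1"
proof -
  have "unit_speed_geodesic A h \<gamma>" using geodesic by (simp add: simple_closed_geodesic_def)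
  note * = this[unfolded unit_speed_geodesic_def, THEN conjunct2, THEN bspec, OF ch, THEN spec, THEN mp, OF t]
  from * show "(V ch has_vector_derivative - chern_coeff h ch (\<gamma> t) * (V ch t)\<^sup>2) (at t)" by (elim conjE)
  from * show "tangent_norm h ch (\<gamma> t) (V ch t) = 1" by (elim conjE)
qed

lemma h_pos: "h ch (\<gamma> t) > 0"
  using metric ch t unfolding conformal_metric_def by blast

lemma V_nonzero: "V ch t \<noteq> 0"
  using V_unit by (auto simp: tangent_norm_def)

text \<open>Unit speed says that \<open>h V\<close> is the inverse of the conjugate of
  \<open>V\<close>. After rescaling by powers of \<open>V\<close> this turns the metric-dependent
  Cartan involution into minus the ordinary adjoint.\<close>

lemma h_V_V: "complex_of_real (h ch (\<gamma> t)) * V ch t * cnj (V ch t) = 1"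
proof -
  have "(sqrt (h ch (\<gamma> t)) * cmod (V ch t))\<^sup>2 = 1" using V_unit by (simp add: tangent_norm_def)
  then have "h ch (\<gamma> t) * (cmod (V ch t))\<^sup>2 = 1" using h_pos by (simp add: power_mult_distrib)
  then show ?thesis by (metis complex_norm_square mult.assoc of_real_1 of_real_mult)
qed

lemma isCont_V: "isCont (V ch) t"
  using V_accel has_vector_derivative_continuous by blast

lemma V_change:
  assumes ch': "ch' \<in> A" "\<gamma> t \<in> fst ch'"
  shows "V ch' t = transition_deriv ch ch' (\<gamma> t) * V ch t"
proof -
  let ?f = "snd ch' \<circ> chart_inv ch"
  have hol: "?f holomorphic_on (snd ch ` (fst ch \<inter> fst ch'))"
    using atlas ch ch' by (auto simp: riemann_atlas_def)
  have "openin (top_of_set (fst ch)) (fst ch \<inter> fst ch')"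
    using chart_open(1) ch ch' by (intro open_subset openin_open_Int) auto
  then have "openin (top_of_set (snd ch ` fst ch)) (snd ch ` (fst ch \<inter> fst ch'))"
    using homeomorphism_imp_open_map[OF chart_open(3)[OF ch]] by blast
  then have op: "open (snd ch ` (fst ch \<inter> fst ch'))"
    using chart_open(2)[OF ch] by (simp add: openin_open_eq)
  have "(?f has_field_derivative transition_deriv ch ch' (\<gamma> t)) (at (snd ch (\<gamma> t)))"
    unfolding transition_deriv_def using hol op t ch' by (intro holomorphic_derivI[OF hol op]) auto
  from field_vector_diff_chain_at[OF V_deriv this]
  have d: "((\<lambda>s. ?f (snd ch (\<gamma> s))) has_vector_derivative V ch t * transition_deriv ch ch' (\<gamma> t)) (at t)"
    by (simp add: o_def)
  have "((\<lambda>s. snd ch' (\<gamma> s)) has_vector_derivative V ch t * transition_deriv ch ch' (\<gamma> t)) (at t)"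
    by (rule has_vector_derivative_transform_within_open[OF d open_times[OF ch]])
      (use t ch chart_inv_coord in auto)
  moreover have "((\<lambda>s. snd ch' (\<gamma> s)) has_vector_derivative V ch' t) (at t)"
    using geodesic ch'
    by (simp add: simple_closed_geodesic_def unit_speed_geodesic_def coord_velocity_def vector_derivative_works)
  ultimately show ?thesis by (metis mult.commute vector_derivative_at)
qed

text \<open>Makes the gauge at the end of the loop equal to the gauge at its beginning, so the
  gauged holonomy is conjugate to the original one.\<close>

lemma V_periodic: "V ch (t + l) = V ch t"
proof -
  have "((\<lambda>s. s - l) has_vector_derivative 1) (at (t + l))"
    by (auto intro!: derivative_eq_intros)
  moreover have "((\<lambda>s. snd ch (\<gamma> s)) has_vector_derivative V ch t) (at ((t + l) - l))" using V_deriv by simp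
  ultimately have "((\<lambda>s. snd ch (\<gamma> s)) \<circ> (\<lambda>s. s - l) has_vector_derivative 1 *\<^sub>R V ch t) (at (t + l))"
    by (rule vector_diff_chain_at)
  moreover have "\<gamma> (s - l) = \<gamma> s" for s using periodic[of "s - l"] by simp
  ultimately have "((\<lambda>s. snd ch (\<gamma> s)) has_vector_derivative V ch t) (at (t + l))" by (simp add: o_def)
  then show ?thesis by (simp add: coord_velocity_def vector_derivative_at)
qed

end

lemma transition_nonzero:
  assumes "ch \<in> A" "\<gamma> t \<in> fst ch" "ch' \<in> A" "\<gamma> t \<in> fst ch'"
  shows "transition_deriv ch ch' (\<gamma> t) \<noteq> 0"
  using V_change[OF assms] V_nonzero[OF assms(3,4)] by auto

definition loop :: "real \<Rightarrow> 'a" where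
  "loop = (\<lambda>s. \<gamma> (l * s))"

lemma loop_velocity:
  assumes ch: "ch \<in> A" and s: "s \<in> {0..1}" "loop s \<in> fst ch"
  shows "((\<lambda>r. snd ch (loop r)) has_vector_derivative l * V ch (l * s)) (at s within {0..1})"
    and "path_velocity ch loop s = l * V ch (l * s)"
proof -
  have t: "\<gamma> (l * s) \<in> fst ch" using s by (simp add: loop_def)
  have "((\<lambda>r. l * r) has_vector_derivative l) (at s within {0..1})"
    by (auto intro!: derivative_eq_intros)
  from vector_diff_chain_within[OF this has_vector_derivative_at_within[OF V_deriv[OF ch t]]]
  show d: "((\<lambda>r. snd ch (loop r)) has_vector_derivative l * V ch (l * s)) (at s within {0..1})"
    by (simp add: o_def loop_def scaleR_conv_of_real)
  show "path_velocity ch loop s = l * V ch (l * s)"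
    unfolding path_velocity_def
    using vector_derivative_within_cbox[OF _ _ d[unfolded cbox_interval[symmetric]]] s by simp
qed

lemma loop_based: "based_loop (\<gamma> 0) loop"
proof -
  have "continuous_on {0..1} (\<lambda>s. \<gamma> (l * s))"
    by (rule continuous_on_compose2[OF cont_\<gamma>]) (auto intro!: continuous_intros)
  then show ?thesis
    using periodic[of 0] by (simp add: based_loop_def path_def pathstart_def pathfinish_def loop_def)
qed

lemma loop_C1: "C1_path A loop"
proof -
  have "continuous_on {s \<in> {0..1}. loop s \<in> fst ch} (path_velocity ch loop)" if ch: "ch \<in> A" for ch
  proof -
    have "continuous_on {s \<in> {0..1}. loop s \<in> fst ch} (\<lambda>s. complex_of_real l * V ch (l * s))"
    proof (intro continuous_at_imp_continuous_on ballI)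
      fix s assume "s \<in> {s \<in> {0..1}. loop s \<in> fst ch}"
      then have "isCont (V ch) (l * s)" by (intro isCont_V[OF ch]) (simp add: loop_def)
      then show "isCont (\<lambda>s. complex_of_real l * V ch (l * s)) s"
        by (intro continuous_intros) (rule isCont_o2[of s "\<lambda>s. l * s" "V ch"], auto intro!: continuous_intros)
    qed
    then show ?thesis
      by (rule continuous_on_eq) (use loop_velocity(2)[OF ch] in auto)
  qed
  then show ?thesis
    using loop_based loop_velocity(1) unfolding C1_path_def based_loop_def
    by (blast intro: differentiableI_vector)
qed

text \<open>The last factor turns a coefficient of \<open>dz\<^sup>i\<^sup>-\<^sup>j\<close> into a number that does not depend on the chart.\<close>

definition along :: "'a G_form \<Rightarrow> 'a chart \<Rightarrow> real \<Rightarrow> nat \<Rightarrow> nat \<Rightarrow> complex" where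
  "along \<omega> ch t i j = (V ch t * fst (\<omega> ch (\<gamma> t)) $$ (i, j) + cnj (V ch t) * snd (\<omega> ch (\<gamma> t)) $$ (i, j))
     * (V ch t ^ i / V ch t ^ j)"

lemma powi_diff_eq: "x \<noteq> 0 \<Longrightarrow> x powi (int i - int j) = x ^ i / (x ^ j :: complex)"
  by (simp add: power_int_diff)

lemma along_chart_indep:
  assumes ch: "ch \<in> A" "\<gamma> t \<in> fst ch" and ch': "ch' \<in> A" "\<gamma> t \<in> fst ch'"
    and \<omega>: "is_G_form n A \<omega>" and ij: "i < n" "j < n"
  shows "along \<omega> ch t i j = along \<omega> ch' t i j"
proof -
  define \<tau> where "\<tau> = transition_deriv ch ch' (\<gamma> t)"
  have \<tau>0: "\<tau> \<noteq> 0" unfolding \<tau>_def by (rule transition_nonzero[OF ch ch'])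
  have V: "V ch' t = \<tau> * V ch t" unfolding \<tau>_def by (rule V_change[OF ch ch'])
  have V0: "V ch t \<noteq> 0" by (rule V_nonzero[OF ch])
  have "fst (\<omega> ch (\<gamma> t)) $$ (i, j) = fst (\<omega> ch' (\<gamma> t)) $$ (i, j) * \<tau> powi (int i - int j) * \<tau>"
    "snd (\<omega> ch (\<gamma> t)) $$ (i, j) = snd (\<omega> ch' (\<gamma> t)) $$ (i, j) * \<tau> powi (int i - int j) * cnj \<tau>"
    using \<omega> ch ch' ij unfolding is_G_form_def \<tau>_def Let_def by blast+
  moreover have "(\<tau> * V ch t) ^ i / (\<tau> * V ch t) ^ j = (\<tau> ^ i / \<tau> ^ j) * (V ch t ^ i / V ch t ^ j)"
    by (simp add: power_mult_distrib)
  ultimately show ?thesis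
    unfolding along_def V powi_diff_eq[OF \<tau>0] by (simp only: complex_cnj_mult distrib_right distrib_left mult_ac)
qed

end

section \<open>Regularity of families of forms along the geodesic\<close>

lemma continuous_on_local:
  fixes f :: "'a::t2_space \<Rightarrow> 'b::topological_space"
  assumes "\<And>x. x \<in> S \<Longrightarrow> \<exists>T g. open T \<and> x \<in> T \<and> continuous_on T g \<and> (\<forall>y\<in>T. f y = g y)"
  shows "continuous_on S f"
proof (intro continuous_at_imp_continuous_on ballI)
  fix x assume "x \<in> S"
  then obtain T g where T: "open T" "x \<in> T" "continuous_on T g" "\<forall>y\<in>T. f y = g y" using assms by blast
  have "continuous_on T f" using T(3,4) by (simp cong: continuous_on_cong)
  then show "isCont f x" using T(1,2) by (simp add: continuous_on_eq_continuous_at)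
qed

lemma smooth_on_partial:
  fixes f :: "real \<times> complex \<Rightarrow> complex"
  assumes f: "smooth_on f S"
  shows "continuous_on S f"
    and "(t, x) \<in> S \<Longrightarrow> ((\<lambda>t. f (t, x)) has_vector_derivative frechet_derivative f (at (t, x)) (1, 0)) (at t)"
    and "continuous_on S (\<lambda>p. frechet_derivative f (at p) (1, 0))"
proof -
  have "Ck_on 0 f S" "Ck_on (Suc 0) f S" using f by (auto simp: smooth_on_def simp del: Ck_on.simps)
  then show "continuous_on S f" "continuous_on S (\<lambda>p. frechet_derivative f (at p) (1, 0))" by auto
  have d: "f differentiable (at p)" if "p \<in> S" for p using \<open>Ck_on (Suc 0) f S\<close> that by auto
  assume "(t, x) \<in> S"
  from d[OF this] have fd: "(f has_derivative frechet_derivative f (at (t, x))) (at (t, x))"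
    by (simp add: frechet_derivative_works)
  have "((\<lambda>t. (t, x)) has_vector_derivative (1, 0)) (at t)"
    by (auto intro!: derivative_eq_intros has_vector_derivative_Pair)
  then have "((\<lambda>t. (t, x)) has_derivative (\<lambda>h. h *\<^sub>R (1, 0))) (at t)" by (simp add: has_vector_derivative_def)
  note c = has_derivative_compose[OF this fd]
  have e: "(\<lambda>h. frechet_derivative f (at (t, x)) (h *\<^sub>R (1, 0))) = (\<lambda>h. h *\<^sub>R frechet_derivative f (at (t, x)) (1, 0))"
    by (rule ext) (rule linear_scale[OF has_derivative_linear[OF fd]])
  from c show "((\<lambda>t. f (t, x)) has_vector_derivative frechet_derivative f (at (t, x)) (1, 0)) (at t)"
    unfolding has_vector_derivative_def e .
qed

context closed_geodesic
begin

lemma along_has_derivative: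
  assumes "((\<lambda>t. fst (\<beta> t ch (\<gamma> \<tau>)) $$ (i, j)) has_vector_derivative x) (at t)"
    and "((\<lambda>t. snd (\<beta> t ch (\<gamma> \<tau>)) $$ (i, j)) has_vector_derivative y) (at t)"
  shows "((\<lambda>t. along (\<beta> t) ch \<tau> i j) has_vector_derivative (V ch \<tau> * x + cnj (V ch \<tau>) * y) * (V ch \<tau> ^ i / V ch \<tau> ^ j)) (at t)"
  unfolding along_def by (auto intro!: derivative_eq_intros assms)

text \<open>The chart \<open>cht \<tau>\<close> is an arbitrary choice that may jump with
  \<open>\<tau>\<close>. Since \<open>along\<close> does not depend on the chart, it can be computed
  near each \<open>\<tau>0\<close> in one fixed chart, where smoothness is available.\<close>

lemma along_family:
  fixes \<beta> :: "real \<Rightarrow> 'a G_form"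
  assumes sm: "\<And>ch. ch \<in> A \<Longrightarrow>
          smooth_on (\<lambda>(t, x). fst (\<beta> t ch (chart_inv ch x)) $$ (i, j)) ({-e<..<e} \<times> snd ch ` fst ch) \<and>
          smooth_on (\<lambda>(t, x). snd (\<beta> t ch (chart_inv ch x)) $$ (i, j)) ({-e<..<e} \<times> snd ch ` fst ch)"
    and G: "\<And>t. t \<in> {-e<..<e} \<Longrightarrow> is_G_form n A (\<beta> t)" and ij: "i < n" "j < n"
  shows "\<exists>bd. (\<forall>t\<in>{-e<..<e}. \<forall>\<tau>. ((\<lambda>t. along (\<beta> t) (cht \<tau>) \<tau> i j) has_vector_derivative bd t \<tau>) (at t)) \<and>
     continuous_on ({-e<..<e} \<times> UNIV) (\<lambda>(t, \<tau>). bd t \<tau>) \<and>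
     (\<forall>t\<in>{-e<..<e}. continuous_on UNIV (\<lambda>\<tau>. along (\<beta> t) (cht \<tau>) \<tau> i j))"
proof -
  define \<phi> where "\<phi> ch = (\<lambda>(t, x). fst (\<beta> t ch (chart_inv ch x)) $$ (i, j))" for ch
  define \<psi> where "\<psi> ch = (\<lambda>(t, x). snd (\<beta> t ch (chart_inv ch x)) $$ (i, j))" for ch
  have sm': "smooth_on (\<phi> ch) ({-e<..<e} \<times> snd ch ` fst ch)" "smooth_on (\<psi> ch) ({-e<..<e} \<times> snd ch ` fst ch)" if "ch \<in> A" for ch
    using sm[OF that] by (simp_all add: \<phi>_def \<psi>_def)
  define L where "L ch p = frechet_derivative (\<phi> ch) (at p) (1, 0)" for ch p
  define R where "R ch p = frechet_derivative (\<psi> ch) (at p) (1, 0)" for ch p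
  define bdc where "bdc ch t \<tau> = (V ch \<tau> * L ch (t, snd ch (\<gamma> \<tau>)) + cnj (V ch \<tau>) * R ch (t, snd ch (\<gamma> \<tau>))) * (V ch \<tau> ^ i / V ch \<tau> ^ j)"
    for ch t \<tau>
  have der: "((\<lambda>t. along (\<beta> t) ch \<tau> i j) has_vector_derivative bdc ch t \<tau>) (at t)"
    if t: "t \<in> {-e<..<e}" and ch: "ch \<in> A" "\<gamma> \<tau> \<in> fst ch" for t ch \<tau>
    unfolding bdc_def
  proof (rule along_has_derivative)
    have p: "(t, snd ch (\<gamma> \<tau>)) \<in> {-e<..<e} \<times> snd ch ` fst ch" using t ch by auto
    show "((\<lambda>t. fst (\<beta> t ch (\<gamma> \<tau>)) $$ (i, j)) has_vector_derivative L ch (t, snd ch (\<gamma> \<tau>))) (at t)"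
      using smooth_on_partial(2)[OF sm'(1)[OF ch(1)] p] chart_inv_coord[OF ch] by (simp add: L_def \<phi>_def)
    show "((\<lambda>t. snd (\<beta> t ch (\<gamma> \<tau>)) $$ (i, j)) has_vector_derivative R ch (t, snd ch (\<gamma> \<tau>))) (at t)"
      using smooth_on_partial(2)[OF sm'(2)[OF ch(1)] p] chart_inv_coord[OF ch] by (simp add: R_def \<psi>_def)
  qed
  \<comment> \<open>The derivative in \<open>t\<close> inherits independence of the chart because it
    is the derivative of the same function.\<close>
  have indep: "bdc (cht \<tau>) t \<tau> = bdc ch t \<tau>" if t: "t \<in> {-e<..<e}" and ch: "ch \<in> A" "\<gamma> \<tau> \<in> fst ch" for t ch \<tau>
  proof -
    have "((\<lambda>t. along (\<beta> t) ch \<tau> i j) has_vector_derivative bdc (cht \<tau>) t \<tau>) (at t)"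
      by (rule has_vector_derivative_transform_within_open[OF der[OF t cht] _ t])
        (use along_chart_indep[OF cht ch G ij] in auto)
    from vector_derivative_unique_at[OF this der[OF t ch]] show ?thesis .
  qed
  have contV: "continuous_on {\<tau>. \<gamma> \<tau> \<in> fst ch} (V ch)" "continuous_on {\<tau>. \<gamma> \<tau> \<in> fst ch} (\<lambda>\<tau>. snd ch (\<gamma> \<tau>))" if ch: "ch \<in> A" for ch
    using isCont_V[OF ch] has_vector_derivative_continuous[OF V_deriv[OF ch]]
    by (auto intro: continuous_at_imp_continuous_on)
  have cont_comp: "continuous_on ({-e<..<e} \<times> {\<tau>. \<gamma> \<tau> \<in> fst ch}) (\<lambda>p. F (fst p, snd ch (\<gamma> (snd p))))"
    if ch: "ch \<in> A" and F: "continuous_on ({-e<..<e} \<times> snd ch ` fst ch) F" for ch and F :: "real \<times> complex \<Rightarrow> complex"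
    by (rule continuous_on_compose2[OF F])
      (auto intro!: continuous_intros continuous_on_compose2[OF contV(2)[OF ch]])
  have contV2: "continuous_on ({-e<..<e} \<times> {\<tau>. \<gamma> \<tau> \<in> fst ch}) (\<lambda>p. V ch (snd p))" if ch: "ch \<in> A" for ch
    by (rule continuous_on_compose2[OF contV(1)[OF ch]]) (auto intro!: continuous_intros)
  have contbd: "continuous_on ({-e<..<e} \<times> UNIV) (\<lambda>(t, \<tau>). bdc (cht \<tau>) t \<tau>)"
  proof (rule continuous_on_local)
    fix p :: "real \<times> real" assume p: "p \<in> {-e<..<e} \<times> UNIV"
    obtain t0 \<tau>0 where p0: "p = (t0, \<tau>0)" by (cases p)
    let ?ch = "cht \<tau>0" and ?T = "{-e<..<e} \<times> {\<tau>. \<gamma> \<tau> \<in> fst (cht \<tau>0)}"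
    have "continuous_on ?T (\<lambda>p. bdc ?ch (fst p) (snd p))"
      unfolding bdc_def
      using V_nonzero[OF cht(1)[of \<tau>0]]
      by (intro continuous_intros contV2 cont_comp[of ?ch "L ?ch"] cont_comp[of ?ch "R ?ch"] cht(1))
        (auto simp: L_def[abs_def] R_def[abs_def] intro!: smooth_on_partial(3) sm' cht(1))
    moreover have "open ?T" by (intro open_Times open_times cht(1)) auto
    moreover have "p \<in> ?T" using p p0 cht(2) by auto
    moreover have "\<forall>y\<in>?T. (\<lambda>(t, \<tau>). bdc (cht \<tau>) t \<tau>) y = bdc ?ch (fst y) (snd y)"
      using indep[OF _ cht(1)] by auto
    ultimately show "\<exists>T g. open T \<and> p \<in> T \<and> continuous_on T g \<and> (\<forall>y\<in>T. (\<lambda>(t, \<tau>). bdc (cht \<tau>) t \<tau>) y = g y)"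
      by blast
  qed
  have contb: "continuous_on UNIV (\<lambda>\<tau>. along (\<beta> t) (cht \<tau>) \<tau> i j)" if t: "t \<in> {-e<..<e}" for t
  proof (rule continuous_on_local)
    fix \<tau>0 :: real
    let ?ch = "cht \<tau>0" and ?T = "{\<tau>. \<gamma> \<tau> \<in> fst (cht \<tau>0)}"
    have c: "continuous_on ?T (\<lambda>\<tau>. F (t, snd ?ch (\<gamma> \<tau>)))"
      if F: "continuous_on ({-e<..<e} \<times> snd ?ch ` fst ?ch) F" for F :: "real \<times> complex \<Rightarrow> complex"
      by (rule continuous_on_compose2[OF F])
        (use t in \<open>auto intro!: continuous_intros contV(2) cht(1)\<close>)
    have "continuous_on ?T (\<lambda>\<tau>. (V ?ch \<tau> * \<phi> ?ch (t, snd ?ch (\<gamma> \<tau>)) + cnj (V ?ch \<tau>) * \<psi> ?ch (t, snd ?ch (\<gamma> \<tau>))) * (V ?ch \<tau> ^ i / V ?ch \<tau> ^ j))"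
      using V_nonzero[OF cht(1)[of \<tau>0]]
      by (intro continuous_intros contV cht(1) c smooth_on_partial(1) sm') auto
    moreover have "open ?T" by (intro open_times cht(1))
    moreover have "\<tau>0 \<in> ?T" using cht(2) by auto
    moreover have "\<forall>\<tau>\<in>?T. along (\<beta> t) (cht \<tau>) \<tau> i j = (V ?ch \<tau> * \<phi> ?ch (t, snd ?ch (\<gamma> \<tau>)) + cnj (V ?ch \<tau>) * \<psi> ?ch (t, snd ?ch (\<gamma> \<tau>))) * (V ?ch \<tau> ^ i / V ?ch \<tau> ^ j)"
      using along_chart_indep[OF cht cht(1)[of \<tau>0] _ G[OF t] ij] chart_inv_coord[OF cht(1)[of \<tau>0]]
      by (simp add: along_def \<phi>_def \<psi>_def)
    ultimately show "\<exists>T g. open T \<and> \<tau>0 \<in> T \<and> continuous_on T g \<and> (\<forall>\<tau>\<in>T. along (\<beta> t) (cht \<tau>) \<tau> i j = g \<tau>)"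
      by blast
  qed
  show ?thesis
    by (rule exI[of _ "\<lambda>t \<tau>. bdc (cht \<tau>) t \<tau>"]) (use der[OF _ cht] contbd contb in auto)
qed

text \<open>The matrix \<open>E0_mat n (k - 1)\<close> is supported on \<open>i - j = k - 1\<close>,
  so the weight \<open>v^(k - 1)\<close> and the \<open>v\<close> from \<open>dz\<close> complete
  \<open>q\<close> to \<open>q v^k\<close>. In the adjoint term the power of \<open>h\<close> is
  converted by \<open>h_V_V\<close> and yields the conjugate.\<close>

lemma along_psi0:
  assumes ij: "i < n" "j < n" and k: "2 \<le> k"
  shows "along (psi0 n k h q) (cht \<tau>) \<tau> i j = differential_along A k q \<gamma> \<tau> * E0_mat n (k - 1) $$ (i, j)
     + cnj (differential_along A k q \<gamma> \<tau>) * cnj (E0_mat n (k - 1) $$ (j, i))"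
proof -
  let ?ch = "cht \<tau>" and ?p = "\<gamma> \<tau>"
  define v where "v = V ?ch \<tau>"
  define H where "H = complex_of_real (h ?ch ?p)"
  define q0 where "q0 = q ?ch ?p"
  have Q: "differential_along A k q \<gamma> \<tau> = q0 * v ^ k"
    by (simp add: differential_along_def cht_def Let_def q0_def v_def)
  have v0: "v \<noteq> 0" unfolding v_def by (rule V_nonzero[OF cht])
  have Hv: "H * v * cnj v = 1" unfolding H_def v_def by (rule h_V_V[OF cht])
  have fst: "fst (psi0 n k h q ?ch ?p) $$ (i, j) = q0 * E0_mat n (k - 1) $$ (i, j)"
    using ij carrier_matD[OF E0_mat_carrier[of n "k - 1"]]
    by (simp add: psi0_def form_diff_def phi0_def cartan_form_def cartan_fibre_def q0_def)
  have snd: "snd (psi0 n k h q ?ch ?p) $$ (i, j) = cnj (q0 * E0_mat n (k - 1) $$ (j, i)) * H powi (int i - int j)"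
    using ij carrier_matD[OF E0_mat_carrier[of n "k - 1"]]
    by (simp add: psi0_def form_diff_def phi0_def cartan_form_def cartan_fibre_def q0_def H_def)
  have 1: "v * (q0 * E0_mat n (k - 1) $$ (i, j)) * (v ^ i / v ^ j) = q0 * v ^ k * E0_mat n (k - 1) $$ (i, j)"
  proof (cases "i = j + (k - 1)")
    case True
    obtain m where m: "k = Suc m" using k by (cases k) auto
    have e: "v * (v ^ i / v ^ j) = v ^ k" using v0 by (simp add: True m power_add)
    have "v * (q0 * x) * (v ^ i / v ^ j) = q0 * (v * (v ^ i / v ^ j)) * x" for x by (simp only: mult_ac)
    then show ?thesis unfolding e .
  qed (use ij in \<open>simp add: E0_mat_entry\<close>)
  have 2: "cnj v * (cnj (q0 * E0_mat n (k - 1) $$ (j, i)) * H powi (int i - int j)) * (v ^ i / v ^ j)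
     = cnj (q0 * v ^ k) * cnj (E0_mat n (k - 1) $$ (j, i))"
  proof (cases "j = i + (k - 1)")
    case True
    have H0: "H \<noteq> 0" using Hv by auto
    have "H powi (int i - int j) * (v ^ i / v ^ j) = (H * v) powi (int i - int j)"
      using v0 by (simp add: power_int_mult_distrib powi_diff_eq)
    also have "H * v = inverse (cnj v)" using Hv v0 by (simp add: field_simps)
    also have "inverse (cnj v) powi (int i - int j) = cnj v ^ (k - 1)"
      using True by (simp add: power_int_inverse power_int_minus[symmetric] del: One_nat_def)
    finally have e: "H powi (int i - int j) * (v ^ i / v ^ j) = cnj v ^ (k - 1)" .
    have "cnj v * cnj v ^ (k - 1) = cnj v ^ k" using k by (cases k) auto
    then have "cnj v * (H powi (int i - int j) * (v ^ i / v ^ j)) = cnj (v ^ k)" unfolding e by simp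
    moreover have "cnj v * (cnj q0 * cnj x * y) * z = cnj q0 * (cnj v * (y * z)) * cnj x" for x y z
      by (simp only: mult_ac)
    ultimately show ?thesis by (simp only: complex_cnj_mult)
  qed (use ij in \<open>simp add: E0_mat_entry\<close>)
  show ?thesis
    unfolding along_def v_def[symmetric] fst snd Q distrib_right 1 2 ..
qed


section \<open>Parallel transport in the frame given by the velocity vector\<close>

definition gauged_form :: "nat \<Rightarrow> 'a G_form \<Rightarrow> real \<Rightarrow> complex mat" where
  "gauged_form n \<beta> t = mat n n (\<lambda>(i, j). along \<beta> (cht t) t i j)"

definition gauged_section :: "nat \<Rightarrow> ('a chart \<Rightarrow> real \<Rightarrow> complex mat) \<Rightarrow> real \<Rightarrow> complex mat" where
  "gauged_section n M s = weight_conj n (\<lambda>i. V (cht (l * s)) (l * s) ^ i) (M (cht (l * s)) s)"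

text \<open>The chart in the definition changes with \<open>s\<close>; differentiation needs the
  section expressed in one fixed chart.\<close>

lemma gauged_section_chart:
  assumes par: "parallel_section n A \<omega> loop M" and ch: "ch \<in> A" "\<gamma> (l * s) \<in> fst ch" and s: "s \<in> {0..1}"
  shows "gauged_section n M s = weight_conj n (\<lambda>i. V ch (l * s) ^ i) (M ch s)"
proof (rule eq_matI)
  let ?ch = "cht (l * s)" and ?t = "l * s"
  fix i j assume "i < dim_row (weight_conj n (\<lambda>i. V ch ?t ^ i) (M ch s))" "j < dim_col (weight_conj n (\<lambda>i. V ch ?t ^ i) (M ch s))"
  then have ij: "i < n" "j < n" by (auto simp: weight_conj_def)
  define \<tau> where "\<tau> = transition_deriv ?ch ch (\<gamma> ?t)"
  have \<tau>0: "\<tau> \<noteq> 0" unfolding \<tau>_def by (rule transition_nonzero[OF cht ch])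
  have V: "V ch ?t = \<tau> * V ?ch ?t" unfolding \<tau>_def by (rule V_change[OF cht ch])
  have "loop s \<in> fst ?ch \<inter> fst ch" using cht(2) ch by (simp add: loop_def)
  then have "M ?ch s $$ (i, j) = M ch s $$ (i, j) * transition_deriv ?ch ch (loop s) powi (int i - int j)"
    using par cht(1) ch(1) s ij unfolding parallel_section_def by blast
  then have "M ?ch s $$ (i, j) = M ch s $$ (i, j) * (\<tau> ^ i / \<tau> ^ j)"
    by (simp only: \<tau>_def[symmetric] loop_def powi_diff_eq[OF \<tau>0])
  then show "gauged_section n M s $$ (i, j) = weight_conj n (\<lambda>i. V ch ?t ^ i) (M ch s) $$ (i, j)"
    using ij by (simp add: gauged_section_def weight_conj_entry V power_mult_distrib)
qed (auto simp: gauged_section_def weight_conj_def)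

text \<open>The Higgs field has degree \<open>-1\<close>, which cancels the \<open>v\<close> from
  \<open>dz\<close> and leaves \<open>Y\<close>. Its Cartan image becomes \<open>- X\<close> by
  \<open>h_V_V\<close>. The Chern term is diagonal and stays; it is removed only by the derivative
  of the gauge.\<close>

lemma weight_conj_form_along:
  assumes G: "is_G_form n A \<beta>" and ch: "ch \<in> A" "\<gamma> (l * s) \<in> fst ch" and s: "s \<in> {0..1}" and ij: "i < n" "j < n"
  shows "weight_conj n (\<lambda>i. V ch (l * s) ^ i) (form_along (form_add (D_form n h) \<beta>) ch loop s) $$ (i, j)
    = l * ((Y_mat n - X_mat n + gauged_form n \<beta> (l * s)) $$ (i, j) - V ch (l * s) * chern_coeff h ch (\<gamma> (l * s)) * a_mat n $$ (i, j))"
proof -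
  let ?p = "\<gamma> (l * s)"
  define v where "v = V ch (l * s)"
  define H where "H = complex_of_real (h ch ?p)"
  define \<xi> where "\<xi> = chern_coeff h ch ?p"
  define b1 where "b1 = fst (\<beta> ch ?p) $$ (i, j)"
  define b2 where "b2 = snd (\<beta> ch ?p) $$ (i, j)"
  have v0: "v \<noteq> 0" unfolding v_def by (rule V_nonzero[OF ch])
  have Hv: "H * v * cnj v = 1" unfolding H_def v_def by (rule h_V_V[OF ch])
  have dims: "fst (\<beta> ch ?p) \<in> carrier_mat n n" "snd (\<beta> ch ?p) \<in> carrier_mat n n"
    using G ch by (auto simp: is_G_form_def sl_mat_def)
  have dims': "a_mat n \<in> carrier_mat n n" by (simp add: a_mat_eq)
  note dd = carrier_matD[OF dims(1)] carrier_matD[OF dims(2)] carrier_matD[OF dims']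
    carrier_matD[OF XY_mat_carrier(1)[of n]] carrier_matD[OF XY_mat_carrier(2)[of n]]
  have fst: "fst (form_add (D_form n h) \<beta> ch ?p) \<in> carrier_mat n n"
    "fst (form_add (D_form n h) \<beta> ch ?p) $$ (i, j) = - \<xi> * a_mat n $$ (i, j) + Y_mat n $$ (i, j) + b1"
    using ij dims dd by (auto simp: form_add_def D_form_def form_diff_def chern_form_def higgs_form_def cartan_form_def
      cartan_fibre_def b1_def \<xi>_def intro!: carrier_matI)
  have snd: "snd (form_add (D_form n h) \<beta> ch ?p) \<in> carrier_mat n n"
    "snd (form_add (D_form n h) \<beta> ch ?p) $$ (i, j) = cnj (Y_mat n $$ (j, i)) * H powi (int i - int j) + b2"
    using ij dims dd by (auto simp: form_add_def D_form_def form_diff_def chern_form_def higgs_form_def cartan_form_def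
      cartan_fibre_def b2_def H_def intro!: carrier_matI)
  have lp: "loop s = ?p" by (simp add: loop_def)
  have pv: "path_velocity ch loop s = l * v"
    unfolding v_def using loop_velocity(2)[OF ch(1) s] ch lp by simp
  have ff: "form_along (form_add (D_form n h) \<beta>) ch loop s $$ (i, j)
     = l * v * fst (form_add (D_form n h) \<beta> ch ?p) $$ (i, j) + cnj (l * v) * snd (form_add (D_form n h) \<beta> ch ?p) $$ (i, j)"
    unfolding form_along_def lp pv using ij carrier_matD[OF fst(1)] carrier_matD[OF snd(1)] by simp
  define W where "W = v ^ i / v ^ j"
  have "weight_conj n (\<lambda>i. v ^ i) (form_along (form_add (D_form n h) \<beta>) ch loop s) $$ (i, j)
     = l * ((v * b1 + cnj v * b2) * (v ^ i / v ^ j) + v * Y_mat n $$ (i, j) * (v ^ i / v ^ j)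
        + cnj v * cnj (Y_mat n $$ (j, i)) * (H powi (int i - int j) * (v ^ i / v ^ j)) - v * \<xi> * (a_mat n $$ (i, j) * (v ^ i / v ^ j)))"
    unfolding weight_conj_entry[OF ij] W_def[symmetric] ff fst(2) snd(2) by (simp add: algebra_simps)
  also have "(v * b1 + cnj v * b2) * (v ^ i / v ^ j) = gauged_form n \<beta> (l * s) $$ (i, j)"
    using along_chart_indep[OF ch cht G ij] ij by (simp add: gauged_form_def along_def v_def b1_def b2_def)
  also have "v * Y_mat n $$ (i, j) * (v ^ i / v ^ j) = Y_mat n $$ (i, j)"
    using ij v0 by (simp add: Y_mat_def)
  also have "cnj v * cnj (Y_mat n $$ (j, i)) * (H powi (int i - int j) * (v ^ i / v ^ j)) = - X_mat n $$ (i, j)"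
  proof (cases "i = Suc j")
    case True
    have "cnj v * cnj (Y_mat n $$ (j, i)) * (H powi (int i - int j) * (v ^ i / v ^ j)) = (H * v * cnj v) * cnj (Y_mat n $$ (j, i))"
      using v0 by (simp add: True)
    then show ?thesis using ij True unfolding Hv by (simp add: Y_mat_def X_mat_def c_coeff_def)
  qed (use ij in \<open>simp add: Y_mat_def X_mat_def\<close>)
  also have "a_mat n $$ (i, j) * (v ^ i / v ^ j) = a_mat n $$ (i, j)"
    using ij v0 by (simp add: a_mat_eq)
  finally show ?thesis
    using ij dd by (simp add: v_def \<xi>_def gauged_form_def algebra_simps)
qed

text \<open>The geodesic equation \<open>v' = - \<xi> v^2\<close> makes the logarithmic derivative
  of \<open>v^i\<close> equal to \<open>- i \<xi> v\<close>, up to the factor \<open>l\<close> of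
  the parametrisation. This cancels the Chern term along \<open>a_mat\<close> up to a multiple of
  the identity, and scalars drop out of the commutator.\<close>

lemma gauged_transport:
  assumes par: "parallel_section n A (form_add (D_form n h) \<beta>) loop M" and G: "is_G_form n A \<beta>"
    and s: "s \<in> {0..1}" and ij: "i < n" "j < n" and F: "F = complex_of_real l \<cdot>\<^sub>m (Y_mat n - X_mat n + gauged_form n \<beta> (l * s))"
  shows "((\<lambda>r. gauged_section n M r $$ (i, j)) has_vector_derivative
     - (F * gauged_section n M s - gauged_section n M s * F) $$ (i, j)) (at s within {0..1})"
proof -
  let ?ch = "cht (l * s)" and ?\<omega> = "form_add (D_form n h) \<beta>"
  note ch = cht[of "l * s"]
  define \<xi> where "\<xi> = chern_coeff h ?ch (\<gamma> (l * s))"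
  define w where "w r i = V ?ch (l * r) ^ i" for r and i :: nat
  define \<theta> where "\<theta> i = of_nat i * (l * (- \<xi> * V ?ch (l * s)))" for i :: nat
  have lp: "loop s \<in> fst ?ch" using ch by (simp add: loop_def)
  have w0: "w s i \<noteq> 0" for i using V_nonzero[OF ch] by (simp add: w_def)
  have MC: "M ?ch s \<in> carrier_mat n n"
    using par ch(1) s lp unfolding parallel_section_def sl_mat_def by blast
  have FC: "form_along ?\<omega> ?ch loop s \<in> carrier_mat n n"
  proof -
    have "fst (\<beta> ?ch (loop s)) \<in> carrier_mat n n" "snd (\<beta> ?ch (loop s)) \<in> carrier_mat n n"
      using G ch lp by (auto simp: is_G_form_def sl_mat_def)
    moreover have "a_mat n \<in> carrier_mat n n" by (simp add: a_mat_eq)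
    ultimately show ?thesis
      by (auto simp: form_along_def form_add_def D_form_def form_diff_def chern_form_def higgs_form_def cartan_form_def
        cartan_fibre_def intro!: carrier_matI)
  qed
  have dM: "((\<lambda>r. M ?ch r $$ (i, j)) has_vector_derivative - (form_along ?\<omega> ?ch loop s * M ?ch s - M ?ch s * form_along ?\<omega> ?ch loop s) $$ (i, j)) (at s within {0..1})"
    using par ch(1) s lp ij unfolding parallel_section_def by blast
  have dw: "((\<lambda>r. w r i) has_vector_derivative \<theta> i * w s i) (at s within {0..1})" for i
  proof -
    have "((\<lambda>r. l * r) has_vector_derivative l) (at s)" by (auto intro!: derivative_eq_intros)
    from vector_diff_chain_at[OF this V_accel[OF ch]]
    have d: "((\<lambda>r. V ?ch (l * r)) has_vector_derivative l * (- \<xi> * (V ?ch (l * s))\<^sup>2)) (at s)"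
      by (simp add: o_def scaleR_conv_of_real \<xi>_def)
    have "((\<lambda>z. z ^ i) has_field_derivative of_nat i * V ?ch (l * s) ^ (i - 1)) (at (V ?ch (l * s)))"
      by (rule derivative_eq_intros refl | simp)+
    from field_vector_diff_chain_at[OF d this]
    have "((\<lambda>r. w r i) has_vector_derivative l * (- \<xi> * (V ?ch (l * s))\<^sup>2) * (of_nat i * V ?ch (l * s) ^ (i - 1))) (at s)"
      by (simp add: o_def w_def)
    moreover have "l * (- \<xi> * (V ?ch (l * s))\<^sup>2) * (of_nat i * V ?ch (l * s) ^ (i - 1)) = \<theta> i * w s i"
      by (cases i) (auto simp: \<theta>_def w_def power2_eq_square)
    ultimately show ?thesis by (simp add: has_vector_derivative_at_within)
  qed
  let ?M = "gauged_section n M s" and ?F = "weight_conj n (w s) (form_along ?\<omega> ?ch loop s) - diag_w n \<theta>"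
  have Ms: "weight_conj n (w s) (M ?ch s) = ?M"
  proof -
    have "w s = (\<lambda>i. V ?ch (l * s) ^ i)" by (rule ext) (simp add: w_def)
    then show ?thesis by (simp only: gauged_section_def)
  qed
  have d: "((\<lambda>r. M ?ch r $$ (i, j) * (w r i / w r j)) has_vector_derivative - (?F * ?M - ?M * ?F) $$ (i, j)) (at s within {0..1})"
    using weight_conj_transport[where F = "form_along ?\<omega> ?ch loop" and M = "M ?ch" and w = w, OF FC MC w0 dM dw ij] unfolding Ms .
  have op: "open {r. \<gamma> (l * r) \<in> fst ?ch}"
    using open_vimage[OF open_times[OF ch(1)], of "\<lambda>r. l * r"] by (simp add: vimage_def continuous_intros)
  \<comment> \<open>Near \<open>s\<close> the moving chart may be replaced by the fixed chart
    \<open>?ch\<close>, in which the derivative \<open>d\<close> was computed.\<close>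
  have eqM: "gauged_section n M r $$ (i, j) = M ?ch r $$ (i, j) * (w r i / w r j)" if "r \<in> {r. \<gamma> (l * r) \<in> fst ?ch} \<inter> {0..1}" for r
    using gauged_section_chart[OF par ch(1), of r] that ij by (simp add: weight_conj_entry w_def)
  obtain \<delta> where \<delta>: "\<delta> > 0" "ball s \<delta> \<subseteq> {r. \<gamma> (l * r) \<in> fst ?ch}"
  proof -
    have "s \<in> {r. \<gamma> (l * r) \<in> fst ?ch}" using ch(2) by simp
    from openE[OF op this] show ?thesis using that by blast
  qed
  have d': "((\<lambda>r. gauged_section n M r $$ (i, j)) has_vector_derivative - (?F * ?M - ?M * ?F) $$ (i, j)) (at s within {0..1})"
    unfolding has_vector_derivative_def
  proof (rule has_derivative_transform_within[OF d[unfolded has_vector_derivative_def] \<delta>(1) s])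
    fix r assume "r \<in> {0..1}" "dist r s < \<delta>"
    then have "r \<in> ball s \<delta>" "r \<in> {0..1}" by (simp_all add: dist_commute)
    then have "r \<in> {r. \<gamma> (l * r) \<in> fst ?ch} \<inter> {0..1}" using \<delta>(2) by blast
    then show "M ?ch r $$ (i, j) * (w r i / w r j) = gauged_section n M r $$ (i, j)" using eqM by simp
  qed
  \<comment> \<open>Diagonal entry \<open>i\<close> of \<open>a_mat\<close> is
    \<open>i - ((n + 1) / 2 - 1)\<close>; its constant part is all that survives the cancellation
    with \<open>\<theta>\<close>.\<close>
  define c where "c = l * \<xi> * V ?ch (l * s) * ((of_nat n + 1) / 2 - 1)"
  have TC: "Y_mat n - X_mat n + gauged_form n \<beta> (l * s) \<in> carrier_mat n n"
    by (auto simp: gauged_form_def intro!: add_carrier_mat)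
  have FCC: "F \<in> carrier_mat n n" using TC by (simp add: F)
  have Fe: "F $$ (a, b) = l * (Y_mat n - X_mat n + gauged_form n \<beta> (l * s)) $$ (a, b)" if "a < n" "b < n" for a b
    unfolding F using that carrier_matD[OF TC] by (intro index_smult_mat) auto
  have F': "?F $$ (a, b) = F $$ (a, b) + (if a = b then c else 0)" if ab: "a < n" "b < n" for a b
  proof -
    have "?F $$ (a, b) = weight_conj n (w s) (form_along ?\<omega> ?ch loop s) $$ (a, b) - diag_w n \<theta> $$ (a, b)"
      using ab by (intro index_minus_mat) (auto simp: diag_w_def)
    also have "weight_conj n (w s) (form_along ?\<omega> ?ch loop s) $$ (a, b)
      = F $$ (a, b) - l * V ?ch (l * s) * \<xi> * a_mat n $$ (a, b)"
      using weight_conj_form_along[OF G ch s ab] unfolding Fe[OF ab] w_def \<xi>_def[symmetric]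
      by (simp only: right_diff_distrib mult.assoc)
    finally show ?thesis
      using ab by (auto simp: diag_w_def a_mat_eq \<theta>_def c_def algebra_simps)
  qed
  have Fc: "?F \<in> carrier_mat n n" by (intro minus_carrier_mat) simp
  have Mc: "?M \<in> carrier_mat n n" by (simp add: gauged_section_def)
  have "(?F * ?M - ?M * ?F) $$ (i, j) = (\<Sum>k<n. ?F $$ (i, k) * ?M $$ (k, j)) - (\<Sum>k<n. ?M $$ (i, k) * ?F $$ (k, j))"
    by (rule commutator_entry[OF Fc Mc ij])
  also have "\<dots> = (\<Sum>k<n. F $$ (i, k) * ?M $$ (k, j) + (if k = i then c * ?M $$ (i, j) else 0))
      - (\<Sum>k<n. ?M $$ (i, k) * F $$ (k, j) + (if k = j then c * ?M $$ (i, j) else 0))"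
    using ij by (intro arg_cong2[where f = "(-)"] sum.cong refl) (auto simp: F' algebra_simps)
  also have "\<dots> = (\<Sum>k<n. F $$ (i, k) * ?M $$ (k, j)) - (\<Sum>k<n. ?M $$ (i, k) * F $$ (k, j))"
    using ij by (simp add: sum.distrib)
  also have "\<dots> = (F * ?M - ?M * F) $$ (i, j)" by (rule commutator_entry[OF FCC Mc ij, symmetric])
  finally show ?thesis using d' by simp
qed

end

section \<open>The holonomy along the geodesic\<close>

text \<open>Both parts come from \<open>uniform_first_order\<close>: integrated over the unit
  interval the error remains of lower order than \<open>t\<close>, and for \<open>r = 1\<close> the
  estimate gives the linear bound.\<close>

lemma integral_first_order:
  fixes B bd :: "real \<Rightarrow> real \<Rightarrow> complex"
  assumes e: "e > 0"
    and der: "\<And>t s. t \<in> {-e<..<e} \<Longrightarrow> s \<in> {0..1} \<Longrightarrow> ((\<lambda>t. B t s) has_vector_derivative bd t s) (at t)"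
    and cont: "continuous_on ({-e<..<e} \<times> {0..1}) (\<lambda>(t, s). bd t s)"
    and B0: "\<And>s. s \<in> {0..1} \<Longrightarrow> B 0 s = 0"
    and contB: "\<And>t. t \<in> {-e<..<e} \<Longrightarrow> continuous_on {0..1} (B t)"
  shows "((\<lambda>t. integral {0..1} (B t)) has_vector_derivative integral {0..1} (bd 0)) (at 0)"
    and "\<exists>K\<ge>0. eventually (\<lambda>t. \<forall>s\<in>{0..1}. cmod (B t s) \<le> K * \<bar>t\<bar>) (nhds 0)"
proof -
  have contbd: "continuous_on {0..1} (bd 0)"
  proof -
    have "continuous_on {0..1} (\<lambda>s::real. (0::real, s))" by (intro continuous_on_Pair continuous_on_const continuous_on_id)
    moreover have "(\<lambda>s::real. (0::real, s)) ` {0..1} \<subseteq> {-e<..<e} \<times> {0..1}" using e by auto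
    ultimately show ?thesis using continuous_on_compose2[OF cont] by fastforce
  qed
  have ev: "eventually (\<lambda>t. t \<in> {-e<..<e}) (nhds 0)" using e by (intro eventually_nhds_in_open) auto
  have u: "eventually (\<lambda>t. \<forall>s\<in>{0..1}. cmod (B t s - t *\<^sub>R bd 0 s) \<le> r * \<bar>t\<bar>) (nhds 0)" if "r > 0" for r
    by (rule uniform_first_order[OF e _ cont _ that]) (use der B0 in auto)
  have I0: "integral {0..1} (B 0) = 0"
    using B0 by (metis (no_types, lifting) integral_0 integral_cong)
  have "((\<lambda>y. norm (integral {0..1} (B y) - integral {0..1} (B 0) - (y - 0) *\<^sub>R integral {0..1} (bd 0)) / norm (y - 0)) \<longlongrightarrow> 0) (at 0)"
  proof (rule tendstoI)
    fix r :: real assume r: "r > 0"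
    have r2: "r / 2 > 0" using r by simp
    have "eventually (\<lambda>t. norm (integral {0..1} (B t) - t *\<^sub>R integral {0..1} (bd 0)) \<le> (r / 2) * \<bar>t\<bar>) (nhds 0)"
      using u[OF r2] ev
    proof eventually_elim
      case (elim t)
      have i: "(B t has_integral integral {0..1} (B t)) {0..1}" "(bd 0 has_integral integral {0..1} (bd 0)) {0..1}"
        using contB[of t] contbd elim by (auto intro!: integrable_integral integrable_continuous_interval)
      have "((\<lambda>s. B t s - t *\<^sub>R bd 0 s) has_integral integral {0..1} (B t) - t *\<^sub>R integral {0..1} (bd 0)) (cbox 0 1)"
        using has_integral_diff[OF i(1) has_integral_cmul[OF i(2), of t]] by simp
      then have "norm (integral {0..1} (B t) - t *\<^sub>R integral {0..1} (bd 0)) \<le> (r / 2 * \<bar>t\<bar>) * content (cbox 0 1 :: real set)"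
        by (rule has_integral_bound[rotated]) (use elim r in auto)
      then show ?case by simp
    qed
    then show "eventually (\<lambda>y. dist (norm (integral {0..1} (B y) - integral {0..1} (B 0) - (y - 0) *\<^sub>R integral {0..1} (bd 0)) / norm (y - 0)) 0 < r) (at 0)"
      unfolding eventually_at_filter
    proof (rule eventually_mono)
      fix t assume "norm (integral {0..1} (B t) - t *\<^sub>R integral {0..1} (bd 0)) \<le> (r / 2) * \<bar>t\<bar>"
      then have le: "norm (integral {0..1} (B t) - t *\<^sub>R integral {0..1} (bd 0)) / \<bar>t\<bar> \<le> r / 2" if "t \<noteq> 0"
        using that by (simp add: pos_divide_le_eq)
      have "norm (integral {0..1} (B t) - t *\<^sub>R integral {0..1} (bd 0)) / \<bar>t\<bar> < r" if "t \<noteq> 0"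
        using le[OF that] r by linarith
      then show "t \<noteq> 0 \<longrightarrow> t \<in> UNIV \<longrightarrow> dist (norm (integral {0..1} (B t) - integral {0..1} (B 0) - (t - 0) *\<^sub>R integral {0..1} (bd 0)) / norm (t - 0)) 0 < r"
        using r I0 by (auto simp: dist_real_def)
    qed
  qed
  then show "((\<lambda>t. integral {0..1} (B t)) has_vector_derivative integral {0..1} (bd 0)) (at 0)"
    unfolding has_vector_derivative_def has_derivative_iff_norm by (simp add: bounded_linear_scaleR_left)
  have "bounded (bd 0 ` {0..1})" by (intro compact_imp_bounded compact_continuous_image contbd compact_Icc)
  then obtain K where "\<forall>x\<in>bd 0 ` {0..1}. cmod x \<le> K" unfolding bounded_iff by blast
  then have K: "\<And>s. s \<in> {0..1} \<Longrightarrow> cmod (bd 0 s) \<le> K" by blast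
  have K0: "K \<ge> 0" using K[of 0] by (auto intro: order_trans[OF norm_ge_zero])
  have "eventually (\<lambda>t. \<forall>s\<in>{0..1}. cmod (B t s) \<le> (1 + K) * \<bar>t\<bar>) (nhds 0)"
    using u[of 1, simplified]
  proof (rule eventually_mono, intro ballI)
    fix t s assume h: "\<forall>\<tau>\<in>{0..1}. cmod (B t \<tau> - t *\<^sub>R bd 0 \<tau>) \<le> \<bar>t\<bar>" and s: "s \<in> {0..1::real}"
    have "cmod (B t s) \<le> cmod (t *\<^sub>R bd 0 s) + cmod (B t s - t *\<^sub>R bd 0 s)" by (rule norm_triangle_sub)
    also have "\<dots> \<le> \<bar>t\<bar> * K + 1 * \<bar>t\<bar>"
      using h s K[OF s] by (intro add_mono) (auto intro: mult_left_mono)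
    finally show "cmod (B t s) \<le> (1 + K) * \<bar>t\<bar>" by (simp add: algebra_simps)
  qed
  then show "\<exists>K\<ge>0. eventually (\<lambda>t. \<forall>s\<in>{0..1}. cmod (B t s) \<le> K * \<bar>t\<bar>) (nhds 0)"
    using K0 by (intro exI[of _ "1 + K"]) auto
qed

section \<open>Entry formulas for sums, triple products and traces\<close>

lemma minus_entry:
  assumes "A \<in> carrier_mat n n" "B \<in> carrier_mat n n" "i < n" "j < n"
  shows "(A - B) $$ (i, j) = A $$ (i, j) - B $$ (i, j)"
  using assms by simp

lemma add_entry:
  assumes "A \<in> carrier_mat n n" "B \<in> carrier_mat n n" "i < n" "j < n"
  shows "(A + B) $$ (i, j) = A $$ (i, j) + B $$ (i, j)"
  using assms by simp

lemma smult_entry: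
  assumes "A \<in> carrier_mat n n" "i < n" "j < n"
  shows "(k \<cdot>\<^sub>m A) $$ (i, j) = k * A $$ (i, j)"
  using assms by simp

lemma triple_entry:
  assumes "A \<in> carrier_mat n n" "M \<in> carrier_mat n n" "B \<in> carrier_mat n n" "i < n" "j < n"
  shows "(A * M * B) $$ (i, j) = (\<Sum>a<n. \<Sum>c<n. A $$ (i, a) * M $$ (a, c) * B $$ (c, j) :: complex)"
proof -
  have "(A * M * B) $$ (i, j) = (\<Sum>c<n. (A * M) $$ (i, c) * B $$ (c, j))"
    using assms by (intro mult_mat_entry) auto
  also have "\<dots> = (\<Sum>c<n. \<Sum>a<n. A $$ (i, a) * M $$ (a, c) * B $$ (c, j))"
  proof (rule sum.cong[OF refl])
    fix c assume c: "c \<in> {..<n}"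
    have "(A * M) $$ (i, c) = (\<Sum>a<n. A $$ (i, a) * M $$ (a, c))"
      using c by (intro mult_mat_entry assms) auto
    then show "(A * M) $$ (i, c) * B $$ (c, j) = (\<Sum>a<n. A $$ (i, a) * M $$ (a, c) * B $$ (c, j))"
      by (simp only: sum_distrib_right)
  qed
  finally show ?thesis by (subst sum.swap)
qed

lemma cancel_left:
  assumes "A * B = 1\<^sub>m n" "A \<in> carrier_mat n n" "B \<in> carrier_mat n n" "X \<in> carrier_mat n n"
  shows "A * (B * X) = (X :: complex mat)"
proof -
  have "A * (B * X) = (A * B) * X" using assoc_mult_mat[OF assms(2-4)] by simp
  then show ?thesis using assms by simp
qed

lemmas assoc_square = assoc_mult_mat[of _ n n _ n _ n for n]

lemma trace_conj:
  assumes "P \<in> carrier_mat n n" "P' \<in> carrier_mat n n" "P * P' = 1\<^sub>m n"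
  shows "(\<Sum>i<n. \<Sum>a<n. \<Sum>c<n. P' $$ (i, a) * x a c * P $$ (c, i)) = (\<Sum>a<n. x a a :: complex)"
proof -
  have "(\<Sum>i<n. \<Sum>a<n. \<Sum>c<n. P' $$ (i, a) * x a c * P $$ (c, i)) = (\<Sum>a<n. \<Sum>i<n. \<Sum>c<n. P' $$ (i, a) * x a c * P $$ (c, i))"
    by (rule sum.swap)
  also have "\<dots> = (\<Sum>a<n. \<Sum>c<n. \<Sum>i<n. P' $$ (i, a) * x a c * P $$ (c, i))"
    by (intro sum.cong refl sum.swap)
  also have "\<dots> = (\<Sum>a<n. \<Sum>c<n. x a c * (P * P') $$ (c, a))"
  proof (intro sum.cong refl)
    fix a c assume "a \<in> {..<n}" "c \<in> {..<n}"
    then have "(P * P') $$ (c, a) = (\<Sum>i<n. P $$ (c, i) * P' $$ (i, a))"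
      by (intro mult_mat_entry assms) auto
    then show "(\<Sum>i<n. P' $$ (i, a) * x a c * P $$ (c, i)) = x a c * (P * P') $$ (c, a)"
      by (simp only: sum_distrib_left mult_ac)
  qed
  also have "\<dots> = (\<Sum>a<n. \<Sum>c<n. if c = a then x a a else 0)"
    unfolding assms(3) by (intro sum.cong refl) auto
  finally show ?thesis by simp
qed

context closed_geodesic
begin

abbreviation "wexp n s i \<equiv> complex_of_real (exp (l * T_eig n i * s))"

text \<open>The connection in the interaction picture: it is written in the eigenbasis of
  \<open>T\<close> and conjugated by the flow of \<open>T\<close>, so that only the perturbation
  \<open>\<beta>\<close> is left.\<close>

definition frame_form :: "nat \<Rightarrow> 'a G_form \<Rightarrow> real \<Rightarrow> complex mat" where
  "frame_form n \<beta> s = weight_conj n (wexp n s) (complex_of_real l \<cdot>\<^sub>m (kraw_inv_mat n * gauged_form n \<beta> (l * s) * kraw_mat n))"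

definition frame_section :: "nat \<Rightarrow> ('a chart \<Rightarrow> real \<Rightarrow> complex mat) \<Rightarrow> real \<Rightarrow> complex mat" where
  "frame_section n M s = weight_conj n (wexp n s) (kraw_inv_mat n * gauged_section n M s * kraw_mat n)"

text \<open>The passage to the eigenbasis is constant in \<open>s\<close> and only conjugates. The
  weights \<open>wexp\<close> have logarithmic derivatives \<open>l * T_eig n i\<close>, which
  subtract exactly the diagonalised \<open>l T\<close>.\<close>

lemma frame_transport:
  assumes par: "parallel_section n A (form_add (D_form n h) \<beta>) loop M" and G: "is_G_form n A \<beta>"
    and s: "s \<in> {0..1}" and ij: "i < n" "j < n"
  shows "((\<lambda>r. frame_section n M r $$ (i, j)) has_vector_derivative
     - (frame_form n \<beta> s * frame_section n M s - frame_section n M s * frame_form n \<beta> s) $$ (i, j)) (at s within {0..1})"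
proof -
  let ?S = "kraw_mat n" and ?S' = "kraw_inv_mat n" and ?T = "Y_mat n - X_mat n" and ?b = "gauged_form n \<beta> (l * s)"
  define F where "F = complex_of_real l \<cdot>\<^sub>m (?T + ?b)"
  define gs where "gs r = gauged_section n M r" for r
  have bc: "?b \<in> carrier_mat n n" by (simp add: gauged_form_def)
  have Tc: "?T \<in> carrier_mat n n" by (intro minus_carrier_mat) simp
  have Fc: "F \<in> carrier_mat n n" unfolding F_def using bc by simp
  have gc: "gs r \<in> carrier_mat n n" for r by (simp add: gs_def gauged_section_def)
  have FgC: "F * gs s - gs s * F \<in> carrier_mat n n" using Fc gc by (intro minus_carrier_mat) simp
  have dW: "((\<lambda>r. (?S' * gs r * ?S) $$ (i, j)) has_vector_derivative
      - ((?S' * F * ?S) * (?S' * gs s * ?S) - (?S' * gs s * ?S) * (?S' * F * ?S)) $$ (i, j)) (at s within {0..1})"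
  proof -
    have d: "((\<lambda>r. \<Sum>a<n. \<Sum>c<n. ?S' $$ (i, a) * gs r $$ (a, c) * ?S $$ (c, j)) has_vector_derivative
       (\<Sum>a<n. \<Sum>c<n. ?S' $$ (i, a) * (- (F * gs s - gs s * F) $$ (a, c)) * ?S $$ (c, j))) (at s within {0..1})"
      unfolding gs_def
      by (intro has_vector_derivative_sum has_vector_derivative_mult_right has_vector_derivative_mult_left
          gauged_transport[OF par G s _ _ F_def]) auto
    have "(?S' * F * ?S) * (?S' * gs s * ?S) = ?S' * (F * gs s) * ?S"
      using Fc gc[of s] by (simp add: assoc_square[where n = n] cancel_left[OF kraw_mult_inv])
    moreover have "(?S' * gs s * ?S) * (?S' * F * ?S) = ?S' * (gs s * F) * ?S"
      using Fc gc[of s] by (simp add: assoc_square[where n = n] cancel_left[OF kraw_mult_inv])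
    moreover have "(?S' * (F * gs s) * ?S - ?S' * (gs s * F) * ?S) $$ (i, j) = (?S' * (F * gs s) * ?S) $$ (i, j) - (?S' * (gs s * F) * ?S) $$ (i, j)"
      using Fc gc ij by (intro minus_entry) auto
    moreover have "(?S' * (F * gs s) * ?S) $$ (i, j) - (?S' * (gs s * F) * ?S) $$ (i, j)
      = (\<Sum>a<n. \<Sum>c<n. ?S' $$ (i, a) * (F * gs s - gs s * F) $$ (a, c) * ?S $$ (c, j))"
    proof -
      have "(F * gs s - gs s * F) $$ (a, c) = (F * gs s) $$ (a, c) - (gs s * F) $$ (a, c)" if "a < n" "c < n" for a c
        using Fc gc that by (intro minus_entry) auto
      then show ?thesis
        using Fc gc ij by (simp add: triple_entry[where n = n] sum_subtractf right_diff_distrib left_diff_distrib del: index_mult_mat)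
    qed
    ultimately show ?thesis
      using d Fc gc ij by (simp add: triple_entry[where n = n] sum_negf del: index_mult_mat)
  qed
  have w0: "wexp n s i \<noteq> 0" for i by simp
  have dw: "((\<lambda>r. wexp n r i) has_vector_derivative complex_of_real (l * T_eig n i) * wexp n s i) (at s within {0..1})" for i
  proof -
    have "((\<lambda>r. exp (l * T_eig n i * r)) has_real_derivative (l * T_eig n i) * exp (l * T_eig n i * s)) (at s within {0..1})"
      by (rule derivative_eq_intros refl | simp)+
    from has_vector_derivative_of_real[OF this] show ?thesis by simp
  qed
  have SFS: "?S' * F * ?S \<in> carrier_mat n n" "?S' * gs s * ?S \<in> carrier_mat n n" using Fc gc by simp_all
  have "weight_conj n (wexp n s) (?S' * F * ?S) - diag_w n (\<lambda>i. complex_of_real (l * T_eig n i)) = frame_form n \<beta> s"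
  proof (rule eq_matI)
    fix a c assume "a < dim_row (frame_form n \<beta> s)" "c < dim_col (frame_form n \<beta> s)"
    then have ac: "a < n" "c < n" by (auto simp: frame_form_def weight_conj_def)
    have "?S' * F * ?S = complex_of_real l \<cdot>\<^sub>m (?S' * (?T * ?S) + ?S' * ?b * ?S)"
      unfolding F_def using bc Tc
      by (simp add: mult_smult_distrib[of _ n n _ n] mult_smult_assoc_mat[of _ n n _ n] mult_add_distrib_mat[of _ n n _ n]
          add_mult_distrib_mat[of _ n n _ _ n] assoc_square[where n = n])
    then have "(?S' * F * ?S) $$ (a, c) = l * ((?S' * (?T * ?S)) $$ (a, c) + (?S' * ?b * ?S) $$ (a, c))"
      using ac bc Tc by (simp add: smult_entry[of _ n] add_entry[of _ n] del: index_mult_mat(1) index_smult_mat(1) index_add_mat(1))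
    also have "(?S' * (?T * ?S)) $$ (a, c) = (if a = c then complex_of_real (T_eig n c) else 0)"
      by (rule kraw_inv_T_kraw[OF ac])
    finally have e: "(?S' * F * ?S) $$ (a, c) = l * ((if a = c then complex_of_real (T_eig n c) else 0) + (?S' * ?b * ?S) $$ (a, c))" .
    have "(weight_conj n (wexp n s) (?S' * F * ?S) - diag_w n (\<lambda>i. complex_of_real (l * T_eig n i))) $$ (a, c)
       = weight_conj n (wexp n s) (?S' * F * ?S) $$ (a, c) - diag_w n (\<lambda>i. complex_of_real (l * T_eig n i)) $$ (a, c)"
      using ac by (intro index_minus_mat) (auto simp: diag_w_def)
    also have "\<dots> = frame_form n \<beta> s $$ (a, c)"
      using ac bc by (simp add: weight_conj_entry e frame_form_def diag_w_def smult_entry[of _ n] algebra_simps del: index_mult_mat(1) index_smult_mat(1))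
    finally show "(weight_conj n (wexp n s) (?S' * F * ?S) - diag_w n (\<lambda>i. complex_of_real (l * T_eig n i))) $$ (a, c) = frame_form n \<beta> s $$ (a, c)" .
  qed (auto simp: frame_form_def weight_conj_def diag_w_def)
  moreover note weight_conj_transport[where F = "\<lambda>_. ?S' * F * ?S" and M = "\<lambda>r. ?S' * gs r * ?S" and w = "wexp n" and s = s and n = n
      and i = i and j = j and \<theta> = "\<lambda>i. complex_of_real (l * T_eig n i)" and T = "{0..1}", OF SFS w0 dW dw ij]
  ultimately have "((\<lambda>r. (?S' * gs r * ?S) $$ (i, j) * (wexp n r i / wexp n r j)) has_vector_derivative
     - (frame_form n \<beta> s * frame_section n M s - frame_section n M s * frame_form n \<beta> s) $$ (i, j)) (at s within {0..1})"
    by (simp only: gs_def frame_section_def)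
  then show ?thesis
    using ij by (simp add: frame_section_def weight_conj_entry gs_def del: index_mult_mat(1))
qed

text \<open>\<open>H\<close> collects the passage to the eigenbasis, the gauge at the base point and
  \<open>g'\<close>, and \<open>D'\<close> undoes the undeformed transport
  \<open>exp(- l T)\<close>. In these terms the monodromy relation between the two ends of a
  parallel section says that the end of the frame section is the conjugate of its beginning by
  \<open>D' * (H * B * H')\<close>, where \<open>B\<close> is the holonomy;
  \<open>small_transport_estimate\<close> controls that end.\<close>

lemma holonomy_conjugation:
  assumes G: "is_G_form n A \<beta>" and n: "n \<ge> 2"
    and mono: "is_monodromy n A (\<gamma> 0) (form_add (D_form n h) \<beta>) R" and R: "R loop \<in> carrier_mat n n"
    and cont: "\<And>i j. i < n \<Longrightarrow> j < n \<Longrightarrow> continuous_on {0..1} (\<lambda>s. frame_form n \<beta> s $$ (i, j))"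
    and eps: "\<And>s i j. s \<in> {0..1} \<Longrightarrow> i < n \<Longrightarrow> j < n \<Longrightarrow> cmod (frame_form n \<beta> s $$ (i, j)) \<le> \<epsilon>"
    and small: "4 * real n * \<epsilon> \<le> 1"
    and \<Gamma>: "\<Gamma> = mat n n (\<lambda>(i, j). integral {0..1} (\<lambda>s. frame_form n \<beta> s $$ (i, j)))"
    and D': "D' = diag_w n (wexp n 1)"
  shows "\<exists>H\<in>carrier_mat n n. \<exists>H'\<in>carrier_mat n n. H * H' = 1\<^sub>m n \<and> H' * H = 1\<^sub>m n \<and>
    conj_near_ad n \<Gamma> (D' * (H * map_mat complex_of_real (R loop) * H')) (8 * (real n)\<^sup>2 * \<epsilon>\<^sup>2)"
proof -
  let ?S = "kraw_mat n" and ?S' = "kraw_inv_mat n" and ?B = "map_mat complex_of_real (R loop)"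
  obtain ch g g' where ch: "ch \<in> A" "\<gamma> 0 \<in> fst ch" and g: "g \<in> carrier_mat n n" "g' \<in> carrier_mat n n"
    and inv: "inverts_mat g g'" "inverts_mat g' g"
    and tr: "\<And>c M0. based_loop (\<gamma> 0) c \<Longrightarrow> C1_path A c \<Longrightarrow> M0 \<in> sl_mat n \<Longrightarrow>
       \<exists>M. parallel_section n A (form_add (D_form n h) \<beta>) c M \<and> M ch 0 = M0 \<and>
              (g * M ch 1 * g') * map_mat complex_of_real (R c) = map_mat complex_of_real (R c) * (g * M0 * g')"
    using mono unfolding is_monodromy_def by blast
  have gg: "g * g' = 1\<^sub>m n" "g' * g = 1\<^sub>m n" using inv g by (auto simp: inverts_mat_def)
  define v where "v i = V ch 0 ^ i" for i
  have v0: "v i \<noteq> 0" for i using V_nonzero[OF ch] by (simp add: v_def)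
  define Vd where "Vd = diag_w n v"
  define Vd' where "Vd' = diag_w n (\<lambda>i. 1 / v i)"
  define D where "D = diag_w n (\<lambda>i. 1 / wexp n 1 i)"
  have VV: "Vd * Vd' = 1\<^sub>m n" "Vd' * Vd = 1\<^sub>m n" unfolding Vd_def Vd'_def using diag_w_inverse[of v] v0 by auto
  have DD: "D * D' = 1\<^sub>m n" unfolding D_def D' using diag_w_inverse(2)[of "wexp n 1"] by simp
  have Bc: "?B \<in> carrier_mat n n" using R by simp
  have carr: "Vd \<in> carrier_mat n n" "Vd' \<in> carrier_mat n n" "D \<in> carrier_mat n n" "D' \<in> carrier_mat n n"
    by (simp_all add: Vd_def Vd'_def D_def D')
  define H where "H = ?S' * Vd * g'"
  define H' where "H' = g * Vd' * ?S"
  have Hc: "H \<in> carrier_mat n n" "H' \<in> carrier_mat n n" using carr g by (simp_all add: H_def H'_def)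
  note as = assoc_square[where n = n]
  note canc = cancel_left[OF kraw_mult_inv] cancel_left[OF kraw_inv_mult] cancel_left[OF VV(1)] cancel_left[OF VV(2)]
    cancel_left[OF DD] cancel_left[OF gg(1)] cancel_left[OF gg(2)]
  have HH: "H * H' = 1\<^sub>m n" "H' * H = 1\<^sub>m n"
    using carr g by (simp_all add: H_def H'_def as canc kraw_inv_mult gg)
  have "\<exists>M\<in>carrier_mat n n. M * (D' * (H * ?B * H')) = D' * (H * ?B * H') * unit_mat n i j \<and>
        (\<forall>a<n. \<forall>b<n. cmod (M $$ (a, b) - unit_mat n i j $$ (a, b) +
            (\<Gamma> * unit_mat n i j - unit_mat n i j * \<Gamma>) $$ (a, b)) \<le> 8 * (real n)\<^sup>2 * \<epsilon>\<^sup>2)"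
    if ij: "i < n" "j < n" "i \<noteq> j" for i j
  proof -
    let ?U = "unit_mat n i j"
    \<comment> \<open>The initial value whose frame section starts at the elementary matrix
      \<open>?U\<close>. Its trace is that of \<open>?U\<close>, which vanishes because
      \<open>i \<noteq> j\<close>, so \<open>M0\<close> is admissible in
      \<open>is_monodromy\<close>.\<close>
    define M0 where "M0 = Vd' * (?S * ?U * ?S') * Vd"
    have SUS: "?S * ?U * ?S' \<in> carrier_mat n n" by simp
    have M0c: "M0 \<in> carrier_mat n n" using carr SUS by (simp add: M0_def)
    have M0g: "M0 = weight_conj n (\<lambda>i. 1 / v i) (?S * ?U * ?S')"
      unfolding weight_conj_eq_diag_w[OF SUS] M0_def Vd_def Vd'_def by simp
    have "(\<Sum>a<n. M0 $$ (a, a)) = 0"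
    proof -
      have "(\<Sum>a<n. M0 $$ (a, a)) = (\<Sum>a<n. (?S * ?U * ?S') $$ (a, a))"
        using v0 unfolding M0g by (intro sum.cong) (auto simp: weight_conj_entry simp del: index_mult_mat)
      also have "\<dots> = (\<Sum>a<n. \<Sum>b<n. \<Sum>c<n. ?S $$ (a, b) * ?U $$ (b, c) * ?S' $$ (c, a))"
        by (intro sum.cong) (auto simp: triple_entry simp del: index_mult_mat)
      also have "\<dots> = (\<Sum>b<n. ?U $$ (b, b))"
        by (rule trace_conj) (auto simp: kraw_inv_mult)
      also have "\<dots> = 0" using ij by (intro sum.neutral) (auto simp: unit_mat_def)
      finally show ?thesis .
    qed
    then have "M0 \<in> sl_mat n" using M0c by (simp add: sl_mat_def)
    then obtain M where par: "parallel_section n A (form_add (D_form n h) \<beta>) loop M" and M0: "M ch 0 = M0"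
      and rel: "(g * M ch 1 * g') * ?B = ?B * (g * M0 * g')"
      using tr[OF loop_based loop_C1] by blast
    have lp: "loop 0 = \<gamma> 0" "loop 1 = \<gamma> 0" using periodic[of 0] by (simp_all add: loop_def)
    have M1c: "M ch 1 \<in> carrier_mat n n"
    proof -
      have "loop 1 \<in> fst ch" using ch lp by simp
      then have "M ch 1 \<in> sl_mat n"
        using par[unfolded parallel_section_def, THEN conjunct1, THEN bspec, OF ch(1), THEN bspec, of 1] by simp
      then show ?thesis by (simp add: sl_mat_def)
    qed
    have gs0: "gauged_section n M 0 = ?S * ?U * ?S'"
    proof -
      have "gauged_section n M 0 = weight_conj n v M0"
        using gauged_section_chart[OF par ch(1), of 0] ch M0 by (simp add: v_def[abs_def])
      then show ?thesis unfolding M0g using weight_conj_inverse[OF v0 SUS] by simp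
    qed
    have gs1: "gauged_section n M 1 = Vd * M ch 1 * Vd'"
    proof -
      have "V ch l = V ch 0" using V_periodic[OF ch] by simp
      moreover have "\<gamma> l = \<gamma> 0" using periodic[of 0] by simp
      ultimately have "gauged_section n M 1 = weight_conj n v (M ch 1)"
        using gauged_section_chart[OF par ch(1), of 1] ch by (simp add: v_def[abs_def])
      then show ?thesis unfolding weight_conj_eq_diag_w[OF M1c] Vd_def Vd'_def .
    qed
    define W where "W = frame_section n M 1"
    have fs0: "frame_section n M 0 = ?U"
    proof -
      have "?S' * (?S * ?U * ?S') * ?S = ?U" by (simp add: as canc kraw_inv_mult right_mult_one_mat[of _ n n])
      then show ?thesis unfolding frame_section_def gs0
        by (intro eq_matI) (auto simp: weight_conj_def unit_mat_def)
    qed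
    have fs1: "W = D' * (?S' * (Vd * M ch 1 * Vd') * ?S) * D"
    proof -
      have c: "?S' * (Vd * M ch 1 * Vd') * ?S \<in> carrier_mat n n" using carr M1c by simp
      show ?thesis unfolding W_def frame_section_def gs1 D' D_def by (rule weight_conj_eq_diag_w[OF c])
    qed
    have Wc: "W \<in> carrier_mat n n" by (simp add: W_def frame_section_def)
    \<comment> \<open>The monodromy relation with \<open>g\<close> and \<open>g'\<close> cancelled
      and an arbitrary right factor, the shape in which it rewrites inside right-nested
      products.\<close>
    have rel': "M ch 1 * (g' * (?B * (g * Y))) = g' * (?B * (g * (M0 * Y)))" if Y: "Y \<in> carrier_mat n n" for Y
    proof -
      have "g' * (((g * M ch 1 * g') * ?B) * (g * Y)) = g' * ((?B * (g * M0 * g')) * (g * Y))" unfolding rel ..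
      then show ?thesis using g M1c Bc Y M0c by (simp add: as canc)
    qed
    have "W * (D' * (H * ?B * H')) = D' * (H * ?B * H') * ?U"
    proof -
      have "W * (D' * (H * ?B * H')) = D' * (?S' * (Vd * (M ch 1 * (g' * (?B * (g * (Vd' * ?S)))))))"
        unfolding fs1 H_def H'_def using carr g Bc M1c by (simp add: as canc)
      also have "M ch 1 * (g' * (?B * (g * (Vd' * ?S)))) = g' * (?B * (g * (M0 * (Vd' * ?S))))"
        using carr by (intro rel') simp
      also have "M0 * (Vd' * ?S) = Vd' * (?S * ?U)"
        unfolding M0_def using carr by (simp add: as canc kraw_inv_mult right_mult_one_mat[of _ n n])
      also have "D' * (?S' * (Vd * (g' * (?B * (g * (Vd' * (?S * ?U))))))) = D' * (H * ?B * H') * ?U"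
        unfolding H_def H'_def using carr g Bc by (simp add: as)
      finally show ?thesis .
    qed
    moreover have "cmod (W $$ (a, b) - ?U $$ (a, b) + (\<Gamma> * ?U - ?U * \<Gamma>) $$ (a, b)) \<le> 8 * (real n)\<^sup>2 * \<epsilon>\<^sup>2"
      if ab: "a < n" "b < n" for a b
      unfolding W_def fs0[symmetric]
    proof (rule small_transport_estimate[OF _ _ cont _ eps small _ _ \<Gamma> ab])
      show "frame_form n \<beta> s \<in> carrier_mat n n" "frame_section n M s \<in> carrier_mat n n" for s
        by (simp_all add: frame_form_def frame_section_def)
      show "((\<lambda>s. frame_section n M s $$ (i, j)) has_vector_derivative
            - (frame_form n \<beta> s * frame_section n M s - frame_section n M s * frame_form n \<beta> s) $$ (i, j)) (at s within {0..1})"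
        if "s \<in> {0..1}" "i < n" "j < n" for s i j by (rule frame_transport[OF par G that])
      show "cmod (frame_section n M 0 $$ (i, j)) \<le> 1" if "i < n" "j < n" for i j
        unfolding fs0 using that by (simp add: unit_mat_def)
    qed (use n in auto)
    ultimately show ?thesis using Wc by blast
  qed
  then have "conj_near_ad n \<Gamma> (D' * (H * ?B * H')) (8 * (real n)\<^sup>2 * \<epsilon>\<^sup>2)"
    unfolding conj_near_ad_def by blast
  then show ?thesis using Hc HH by blast
qed


lemma frame_form_entry:
  assumes "i < n" "j < n"
  shows "frame_form n \<beta> s $$ (i, j) =
    (\<Sum>a<n. \<Sum>c<n. kraw_inv_mat n $$ (i, a) * along \<beta> (cht (l * s)) (l * s) a c * kraw_mat n $$ (c, j)) * (l * (wexp n s i / wexp n s j))"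
proof -
  have b: "gauged_form n \<beta> (l * s) \<in> carrier_mat n n" by (simp add: gauged_form_def)
  have e: "(\<Sum>a<n. \<Sum>c<n. kraw_inv_mat n $$ (i, a) * gauged_form n \<beta> (l * s) $$ (a, c) * kraw_mat n $$ (c, j))
     = (\<Sum>a<n. \<Sum>c<n. kraw_inv_mat n $$ (i, a) * along \<beta> (cht (l * s)) (l * s) a c * kraw_mat n $$ (c, j))"
    by (intro sum.cong refl) (auto simp: gauged_form_def)
  have "frame_form n \<beta> s $$ (i, j) = complex_of_real l * (kraw_inv_mat n * gauged_form n \<beta> (l * s) * kraw_mat n) $$ (i, j) * (wexp n s i / wexp n s j)"
    unfolding frame_form_def weight_conj_entry[OF assms] using assms b by (subst smult_entry[of _ n]) auto
  then show ?thesis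
    unfolding triple_entry[OF kraw_mat_carrier(2) b kraw_mat_carrier(1) assms] e by (simp only: mult_ac)
qed

theorem ln_largest_eigenvalue_derivative:
  assumes n: "n \<ge> 2" and k: "2 \<le> k" "k \<le> n"
    and tangent: "tangent_path n A h (\<gamma> 0) (psi0 n k h q) \<delta>"
  shows "((\<lambda>t. ln (largest_eigenvalue (\<delta> t loop))) has_real_derivative
           (-1) ^ k * fact (n - 1) / (2 ^ (k - 2) * fact (n - k)) *
           integral {0..l} (\<lambda>t. Re (differential_along A k q \<gamma> t))) (at 0)"
proof -
  let ?S = "kraw_mat n" and ?S' = "kraw_inv_mat n"
  from tangent[unfolded tangent_path_def] show ?thesis
  proof (elim exE conjE, goal_cases)
    case (1 e \<beta>)
    note e = 1(1) and raw = 1(2-)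
    note sm = raw(1)[rule_format] and b0 = raw(2)[rule_format, THEN conjunct1]
      and b1 = raw(2)[rule_format, THEN conjunct2, rule_format] and t = raw(3)[rule_format]
    have ev_e: "eventually (\<lambda>t. t \<in> {-e<..<e}) (nhds 0)" using e by (intro eventually_nhds_in_open) auto
    have G: "is_G_form n A (\<beta> t)" if "t \<in> {-e<..<e}" for t using t[OF that] by blast
    have R: "\<delta> t loop \<in> carrier_mat n n \<and> det (\<delta> t loop) = 1" if te: "t \<in> {-e<..<e}" for t
    proof -
      from t[OF te] have "hitchin_rep n (\<gamma> 0) (\<delta> t)" by blast
      then obtain Rs where "\<forall>s\<in>{0..1::real}. psl_rep n (\<gamma> 0) (Rs s)" "Rs 1 = \<delta> t"
        unfolding hitchin_rep_def by blast
      then have "psl_rep n (\<gamma> 0) (\<delta> t)" by (metis atLeastAtMost_iff order_refl zero_le_one)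
      then show ?thesis using loop_based unfolding psl_rep_def by blast
    qed
    have "\<forall>i\<in>{..<n}. \<forall>j\<in>{..<n}. \<exists>bd. (\<forall>t\<in>{-e<..<e}. \<forall>\<tau>. ((\<lambda>t. along (\<beta> t) (cht \<tau>) \<tau> i j) has_vector_derivative bd t \<tau>) (at t)) \<and>
       continuous_on ({-e<..<e} \<times> UNIV) (\<lambda>(t, \<tau>). bd t \<tau>) \<and>
       (\<forall>t\<in>{-e<..<e}. continuous_on UNIV (\<lambda>\<tau>. along (\<beta> t) (cht \<tau>) \<tau> i j))"
      using along_family[OF sm G] by auto
    then obtain bd where bd': "\<forall>i\<in>{..<n}. \<forall>j\<in>{..<n}. (\<forall>t\<in>{-e<..<e}. \<forall>\<tau>. ((\<lambda>t. along (\<beta> t) (cht \<tau>) \<tau> i j) has_vector_derivative bd i j t \<tau>) (at t)) \<and>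
       continuous_on ({-e<..<e} \<times> UNIV) (\<lambda>(t, \<tau>). bd i j t \<tau>) \<and>
       (\<forall>t\<in>{-e<..<e}. continuous_on UNIV (\<lambda>\<tau>. along (\<beta> t) (cht \<tau>) \<tau> i j))"
      unfolding bchoice_iff by blast
    have bd: "((\<lambda>t. along (\<beta> t) (cht \<tau>) \<tau> i j) has_vector_derivative bd i j t \<tau>) (at t)"
      if "i < n" "j < n" "t \<in> {-e<..<e}" for i j t \<tau> using bd' that by blast
    have bdc: "continuous_on ({-e<..<e} \<times> UNIV) (\<lambda>(t, \<tau>). bd i j t \<tau>)" if "i < n" "j < n" for i j
      using bd' that by blast
    have bc: "continuous_on UNIV (\<lambda>\<tau>. along (\<beta> t) (cht \<tau>) \<tau> i j)" if "i < n" "j < n" "t \<in> {-e<..<e}" for i j t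
      using bd' that by blast
    define Q where "Q = differential_along A k q \<gamma>"
    \<comment> \<open>\<open>tangent_path\<close> gives the derivative at \<open>0\<close> in terms
      of \<open>psi0\<close>, \<open>along_family\<close> gives one that is jointly continuous;
      uniqueness of derivatives identifies them.\<close>
    have bd0: "bd i j 0 \<tau> = Q \<tau> * E0_mat n (k - 1) $$ (i, j) + cnj (Q \<tau>) * cnj (E0_mat n (k - 1) $$ (j, i))"
      if ij: "i < n" "j < n" for i j \<tau>
    proof -
      have "((\<lambda>t. along (\<beta> t) (cht \<tau>) \<tau> i j) has_vector_derivative along (psi0 n k h q) (cht \<tau>) \<tau> i j) (at 0)"
        unfolding along_def[of "psi0 n k h q"] by (rule along_has_derivative) (use b1[OF cht ij] in auto)
      moreover have "((\<lambda>t. along (\<beta> t) (cht \<tau>) \<tau> i j) has_vector_derivative bd i j 0 \<tau>) (at 0)"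
        using bd[OF ij] e by simp
      ultimately have "bd i j 0 \<tau> = along (psi0 n k h q) (cht \<tau>) \<tau> i j" by (rule vector_derivative_unique_at[rotated])
      then show ?thesis using along_psi0[OF ij k(1)] by (simp add: Q_def)
    qed
    define gd where "gd i j t s = (\<Sum>a<n. \<Sum>c<n. ?S' $$ (i, a) * bd a c t (l * s) * ?S $$ (c, j)) * (l * (wexp n s i / wexp n s j))"
      for i j t s
    have gder: "((\<lambda>t. frame_form n (\<beta> t) s $$ (i, j)) has_vector_derivative gd i j t s) (at t)"
      if "i < n" "j < n" "t \<in> {-e<..<e}" for i j t s
      unfolding frame_form_entry[OF that(1,2)] gd_def
      by (intro has_vector_derivative_mult_left has_vector_derivative_sum has_vector_derivative_mult_right bd that(3)) auto
    have gcont: "continuous_on ({-e<..<e} \<times> {0..1}) (\<lambda>(t, s). gd i j t s)" if "i < n" "j < n" for i j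
    proof -
      have c: "continuous_on ({-e<..<e} \<times> {0..1}) (\<lambda>p. bd a c (fst p) (l * snd p))" if "a < n" "c < n" for a c
      proof -
        have "continuous_on ({-e<..<e} \<times> {0..1::real}) (\<lambda>p. (fst p, l * snd p))" by (intro continuous_intros)
        moreover have "(\<lambda>p. (fst p, l * snd p)) ` ({-e<..<e} \<times> {0..1::real}) \<subseteq> {-e<..<e} \<times> UNIV" by auto
        ultimately show ?thesis using continuous_on_compose2[OF bdc[OF that]] by fastforce
      qed
      show ?thesis
        unfolding gd_def case_prod_beta
        by (intro continuous_intros c) auto
    qed
    have g0: "frame_form n (\<beta> 0) s $$ (i, j) = 0" if ij: "i < n" "j < n" for i j s
      unfolding frame_form_entry[OF ij]
      by (simp add: along_def b0[OF cht])
    have gcs: "continuous_on {0..1} (\<lambda>s. frame_form n (\<beta> t) s $$ (i, j))" if ij: "i < n" "j < n" and te: "t \<in> {-e<..<e}" for i j t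
    proof -
      have c: "continuous_on {0..1} (\<lambda>s. along (\<beta> t) (cht (l * s)) (l * s) a c)" if "a < n" "c < n" for a c
        by (rule continuous_on_compose2[OF bc[OF that te]]) (auto intro!: continuous_intros)
      show ?thesis
        unfolding frame_form_entry[OF ij] by (intro continuous_intros c) auto
    qed
    define \<Gamma> where "\<Gamma> t = mat n n (\<lambda>(i, j). integral {0..1} (\<lambda>s. frame_form n (\<beta> t) s $$ (i, j)))" for t
    define \<kappa> where "\<kappa> i j = integral {0..1} (gd i j 0)" for i j
    note ifo = integral_first_order[where B = "\<lambda>t s. frame_form n (\<beta> t) s $$ (i, j)" and bd = "gd i j" and e = e for i j]
    have \<kappa>der: "((\<lambda>t. \<Gamma> t $$ (i, j)) has_vector_derivative \<kappa> i j) (at 0)" if ij: "i < n" "j < n" for i j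
      using ifo(1)[OF e gder gcont g0 gcs, OF ij _ ij ij ij] ij by (simp add: \<Gamma>_def \<kappa>_def)
    have "\<exists>K\<ge>0. eventually (\<lambda>t. \<forall>s\<in>{0..1}. cmod (frame_form n (\<beta> t) s $$ (i, j)) \<le> K * \<bar>t\<bar>) (nhds 0)" if ij: "i < n" "j < n" for i j
      using ifo(2)[OF e gder gcont g0 gcs, OF ij _ ij ij ij] .
    then have "\<forall>i\<in>{..<n}. \<forall>j\<in>{..<n}. \<exists>K\<ge>0. eventually (\<lambda>t. \<forall>s\<in>{0..1}. cmod (frame_form n (\<beta> t) s $$ (i, j)) \<le> K * \<bar>t\<bar>) (nhds 0)"
      by blast
    then obtain K where "\<forall>i\<in>{..<n}. \<forall>j\<in>{..<n}. K i j \<ge> 0 \<and> eventually (\<lambda>t. \<forall>s\<in>{0..1}. cmod (frame_form n (\<beta> t) s $$ (i, j)) \<le> K i j * \<bar>t\<bar>) (nhds 0)"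
      unfolding bchoice_iff by blast
    then have K: "\<And>i j. i < n \<Longrightarrow> j < n \<Longrightarrow> K i j \<ge> 0"
      "\<And>i j. i < n \<Longrightarrow> j < n \<Longrightarrow> eventually (\<lambda>t. \<forall>s\<in>{0..1}. cmod (frame_form n (\<beta> t) s $$ (i, j)) \<le> K i j * \<bar>t\<bar>) (nhds 0)"
      by blast+
    define K1 where "K1 = (\<Sum>i<n. \<Sum>j<n. K i j)"
    have K1: "K i j \<le> K1" if ij: "i < n" "j < n" for i j
    proof -
      have "K i j \<le> (\<Sum>j<n. K i j)" using ij K(1) by (intro member_le_sum) auto
      also have "\<dots> \<le> K1" unfolding K1_def using ij K(1) by (intro member_le_sum[of i _ "\<lambda>i. \<Sum>j<n. K i j"] sum_nonneg) auto
      finally show ?thesis .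
    qed
    have K10: "K1 \<ge> 0" unfolding K1_def using K(1) by (intro sum_nonneg) auto
    have evG: "eventually (\<lambda>t. \<forall>i\<in>{..<n}. \<forall>j\<in>{..<n}. \<forall>s\<in>{0..1}. cmod (frame_form n (\<beta> t) s $$ (i, j)) \<le> K1 * \<bar>t\<bar>) (nhds 0)"
    proof (rule eventually_ball_finite[OF finite_lessThan], rule ballI, rule eventually_ball_finite[OF finite_lessThan], rule ballI)
      fix i j assume "i \<in> {..<n}" "j \<in> {..<n}"
      then have ij: "i < n" "j < n" by auto
      show "eventually (\<lambda>t. \<forall>s\<in>{0..1}. cmod (frame_form n (\<beta> t) s $$ (i, j)) \<le> K1 * \<bar>t\<bar>) (nhds 0)"
        using K(2)[OF ij] by (rule eventually_mono) (meson K1[OF ij] abs_ge_zero mult_right_mono order_trans)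
    qed
    have evsmall: "eventually (\<lambda>t. 4 * real n * (K1 * \<bar>t\<bar>) \<le> 1) (nhds 0)"
      using eventually_abs_le[of 1 "4 * real n * K1"] by (simp add: mult.assoc)
    \<comment> \<open>The eigenvalues of the undeformed holonomy \<open>exp(- l T)\<close>. They
      increase with \<open>i\<close>, and their product is \<open>1\<close> because \<open>T\<close>
      has trace zero.\<close>
    define d where "d i = exp (- l * T_eig n i)" for i
    define D' where "D' = diag_w n (wexp n 1)"
    define C where "C t H H' = D' * (H * map_mat complex_of_real (\<delta> t loop) * H')" for t H H'
    define good where "good t H H' \<longleftrightarrow> conj_near_ad n (\<Gamma> t) (C t H H') (8 * (real n)\<^sup>2 * (K1 * \<bar>t\<bar>)\<^sup>2)" for t H H'
    define ok where "ok t \<longleftrightarrow> t \<in> {-e<..<e} \<and> (\<forall>i\<in>{..<n}. \<forall>j\<in>{..<n}. \<forall>s\<in>{0..1}. cmod (frame_form n (\<beta> t) s $$ (i, j)) \<le> K1 * \<bar>t\<bar>)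
       \<and> 4 * real n * (K1 * \<bar>t\<bar>) \<le> 1" for t
    have ev_ok: "eventually ok (nhds 0)"
      unfolding ok_def using ev_e evG evsmall by eventually_elim blast
    have "\<exists>H H'. H \<in> carrier_mat n n \<and> H' \<in> carrier_mat n n \<and> H * H' = 1\<^sub>m n \<and> H' * H = 1\<^sub>m n \<and> (ok t \<longrightarrow> good t H H')" for t
    proof (cases "ok t")
      case True
      then have te: "t \<in> {-e<..<e}" by (simp add: ok_def)
      have "\<exists>H\<in>carrier_mat n n. \<exists>H'\<in>carrier_mat n n. H * H' = 1\<^sub>m n \<and> H' * H = 1\<^sub>m n \<and> good t H H'"
        unfolding good_def C_def
      proof (rule holonomy_conjugation[OF G[OF te] n _ _ _ _ _ \<Gamma>_def D'_def])
        show "is_monodromy n A (\<gamma> 0) (form_add (D_form n h) (\<beta> t)) (\<delta> t)" using t[OF te] by blast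
        show "\<delta> t loop \<in> carrier_mat n n" using R[OF te] by blast
        show "continuous_on {0..1} (\<lambda>s. frame_form n (\<beta> t) s $$ (i, j))" if "i < n" "j < n" for i j by (rule gcs[OF that te])
        show "cmod (frame_form n (\<beta> t) s $$ (i, j)) \<le> K1 * \<bar>t\<bar>" if "s \<in> {0..1}" "i < n" "j < n" for s i j
          using True that by (auto simp: ok_def)
        show "4 * real n * (K1 * \<bar>t\<bar>) \<le> 1" using True by (simp add: ok_def)
      qed
      then show ?thesis by blast
    next
      case False
      then show ?thesis by (intro exI[of _ "1\<^sub>m n"]) auto
    qed
    then obtain H H' where H: "\<And>t. H t \<in> carrier_mat n n" "\<And>t. H' t \<in> carrier_mat n n" "\<And>t. H t * H' t = 1\<^sub>m n"
      "\<And>t. H' t * H t = 1\<^sub>m n" "\<And>t. ok t \<Longrightarrow> good t (H t) (H' t)"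
      by metis
    have gd0: "gd i j 0 s = (\<Sum>a<n. \<Sum>c<n. ?S' $$ (i, a) * (Q (l * s) * E0_mat n (k - 1) $$ (a, c) + cnj (Q (l * s)) * cnj (E0_mat n (k - 1) $$ (c, a))) * ?S $$ (c, j)) * (l * (wexp n s i / wexp n s j))"
      for i j s
      unfolding gd_def by (intro arg_cong2[where f = "(*)"] sum.cong refl) (simp add: bd0)
    have gint: "gd i j 0 integrable_on {0..1}" if ij: "i < n" "j < n" for i j
    proof -
      have "continuous_on {0..1::real} (\<lambda>s. (0::real, s))" by (intro continuous_on_Pair continuous_on_const continuous_on_id)
      moreover have "(\<lambda>s::real. (0::real, s)) ` {0..1} \<subseteq> {-e<..<e} \<times> {0..1}" using e by auto
      ultimately have "continuous_on {0..1} (gd i j 0)" using continuous_on_compose2[OF gcont[OF ij]] by fastforce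
      then show ?thesis by (rule integrable_continuous_interval)
    qed
    \<comment> \<open>On the diagonal the exponential weights cancel, so this is the trace of a
      conjugate; \<open>E0_mat n (k - 1)\<close> has zero diagonal because
      \<open>k - 1 > 0\<close>.\<close>
    have tr0: "(\<Sum>i<n. \<kappa> i i) = 0"
    proof -
      have "(\<Sum>i<n. \<kappa> i i) = integral {0..1} (\<lambda>s. \<Sum>i<n. gd i i 0 s)"
        unfolding \<kappa>_def using gint by (subst integral_sum) auto
      also have "(\<lambda>s. \<Sum>i<n. gd i i 0 s) = (\<lambda>s. 0)"
      proof
        fix s
        have "(\<Sum>i<n. gd i i 0 s) = (\<Sum>i<n. \<Sum>a<n. \<Sum>c<n. ?S' $$ (i, a) * (Q (l * s) * E0_mat n (k - 1) $$ (a, c) + cnj (Q (l * s)) * cnj (E0_mat n (k - 1) $$ (c, a))) * ?S $$ (c, i)) * l"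
          unfolding gd0 by (simp add: sum_distrib_right)
        also have "(\<Sum>i<n. \<Sum>a<n. \<Sum>c<n. ?S' $$ (i, a) * (Q (l * s) * E0_mat n (k - 1) $$ (a, c) + cnj (Q (l * s)) * cnj (E0_mat n (k - 1) $$ (c, a))) * ?S $$ (c, i))
           = (\<Sum>a<n. Q (l * s) * E0_mat n (k - 1) $$ (a, a) + cnj (Q (l * s)) * cnj (E0_mat n (k - 1) $$ (a, a)))"
          by (rule trace_conj) (auto simp: kraw_mult_inv)
        also have "\<dots> = 0" using k by (intro sum.neutral) (auto simp: E0_mat_entry)
        finally show "(\<Sum>i<n. gd i i 0 s) = 0" by simp
      qed
      finally show ?thesis by simp
    qed
    define N where "N = n - 1"
    have N: "N < n" using n by (simp add: N_def)
    define c0 where "c0 = (-1) ^ (k - 1) * fact (n - 1) / (2 ^ (k - 1) * fact (n - 1 - (k - 1)) :: real)"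
    \<comment> \<open>The weights cancel again, and \<open>Q\<close> and its conjugate are
      multiplied by the same real expectation \<open>c0\<close>, which leaves twice the real part of
      \<open>Q\<close>.\<close>
    have gdN: "gd N N 0 s = complex_of_real (2 * c0 * l * Re (Q (l * s)))" for s
    proof -
      have kn: "k - 1 < n" using k n by simp
      have "gd N N 0 s = (Q (l * s) * (\<Sum>a<n. \<Sum>c<n. ?S' $$ (N, a) * E0_mat n (k - 1) $$ (a, c) * ?S $$ (c, N))
          + cnj (Q (l * s)) * (\<Sum>a<n. \<Sum>c<n. ?S' $$ (N, a) * cnj (E0_mat n (k - 1) $$ (c, a)) * ?S $$ (c, N))) * l"
        unfolding gd0 by (simp add: sum_distrib_left sum.distrib distrib_left distrib_right mult_ac)
      also have "\<dots> = (Q (l * s) + cnj (Q (l * s))) * complex_of_real c0 * l"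
        unfolding N_def E0_mat_expectation[OF kn] c0_def by (simp only: distrib_right)
      also have "Q (l * s) + cnj (Q (l * s)) = complex_of_real (2 * Re (Q (l * s)))"
        by (rule complex_add_cnj)
      finally show ?thesis by simp
    qed
    have "((\<lambda>t. ln (largest_eigenvalue (\<delta> t loop))) has_real_derivative - Re (\<kappa> N N)) (at 0)"
    proof (rule ln_largest_eigenvalue_variation[OF n N _ _ _ refl, where H = H and H' = H' and \<Gamma> = \<Gamma> and \<kappa> = \<kappa> and D' = D' and d = d
          and K = "8 * (real n)\<^sup>2" and \<rho> = K1 and C = "\<lambda>t. C t (H t) (H' t)"])
      show "d i > 0" for i by (simp add: d_def)
      show "D' = diag_w n (\<lambda>i. 1 / complex_of_real (d i))"
        by (simp add: D'_def d_def exp_minus divide_inverse)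
      show "d i < d N" if "i < n" "i \<noteq> N" for i
      proof -
        have "i < N" using that by (simp add: N_def)
        then have "T_eig n N < T_eig n i" by (simp add: T_eig_def divide_strict_right_mono)
        then show ?thesis using l_pos by (simp add: d_def)
      qed
      have "(\<Sum>i<n. T_eig n i) = 0"
      proof -
        have "2 * (\<Sum>i<m. real i) = real m * (real m - 1)" for m by (induction m) (auto simp: algebra_simps)
        moreover have "real (n - 1) = real n - 1" using n by simp
        ultimately have "(\<Sum>i<n. real (n - 1) - 2 * real i) = 0"
          by (simp add: sum_subtractf sum_distrib_left[symmetric] del: of_nat_diff)
        then show ?thesis by (simp add: T_eig_def flip: sum_divide_distrib)
      qed
      then have "(\<Sum>i<n. - l * T_eig n i) = 0" by (simp only: sum_distrib_left[symmetric] mult_zero_right)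
      then show "(\<Prod>i<n. d i) = 1" unfolding d_def by (simp flip: exp_sum)
      show "eventually (\<lambda>t. \<delta> t loop \<in> carrier_mat n n \<and> det (\<delta> t loop) = 1) (nhds 0)"
        using ev_e by (rule eventually_mono) (rule R)
      show "eventually (\<lambda>t. \<Gamma> t \<in> carrier_mat n n \<and> (\<forall>i<n. \<forall>j<n. cmod (\<Gamma> t $$ (i, j)) \<le> K1 * \<bar>t\<bar>)) (nhds 0)"
        using ev_ok
      proof (rule eventually_mono, intro conjI allI impI)
        fix t i j assume o: "ok t" and ij: "i < n" "j < n"
        have "cmod (integral (cbox 0 1) (\<lambda>s. frame_form n (\<beta> t) s $$ (i, j))) \<le> K1 * \<bar>t\<bar> * content (cbox 0 1 :: real set)"
          using o ij K10 gcs[OF ij, of t] by (intro integrable_bound integrable_continuous) (auto simp: ok_def)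
        then show "cmod (\<Gamma> t $$ (i, j)) \<le> K1 * \<bar>t\<bar>" using ij by (simp add: \<Gamma>_def)
      qed (simp add: \<Gamma>_def)
      show "eventually (\<lambda>t. conj_near_ad n (\<Gamma> t) (C t (H t) (H' t)) (8 * (real n)\<^sup>2 * (K1 * \<bar>t\<bar>)\<^sup>2)) (nhds 0)"
        using ev_ok by (rule eventually_mono) (use H(5) in \<open>simp add: good_def\<close>)
    qed (use H \<kappa>der tr0 K10 in \<open>auto simp: C_def\<close>)
    moreover have "- Re (\<kappa> N N) = (-1) ^ k * fact (n - 1) / (2 ^ (k - 2) * fact (n - k)) * integral {0..l} (\<lambda>t. Re (Q t))"
    proof -
      obtain m where m: "k = Suc (Suc m)" using k by (metis Suc_le_D numeral_2_eq_2 Suc_le_mono)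
      have s: "gd N N 0 integrable_on {0..1}" by (rule gint[OF N N])
      have c0_nz: "c0 \<noteq> 0" by (simp add: c0_def)
      have "(\<lambda>s. Re (gd N N 0 s)) integrable_on {0..1}" using s integrable_linear[OF s bounded_linear_Re] by (simp add: o_def)
      then have "(\<lambda>s. Re (Q (l * s))) integrable_on {0..1}"
        using integrable_cmul[of "\<lambda>s. Re (gd N N 0 s)" "{0..1}" "1 / (2 * c0 * l)"] l_pos c0_nz by (simp add: gdN)
      then have h1: "((\<lambda>s. Re (Q (l * s))) has_integral integral {0..1} (\<lambda>s. Re (Q (l * s)))) (cbox 0 1)"
        by (simp add: integrable_integral)
      \<comment> \<open>Change of variable from the parameter of \<open>loop\<close> to arc length;
        it supplies the factor \<open>l\<close> that \<open>gdN\<close> carries.\<close>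
      have "((\<lambda>x. Re (Q (l * ((1 / l) *\<^sub>R x + 0)))) has_integral (integral {0..1} (\<lambda>s. Re (Q (l * s))) /\<^sub>R (1 / l) ^ DIM(real)))
         (cbox ((0 - 0) /\<^sub>R (1 / l)) ((1 - 0) /\<^sub>R (1 / l)))"
        using l_pos by (intro has_integral_affinity'[OF h1]) simp
      then have "((\<lambda>x. Re (Q x)) has_integral (l * integral {0..1} (\<lambda>s. Re (Q (l * s))))) {0..l}"
        using l_pos by (simp add: mult.commute)
      then have I: "integral {0..l} (\<lambda>x. Re (Q x)) = l * integral {0..1} (\<lambda>s. Re (Q (l * s)))" by (rule integral_unique)
      have "Re (\<kappa> N N) = integral {0..1} (\<lambda>s. Re (gd N N 0 s))"
        unfolding \<kappa>_def using integral_linear[OF s bounded_linear_Re] by (simp add: o_def)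
      also have "\<dots> = 2 * c0 * (l * integral {0..1} (\<lambda>s. Re (Q (l * s))))"
        by (simp add: gdN)
      finally have "- Re (\<kappa> N N) = (- 2 * c0) * integral {0..l} (\<lambda>x. Re (Q x))" unfolding I by simp
      \<comment> \<open>The minus sign changes \<open>(-1)^(k - 1)\<close> into
        \<open>(-1)^k\<close>, and the \<open>2\<close> cancels one of the \<open>k - 1\<close>
        factors in the denominator. Writing \<open>k\<close> as \<open>Suc (Suc m)\<close> keeps the
        subtractions of natural numbers exact.\<close>
      also have "- 2 * c0 = (-1) ^ k * fact (n - 1) / (2 ^ (k - 2) * fact (n - k))"
        by (simp add: c0_def m)
      finally show ?thesis .
    qed
    ultimately show ?case by (simp add: Q_def)
  qed
qed

end

theorem theorem1p0p2:
  fixes A :: "('a::t2_space) chart set"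
    and h :: "'a chart \<Rightarrow> 'a \<Rightarrow> real"
    and q :: "'a chart \<Rightarrow> 'a \<Rightarrow> complex"
    and \<gamma> :: "real \<Rightarrow> 'a"
    and l :: real
    and n k g :: nat
    and \<delta> :: "real \<Rightarrow> (real \<Rightarrow> 'a) \<Rightarrow> real mat"
  assumes "closed_riemann_surface A"
    and "surface_genus TYPE('a) g" and "g \<ge> 2"
    and "hyperbolic_metric A h"
    and "n \<ge> 2" and "2 \<le> k" and "k \<le> n"
    and "holomorphic_differential A k q"
    and "simple_closed_geodesic A h \<gamma> l"
    and "tangent_path n A h (\<gamma> 0) (psi0 n k h q) \<delta>"
  shows "((\<lambda>t. ln (largest_eigenvalue (\<delta> t (\<lambda>s. \<gamma> (l * s))))) has_real_derivative
           (-1) ^ k * fact (n - 1) / (2 ^ (k - 2) * fact (n - k)) *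
           integral {0..l} (\<lambda>t. Re (differential_along A k q \<gamma> t))) (at 0)"
proof -
  interpret closed_geodesic A h \<gamma> l
    using assms by unfold_locales (auto simp: closed_riemann_surface_def hyperbolic_metric_def)
  show ?thesis
    using ln_largest_eigenvalue_derivative[OF assms(5-7,10)] by (simp add: loop_def)
qed

end
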